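(* A compact manifold with vanishing first Betti number admits no radiant structure with symmetric Ricci tensor.
   Context: Manifolds are smooth, connected, without boundary. A radiant structure on a manifold is a pair $(\nabla,\mathbb E)$ comprising a torsion-free affine connection $\nabla$ and a vector field $\mathbb E$ such that $\nabla_X\mathbb E=X$ for all vector fields $X$. Its Ricci tensor is that of $\nabla$: $\mathrm{Ric}(X,Y)=\mathrm{tr}(Z\mapsto R(Z,X)Y)$ with $R(X,Y)Z=\nabla_X\nabla_YZ-\nabla_Y\nabla_XZ-\nabla_{[X,Y]}Z$. The first Betti number is the dimension of $H^1(M;\mathbb R)$. *)

theory Defs
  imports "HOL-Analysis.Analysis" "HOL-Homology.Homology"
begin

section \<open>Smooth maps between open subsets of Euclidean spaces\<close>

text \<open>Only meant for open \<open>S\<close>, so that the derivatives at points of \<open>S\<close> do not depend on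
  the values of the function outside \<open>S\<close>.\<close>

primrec Ck_on :: "nat \<Rightarrow> 'a::real_normed_vector set \<Rightarrow> ('a \<Rightarrow> 'b::real_normed_vector) \<Rightarrow> bool" where
  "Ck_on 0 S f \<longleftrightarrow> continuous_on S f"
| "Ck_on (Suc k) S f \<longleftrightarrow> (\<forall>x\<in>S. f differentiable (at x)) \<and>
      (\<forall>v. Ck_on k S (\<lambda>x. frechet_derivative f (at x) v))"

definition smooth_on :: "'a::real_normed_vector set \<Rightarrow> ('a \<Rightarrow> 'b::real_normed_vector) \<Rightarrow> bool" where
  "smooth_on S f \<longleftrightarrow> (\<forall>k. Ck_on k S f)"

section \<open>Smooth manifolds\<close>

text \<open>The points of the manifold are the elements of the type \<^typ>\<open>'m\<close>. A chart is a pair of its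
  domain \<open>U\<close> and a map that matters on \<open>U\<close> only. The dimension is \<^term>\<open>CARD('n)\<close>, which is
  positive.\<close>

type_synonym ('m, 'n) chart = "'m set \<times> ('m \<Rightarrow> real ^ 'n)"

definition is_chart :: "('m::topological_space, 'n::finite) chart \<Rightarrow> bool" where
  "is_chart c \<longleftrightarrow> open (fst c) \<and> open (snd c ` fst c) \<and>
     homeomorphism (fst c) (snd c ` fst c) (snd c) (inv_into (fst c) (snd c))"

definition in_chart :: "('m, 'n::finite) chart \<Rightarrow> ('m \<Rightarrow> 'b) \<Rightarrow> real ^ 'n \<Rightarrow> 'b" where
  "in_chart c f = f \<circ> inv_into (fst c) (snd c)"

text \<open>A not necessarily maximal atlas; it determines the smooth structure.\<close>

definition smooth_atlas :: "('m::topological_space, 'n::finite) chart set \<Rightarrow> bool" where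
  "smooth_atlas A \<longleftrightarrow> (\<forall>c\<in>A. is_chart c) \<and> (\<Union>c\<in>A. fst c) = UNIV \<and>
     (\<forall>c\<in>A. \<forall>d\<in>A. smooth_on (snd c ` (fst c \<inter> fst d)) (in_chart c (snd d)))"

definition smooth_manifold ::
    "('m::{t2_space, second_countable_topology}, 'n::finite) chart set \<Rightarrow> bool" where
  "smooth_manifold A \<longleftrightarrow> smooth_atlas A \<and> connected (UNIV :: 'm set)"

definition smooth_functions :: "('m, 'n::finite) chart set \<Rightarrow> ('m \<Rightarrow> real) set" where
  "smooth_functions A = {f. \<forall>c\<in>A. smooth_on (snd c ` fst c) (in_chart c f)}"

section \<open>Vector fields\<close>

text \<open>The derivative of \<open>f\<close> at \<open>p\<close> in the direction of the tangent vector whose components in the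
  chart \<open>c\<close> are \<open>v\<close>.\<close>

definition chart_deriv ::
    "('m, 'n::finite) chart \<Rightarrow> ('m \<Rightarrow> 'b::real_normed_vector) \<Rightarrow> 'm \<Rightarrow> real ^ 'n \<Rightarrow> 'b" where
  "chart_deriv c f p v = frechet_derivative (in_chart c f) (at (snd c p)) v"

text \<open>A tangent vector at \<open>p\<close> is a family of component vectors, one for each chart around \<open>p\<close>,
  related by the Jacobians of the transition maps. Accordingly \<open>X c p\<close> are the components with
  respect to \<open>c\<close> of the value of the vector field \<open>X\<close> at \<open>p\<close>. Off the domain of \<open>c\<close> they are set
  to zero, so that equality of vector fields is equality in HOL.\<close>

type_synonym ('m, 'n) field = "('m, 'n) chart \<Rightarrow> 'm \<Rightarrow> real ^ 'n"

definition vector_fields :: "('m, 'n::finite) chart set \<Rightarrow> ('m, 'n) field set" where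
  "vector_fields A = {X.
     (\<forall>c p. \<not> (c \<in> A \<and> p \<in> fst c) \<longrightarrow> X c p = 0) \<and>
     (\<forall>c\<in>A. \<forall>d\<in>A. \<forall>p \<in> fst c \<inter> fst d. X d p = chart_deriv c (snd d) p (X c p)) \<and>
     (\<forall>c\<in>A. smooth_on (snd c ` fst c) (in_chart c (X c)))}"

definition lie_bracket ::
    "('m, 'n::finite) chart set \<Rightarrow> ('m, 'n) field \<Rightarrow> ('m, 'n) field \<Rightarrow> ('m, 'n) field" where
  "lie_bracket A X Y = (\<lambda>c p. if c \<in> A \<and> p \<in> fst c
     then chart_deriv c (Y c) p (X c p) - chart_deriv c (X c) p (Y c p) else 0)"

section \<open>Affine connections and their curvature\<close>

type_synonym ('m, 'n) connection = "('m, 'n) field \<Rightarrow> ('m, 'n) field \<Rightarrow> ('m, 'n) field"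

text \<open>In the Leibniz rule, \<open>chart_deriv c f p (X c p)\<close> is the value of the function \<open>X f\<close> at \<open>p\<close>.\<close>

definition affine_connection :: "('m, 'n::finite) chart set \<Rightarrow> ('m, 'n) connection \<Rightarrow> bool" where
  "affine_connection A nabla \<longleftrightarrow>
     (\<forall>X\<in>vector_fields A. \<forall>Y\<in>vector_fields A. nabla X Y \<in> vector_fields A) \<and>
     (\<forall>X\<in>vector_fields A. \<forall>X'\<in>vector_fields A. \<forall>Y\<in>vector_fields A.
        nabla (\<lambda>c p. X c p + X' c p) Y = (\<lambda>c p. nabla X Y c p + nabla X' Y c p)) \<and>
     (\<forall>f\<in>smooth_functions A. \<forall>X\<in>vector_fields A. \<forall>Y\<in>vector_fields A.
        nabla (\<lambda>c p. f p *\<^sub>R X c p) Y = (\<lambda>c p. f p *\<^sub>R nabla X Y c p)) \<and>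
     (\<forall>X\<in>vector_fields A. \<forall>Y\<in>vector_fields A. \<forall>Y'\<in>vector_fields A.
        nabla X (\<lambda>c p. Y c p + Y' c p) = (\<lambda>c p. nabla X Y c p + nabla X Y' c p)) \<and>
     (\<forall>f\<in>smooth_functions A. \<forall>X\<in>vector_fields A. \<forall>Y\<in>vector_fields A.
        nabla X (\<lambda>c p. f p *\<^sub>R Y c p) =
          (\<lambda>c p. f p *\<^sub>R nabla X Y c p + chart_deriv c f p (X c p) *\<^sub>R Y c p))"

definition torsion_free :: "('m, 'n::finite) chart set \<Rightarrow> ('m, 'n) connection \<Rightarrow> bool" where
  "torsion_free A nabla \<longleftrightarrow> (\<forall>X\<in>vector_fields A. \<forall>Y\<in>vector_fields A.
     (\<lambda>c p. nabla X Y c p - nabla Y X c p) = lie_bracket A X Y)"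

definition radiant_structure ::
    "('m, 'n::finite) chart set \<Rightarrow> ('m, 'n) connection \<Rightarrow> ('m, 'n) field \<Rightarrow> bool" where
  "radiant_structure A nabla E \<longleftrightarrow> affine_connection A nabla \<and> torsion_free A nabla \<and>
     E \<in> vector_fields A \<and> (\<forall>X\<in>vector_fields A. nabla X E = X)"

definition curvature :: "('m, 'n::finite) chart set \<Rightarrow> ('m, 'n) connection \<Rightarrow>
    ('m, 'n) field \<Rightarrow> ('m, 'n) field \<Rightarrow> ('m, 'n) field \<Rightarrow> ('m, 'n) field" where
  "curvature A nabla X Y Z = (\<lambda>c p. nabla X (nabla Y Z) c p - nabla Y (nabla X Z) c p
     - nabla (lie_bracket A X Y) Z c p)"

text \<open>The endomorphism \<open>Z \<mapsto> R(Z,X)Y\<close> of the tangent space at \<open>p\<close>, written in the chart \<open>c\<close>: the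
  vector with components \<open>v\<close> is extended to a vector field. For an affine connection, curvature is
  tensorial and the choice of the extension is immaterial; nor does the trace depend on the chart.\<close>

definition curvature_endo :: "('m, 'n::finite) chart set \<Rightarrow> ('m, 'n) connection \<Rightarrow>
    ('m, 'n) field \<Rightarrow> ('m, 'n) field \<Rightarrow> ('m, 'n) chart \<Rightarrow> 'm \<Rightarrow> real ^ 'n \<Rightarrow> real ^ 'n" where
  "curvature_endo A nabla X Y c p v =
     curvature A nabla (SOME Z. Z \<in> vector_fields A \<and> Z c p = v) X Y c p"

definition ricci :: "('m, 'n::finite) chart set \<Rightarrow> ('m, 'n) connection \<Rightarrow>
    ('m, 'n) field \<Rightarrow> ('m, 'n) field \<Rightarrow> 'm \<Rightarrow> real" where
  "ricci A nabla X Y p =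
     (let c = (SOME c. c \<in> A \<and> p \<in> fst c) in trace (matrix (curvature_endo A nabla X Y c p)))"

definition ricci_symmetric :: "('m, 'n::finite) chart set \<Rightarrow> ('m, 'n) connection \<Rightarrow> bool" where
  "ricci_symmetric A nabla \<longleftrightarrow> (\<forall>X\<in>vector_fields A. \<forall>Y\<in>vector_fields A. \<forall>p.
     ricci A nabla X Y p = ricci A nabla Y X p)"

section \<open>Singular cohomology with real coefficients\<close>

text \<open>Cochains are real functions on the set of singular simplices (extended by zero), which
  amounts to homomorphisms from the free abelian group of singular chains to the reals.\<close>

definition singular_cochains :: "nat \<Rightarrow> 'a topology \<Rightarrow> (((nat \<Rightarrow> real) \<Rightarrow> 'a) \<Rightarrow> real) set" where
  "singular_cochains p T = {u. \<forall>s. \<not> singular_simplex p T s \<longrightarrow> u s = 0}"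

definition singular_coboundary :: "nat \<Rightarrow> 'a topology \<Rightarrow>
    (((nat \<Rightarrow> real) \<Rightarrow> 'a) \<Rightarrow> real) \<Rightarrow> ((nat \<Rightarrow> real) \<Rightarrow> 'a) \<Rightarrow> real" where
  "singular_coboundary p T u = (\<lambda>s. if singular_simplex (Suc p) T s
     then (\<Sum>k\<le>Suc p. (-1) ^ k * u (singular_face (Suc p) k s)) else 0)"

definition cocycles :: "nat \<Rightarrow> 'a topology \<Rightarrow> (((nat \<Rightarrow> real) \<Rightarrow> 'a) \<Rightarrow> real) set" where
  "cocycles p T = {u \<in> singular_cochains p T. singular_coboundary p T u = (\<lambda>_. 0)}"

fun coboundaries :: "nat \<Rightarrow> 'a topology \<Rightarrow> (((nat \<Rightarrow> real) \<Rightarrow> 'a) \<Rightarrow> real) set" where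
  "coboundaries 0 T = {\<lambda>_. 0}"
| "coboundaries (Suc p) T = singular_coboundary p T ` singular_cochains p T"

text \<open>The dimension of \<open>V / W\<close>, for spaces \<open>W \<subseteq> V\<close> of real functions, as the supremum of the sizes
  of finite subsets of \<open>V\<close> that are linearly independent modulo \<open>W\<close>.\<close>

definition independent_modulo :: "('a \<Rightarrow> real) set \<Rightarrow> ('a \<Rightarrow> real) set \<Rightarrow> bool" where
  "independent_modulo W S \<longleftrightarrow>
     (\<forall>a. (\<lambda>x. \<Sum>u\<in>S. a u * u x) \<in> W \<longrightarrow> (\<forall>u\<in>S. a u = 0))"

definition quotient_dim :: "('a \<Rightarrow> real) set \<Rightarrow> ('a \<Rightarrow> real) set \<Rightarrow> enat" where
  "quotient_dim V W = (SUP S \<in> {S. finite S \<and> S \<subseteq> V \<and> independent_modulo W S}. enat (card S))"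

definition betti_number :: "nat \<Rightarrow> 'a topology \<Rightarrow> enat" where
  "betti_number p T = quotient_dim (cocycles p T) (coboundaries p T)"

end

theory Submission
  imports Defs
begin

text \<open>Let \<open>n\<close> be the dimension. If the Ricci tensor of a torsion-free connection is symmetric, the first
  Bianchi identity makes the trace of its curvature vanish, so in a coordinate ball the trace of the
  connection form is closed and has a primitive \<open>f\<close>; the density \<open>exp f\<close> is then parallel. The local
  parallel densities are unique up to positive constants, and the resulting monodromy in the positive
  reals is trivial because the first Betti number vanishes. So there is a global parallel density
  \<open>\<mu>\<close>. Since \<open>\<nabla>E\<close> is the identity, the divergence of \<open>E\<close> with respect to \<open>\<mu>\<close> is the constant \<open>n\<close>,
  whereas its integral over a compact manifold is \<open>0\<close> by the divergence theorem.\<close>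

section \<open>Calculus of smooth maps\<close>

text \<open>A density is used rather than a volume form because vanishing of the first Betti number
  does not give an orientation. Densities transform by the absolute value of the Jacobian
  determinant, so logarithms turn the gluing problem into one about additive real constants, which
  real cohomology can resolve. The hypothesis speaks of singular cochains on merely continuous
  simplices, along which the trace of the connection form cannot be integrated. Increments of local
  primitives replace the integral; all that matters is that the discrepancy of two primitives is
  constant on connected subsets of the overlap. A connection acts on global vector fields only, so
  its local nature and its coordinate expression have to be recovered by cut-off functions. Likewise
  Ricci curvature is defined through an arbitrary chart and arbitrary extensions of tangent vectors,
  and both choices have to be shown immaterial. No integral over the manifold is ever defined:
  functions supported in one coordinate ball are integrated there, and a finite partition of unity
  assembles the total.\<close>

lemma frechet_derivative_cong_open:
  assumes "open S" "x \<in> S" "\<And>y. y \<in> S \<Longrightarrow> f y = g y"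
  shows "frechet_derivative f (at x) = frechet_derivative g (at x)"
proof -
  have "(f has_derivative D) (at x) \<longleftrightarrow> (g has_derivative D) (at x)" for D
    using assms by (metis has_derivative_transform_within_open)
  then show ?thesis by (simp add: frechet_derivative_def)
qed

lemma frechet_derivative_eqI: "(f has_derivative D) (at x) \<Longrightarrow> frechet_derivative f (at x) v = D v"
  by (metis frechet_derivative_at)

lemma has_derivative_frechet:
  "f differentiable (at x) \<Longrightarrow> (f has_derivative frechet_derivative f (at x)) (at x)"
  by (simp add: frechet_derivative_works)

lemma Ck_on_imp_continuous_on: "Ck_on k S f \<Longrightarrow> continuous_on S f"
  by (cases k)
    (auto intro!: continuous_at_imp_continuous_on simp: differentiable_imp_continuous_within)

text \<open>The recursion does not display this inclusion: at the base, differentiability gives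
  continuity, and above it the claim passes to the directional derivatives.\<close>

lemma Ck_on_SucD: "Ck_on (Suc k) S f \<Longrightarrow> Ck_on k S f"
proof (induction k arbitrary: f)
  case 0
  then show ?case using Ck_on_imp_continuous_on[OF 0] by simp
next
  case (Suc k)
  then show ?case by simp
qed

lemma Ck_on_subset: "Ck_on k S f \<Longrightarrow> T \<subseteq> S \<Longrightarrow> Ck_on k T f"
  by (induction k arbitrary: f) (auto intro: continuous_on_subset)

lemma Ck_on_cong:
  assumes "open S" "\<And>x. x \<in> S \<Longrightarrow> f x = g x" "Ck_on k S f"
  shows "Ck_on k S g"
  using assms(2,3)
proof (induction k arbitrary: f g)
  case 0
  then show ?case by (simp cong: continuous_on_cong)
next
  case (Suc k)
  have eq: "frechet_derivative f (at x) = frechet_derivative g (at x)" if "x \<in> S" for x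
    by (rule frechet_derivative_cong_open[OF \<open>open S\<close> that]) (simp add: Suc.prems)
  have "g differentiable (at x)" if "x \<in> S" for x
    using Suc.prems that \<open>open S\<close>
    by (metis Ck_on.simps(2) differentiable_def has_derivative_transform_within_open)
  moreover have "Ck_on k S (\<lambda>x. frechet_derivative g (at x) v)" for v
    by (rule Suc.IH[of "\<lambda>x. frechet_derivative f (at x) v"]) (use Suc.prems eq in auto)
  ultimately show ?case by simp
qed

lemma Ck_on_local:
  assumes "\<And>x. x \<in> S \<Longrightarrow> \<exists>T. open T \<and> x \<in> T \<and> Ck_on k T f"
  shows "Ck_on k S f"
  using assms
proof (induction k arbitrary: f)
  case 0
  then show ?case
    by (auto intro!: continuous_at_imp_continuous_on simp: continuous_on_eq_continuous_at)
      (metis continuous_on_eq_continuous_at)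
next
  case (Suc k)
  then show ?case by (simp, metis)
qed

text \<open>On an open set the directional derivatives demanded by \<open>Ck_on\<close> agree with
  any explicit formula \<open>D\<close>, so later inductions can work with the rules of calculus
  instead of \<open>frechet_derivative\<close>.\<close>

lemma Ck_on_SucI:
  assumes "open S" "\<And>x. x \<in> S \<Longrightarrow> (f has_derivative D x) (at x)" "\<And>v. Ck_on k S (\<lambda>x. D x v)"
  shows "Ck_on (Suc k) S f"
proof -
  have "Ck_on k S (\<lambda>x. frechet_derivative f (at x) v)" for v
    by (rule Ck_on_cong[OF assms(1) _ assms(3)[of v]])
      (simp add: frechet_derivative_eqI[OF assms(2)])
  then show ?thesis using assms(2) by (auto simp: differentiable_def)
qed

lemma Ck_on_const: "open S \<Longrightarrow> Ck_on k S (\<lambda>_. c)"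
proof (induction k arbitrary: c)
  case (Suc k)
  show ?case by (rule Ck_on_SucI[where D="\<lambda>_ _. 0"]) (use Suc in auto)
qed simp

lemma Ck_on_bounded_linear_comp:
  assumes "bounded_linear L" "open S" "Ck_on k S f"
  shows "Ck_on k S (\<lambda>x. L (f x))"
  using assms(3)
proof (induction k arbitrary: f)
  case 0
  then show ?case using assms(1) by (simp add: bounded_linear.continuous_on)
next
  case (Suc k)
  show ?case
  proof (rule Ck_on_SucI[where D="\<lambda>x v. L (frechet_derivative f (at x) v)"])
    fix x assume "x \<in> S"
    then show "((\<lambda>x. L (f x)) has_derivative (\<lambda>v. L (frechet_derivative f (at x) v))) (at x)"
      using Suc.prems by (intro bounded_linear.has_derivative[OF assms(1)] has_derivative_frechet) auto
  qed (use Suc assms in auto)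
qed

lemma Ck_on_bounded_linear:
  assumes "bounded_linear L" "open S"
  shows "Ck_on k S L"
proof (cases k)
  case 0
  then show ?thesis using assms by (simp add: linear_continuous_on)
next
  case (Suc j)
  show ?thesis unfolding Suc
    by (rule Ck_on_SucI[where D="\<lambda>_. L"])
      (use assms in \<open>auto intro: Ck_on_const bounded_linear_imp_has_derivative\<close>)
qed

lemma Ck_on_add:
  assumes "open S" "Ck_on k S f" "Ck_on k S g"
  shows "Ck_on k S (\<lambda>x. f x + g x)"
  using assms(2,3)
proof (induction k arbitrary: f g)
  case 0
  then show ?case by (simp add: continuous_on_add)
next
  case (Suc k)
  show ?case
  proof (rule Ck_on_SucI[where D="\<lambda>x v. frechet_derivative f (at x) v + frechet_derivative g (at x) v"])
    fix x assume "x \<in> S"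
    then show "((\<lambda>x. f x + g x) has_derivative
        (\<lambda>v. frechet_derivative f (at x) v + frechet_derivative g (at x) v)) (at x)"
      using Suc.prems by (intro has_derivative_add has_derivative_frechet) auto
  qed (use Suc assms in auto)
qed

text \<open>One product rule serves multiplication, scaling and inner products. The derivative
  contains the factors themselves, which are only as smooth as the induction requires after
  \<open>Ck_on_SucD\<close>.\<close>

lemma Ck_on_bilinear:
  assumes "bounded_bilinear pr" "open S" "Ck_on k S f" "Ck_on k S g"
  shows "Ck_on k S (\<lambda>x. pr (f x) (g x))"
  using assms(3,4)
proof (induction k arbitrary: f g)
  case 0
  then show ?case using assms(1) by (simp add: bounded_bilinear.continuous_on)
next
  case (Suc k)
  show ?case
  proof (rule Ck_on_SucI[where D="\<lambda>x v. pr (f x) (frechet_derivative g (at x) v) +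
        pr (frechet_derivative f (at x) v) (g x)"])
    fix x assume "x \<in> S"
    then show "((\<lambda>x. pr (f x) (g x)) has_derivative (\<lambda>v. pr (f x) (frechet_derivative g (at x) v) +
        pr (frechet_derivative f (at x) v) (g x))) (at x)"
      using Suc.prems
      by (intro bounded_bilinear.FDERIV[OF assms(1)] has_derivative_frechet) auto
  next
    fix v
    have "Ck_on k S f" "Ck_on k S g" using Suc.prems Ck_on_SucD by blast+
    then show "Ck_on k S (\<lambda>x. pr (f x) (frechet_derivative g (at x) v) +
        pr (frechet_derivative f (at x) v) (g x))"
      using Suc.prems assms(2) by (intro Ck_on_add Suc.IH) auto
  qed (use assms in auto)
qed

lemma Ck_on_sum:
  assumes "open S" "\<And>i. i \<in> I \<Longrightarrow> Ck_on k S (f i)"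
  shows "Ck_on k S (\<lambda>x. \<Sum>i\<in>I. f i x)"
  using assms by (induction I rule: infinite_finite_induct) (auto intro: Ck_on_add Ck_on_const)

text \<open>In the chain rule the direction in which \<open>g\<close> is differentiated varies with
  the point, whereas \<open>Ck_on\<close> controls fixed directions only. Expanding that direction
  in the finite basis turns the derivative into a sum of products to which the induction applies;
  this is why the middle space is Euclidean.\<close>

lemma Ck_on_compose:
  fixes f :: "'a::real_normed_vector \<Rightarrow> 'b::euclidean_space" and g :: "'b \<Rightarrow> 'c::real_normed_vector"
  assumes "open S" "open T" "Ck_on k S f" "Ck_on k T g" "f ` S \<subseteq> T"
  shows "Ck_on k S (\<lambda>x. g (f x))"
  using assms(3,4)
proof (induction k arbitrary: g)
  case 0
  then show ?case using assms(5) by (auto intro: continuous_on_compose2)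
next
  case (Suc k)
  let ?D = "\<lambda>x v. \<Sum>b\<in>Basis. (frechet_derivative f (at x) v \<bullet> b) *\<^sub>R frechet_derivative g (at (f x)) b"
  show ?case
  proof (rule Ck_on_SucI[where D="?D"])
    fix x assume x: "x \<in> S"
    have df: "(f has_derivative frechet_derivative f (at x)) (at x)"
      using Suc.prems x by (auto intro: has_derivative_frechet)
    have dg: "(g has_derivative frechet_derivative g (at (f x))) (at (f x))"
      using Suc.prems x assms(5) by (intro has_derivative_frechet) auto
    have "((\<lambda>x. g (f x)) has_derivative (\<lambda>v. frechet_derivative g (at (f x)) (frechet_derivative f (at x) v))) (at x)"
      using diff_chain_at[OF df dg] by (simp add: o_def)
    moreover have "frechet_derivative g (at (f x)) w = (\<Sum>b\<in>Basis. (w \<bullet> b) *\<^sub>R frechet_derivative g (at (f x)) b)" for w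
    proof -
      interpret linear "frechet_derivative g (at (f x))"
        using dg has_derivative_linear by blast
      show ?thesis by (subst euclidean_representation[of w, symmetric]) (simp add: sum scale)
    qed
    then have "frechet_derivative g (at (f x)) (frechet_derivative f (at x) v) = ?D x v" for v .
    ultimately show "((\<lambda>x. g (f x)) has_derivative ?D x) (at x)" by (simp only:)
  next
    fix v
    have "Ck_on k S f" using Suc.prems Ck_on_SucD by blast
    then have "Ck_on k S (\<lambda>x. frechet_derivative g (at (f x)) b)" for b
      by (rule Suc.IH) (use Suc.prems in auto)
    moreover have "Ck_on k S (\<lambda>x. frechet_derivative f (at x) v \<bullet> b)" for b
      using Suc.prems assms(1) by (intro Ck_on_bounded_linear_comp[OF bounded_linear_inner_left]) auto
    ultimately show "Ck_on k S (\<lambda>x. ?D x v)"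
      using assms(1) by (intro Ck_on_sum Ck_on_bilinear[OF bounded_bilinear_scaleR])
  qed (use assms in auto)
qed

text \<open>The derivative of the reciprocal is built from the reciprocal itself and the derivative
  of \<open>f\<close>, so regularity is gained one order at a time.\<close>

lemma Ck_on_inverse:
  fixes f :: "'a::real_normed_vector \<Rightarrow> real"
  assumes "open S" "\<And>x. x \<in> S \<Longrightarrow> f x \<noteq> 0" "Ck_on k S f"
  shows "Ck_on k S (\<lambda>x. inverse (f x))"
  using assms(3)
proof (induction k)
  case 0
  then show ?case using assms(2) by (auto intro: continuous_on_inverse)
next
  case (Suc k)
  show ?case
  proof (rule Ck_on_SucI[where D="\<lambda>x v. - (inverse (f x) * frechet_derivative f (at x) v * inverse (f x))"])
    fix x assume "x \<in> S"
    then show "((\<lambda>x. inverse (f x)) has_derivative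
        (\<lambda>v. - (inverse (f x) * frechet_derivative f (at x) v * inverse (f x)))) (at x)"
      using Suc.prems assms(2) by (intro Deriv.has_derivative_inverse has_derivative_frechet) auto
  next
    fix v
    have "Ck_on k S (\<lambda>x. inverse (f x))" using Suc Ck_on_SucD by blast
    then show "Ck_on k S (\<lambda>x. - (inverse (f x) * frechet_derivative f (at x) v * inverse (f x)))"
      using Suc.prems assms(1)
      by (intro Ck_on_bounded_linear_comp[OF bounded_linear_minus[OF bounded_linear_ident]]
          Ck_on_bilinear[OF bounded_bilinear_mult]) auto
  qed (use assms in auto)
qed

lemma smooth_on_imp_continuous_on: "smooth_on S f \<Longrightarrow> continuous_on S f"
  unfolding smooth_on_def using Ck_on.simps(1) by blast

lemma smooth_on_subset: "smooth_on S f \<Longrightarrow> T \<subseteq> S \<Longrightarrow> smooth_on T f"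
  unfolding smooth_on_def using Ck_on_subset by blast

lemma smooth_on_cong: "open S \<Longrightarrow> (\<And>x. x \<in> S \<Longrightarrow> f x = g x) \<Longrightarrow> smooth_on S f \<Longrightarrow> smooth_on S g"
  unfolding smooth_on_def using Ck_on_cong by blast

lemma smooth_on_local:
  assumes "\<And>x. x \<in> S \<Longrightarrow> \<exists>T. open T \<and> x \<in> T \<and> smooth_on T f"
  shows "smooth_on S f"
  unfolding smooth_on_def
proof
  fix k show "Ck_on k S f"
    by (rule Ck_on_local) (use assms in \<open>force simp: smooth_on_def\<close>)
qed

lemma smooth_on_differentiable: "smooth_on S f \<Longrightarrow> x \<in> S \<Longrightarrow> f differentiable (at x)"
  unfolding smooth_on_def by (metis Ck_on.simps(2))

lemma smooth_on_has_derivative: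
  "smooth_on S f \<Longrightarrow> x \<in> S \<Longrightarrow> (f has_derivative frechet_derivative f (at x)) (at x)"
  by (simp add: has_derivative_frechet smooth_on_differentiable)

lemma smooth_on_frechet_derivative: "smooth_on S f \<Longrightarrow> smooth_on S (\<lambda>x. frechet_derivative f (at x) v)"
  unfolding smooth_on_def by (metis Ck_on.simps(2))

lemma smooth_on_const: "open S \<Longrightarrow> smooth_on S (\<lambda>_. c)"
  by (simp add: smooth_on_def Ck_on_const)

lemma smooth_on_bounded_linear: "bounded_linear L \<Longrightarrow> open S \<Longrightarrow> smooth_on S L"
  by (simp add: smooth_on_def Ck_on_bounded_linear)

lemma smooth_on_bounded_linear_comp:
  "bounded_linear L \<Longrightarrow> open S \<Longrightarrow> smooth_on S f \<Longrightarrow> smooth_on S (\<lambda>x. L (f x))"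
  by (simp add: smooth_on_def Ck_on_bounded_linear_comp)

lemma smooth_on_add: "open S \<Longrightarrow> smooth_on S f \<Longrightarrow> smooth_on S g \<Longrightarrow> smooth_on S (\<lambda>x. f x + g x)"
  by (simp add: smooth_on_def Ck_on_add)

lemma smooth_on_bilinear:
  "bounded_bilinear pr \<Longrightarrow> open S \<Longrightarrow> smooth_on S f \<Longrightarrow> smooth_on S g \<Longrightarrow> smooth_on S (\<lambda>x. pr (f x) (g x))"
  by (simp add: smooth_on_def Ck_on_bilinear)

lemmas smooth_on_mult = smooth_on_bilinear[OF bounded_bilinear_mult]
lemmas smooth_on_scaleR = smooth_on_bilinear[OF bounded_bilinear_scaleR]

lemma smooth_on_diff:
  assumes "open S" "smooth_on S f" "smooth_on S g"
  shows "smooth_on S (\<lambda>x. f x - g x)"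
  using smooth_on_add[OF assms(1,2)
      smooth_on_bounded_linear_comp[OF bounded_linear_minus[OF bounded_linear_ident] assms(1,3)]]
  by simp

lemma smooth_on_sum:
  "open S \<Longrightarrow> (\<And>i. i \<in> I \<Longrightarrow> smooth_on S (f i)) \<Longrightarrow> smooth_on S (\<lambda>x. \<Sum>i\<in>I. f i x)"
  by (simp add: smooth_on_def Ck_on_sum)

lemma smooth_on_compose:
  fixes f :: "'a::real_normed_vector \<Rightarrow> 'b::euclidean_space"
  assumes "open S" "open T" "smooth_on S f" "smooth_on T g" "f ` S \<subseteq> T"
  shows "smooth_on S (\<lambda>x. g (f x))"
  using assms Ck_on_compose unfolding smooth_on_def by blast

lemma smooth_on_inverse:
  fixes f :: "'a::real_normed_vector \<Rightarrow> real"
  shows "open S \<Longrightarrow> (\<And>x. x \<in> S \<Longrightarrow> f x \<noteq> 0) \<Longrightarrow> smooth_on S f \<Longrightarrow> smooth_on S (\<lambda>x. inverse (f x))"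
  by (simp add: smooth_on_def Ck_on_inverse)

section \<open>Smooth bump functions\<close>

text \<open>For \<open>P = 1\<close> this is the classical function exp(-1/x), extended by zero. The
  polynomial factor makes the family closed under differentiation.\<close>

definition flat :: "real poly \<Rightarrow> real \<Rightarrow> real" where
  "flat P x = (if x > 0 then poly P (inverse x) * exp (- inverse x) else 0)"

lemma poly_times_exp_tendsto_0: "((\<lambda>t. poly P t * exp (- t)) \<longlongrightarrow> 0) (at_top :: real filter)"
proof -
  have "((\<lambda>t. \<Sum>i\<le>degree P. Polynomial.coeff P i * (t ^ i / exp t)) \<longlongrightarrow> (\<Sum>i\<le>degree P. Polynomial.coeff P i * 0)) at_top"
    by (intro tendsto_sum tendsto_mult tendsto_const tendsto_power_div_exp_0)
  moreover have "(\<Sum>i\<le>degree P. Polynomial.coeff P i * (t ^ i / exp t)) = poly P t * exp (- t)" for t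
    by (simp add: poly_altdef sum_distrib_right sum_distrib_left exp_minus divide_inverse mult_ac)
  ultimately show ?thesis by simp
qed

text \<open>Differentiating P(1/x) exp(-1/x) multiplies P - P' by the square of 1/x, which is the
  polynomial \<open>[:0, 0, 1:]\<close>. At the origin the difference quotient is again of this
  type, with \<open>pCons 0 P\<close> in place of \<open>P\<close>, and exponential decay beats
  every polynomial.\<close>

lemma flat_has_derivative:
  "(flat P has_real_derivative flat ([:0, 0, 1:] * (P - pderiv P)) x) (at x)"
proof (cases x "0::real" rule: linorder_cases)
  case less
  have "((\<lambda>_. 0) has_real_derivative 0) (at x)" by simp
  then have "(flat P has_real_derivative 0) (at x)"
    by (rule has_field_derivative_transform_within_open[of _ _ _ "{..<0}"]) (use less in \<open>auto simp: flat_def\<close>)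
  then show ?thesis using less by (simp add: flat_def)
next
  case greater
  have "((\<lambda>x. poly P (inverse x) * exp (- inverse x)) has_real_derivative
      flat ([:0, 0, 1:] * (P - pderiv P)) x) (at x)"
    using greater
    by (auto intro!: derivative_eq_intros simp: flat_def field_simps power2_eq_square)
  then show ?thesis
    by (rule has_field_derivative_transform_within_open[of _ _ _ "{0<..}"]) (use greater in \<open>auto simp: flat_def\<close>)
next
  case equal
  have r: "((\<lambda>h. flat P h / h) \<longlongrightarrow> 0) (at_right 0)"
  proof -
    have "((\<lambda>h. poly (pCons 0 P) (inverse h) * exp (- inverse h)) \<longlongrightarrow> 0) (at_right 0)"
      using poly_times_exp_tendsto_0 filterlim_inverse_at_top_right by (rule filterlim_compose)
    then show ?thesis
      by (rule Lim_transform_eventually)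
        (auto simp: flat_def eventually_at_right_field field_simps intro!: exI[of _ 1])
  qed
  have l: "((\<lambda>h. flat P h / h) \<longlongrightarrow> 0) (at_left 0)"
    by (rule Lim_transform_eventually[OF tendsto_const])
       (auto simp: flat_def eventually_at_left_field intro!: exI[of _ "-1"])
  have "((\<lambda>h. flat P h / h) \<longlongrightarrow> 0) (at 0)" using l r by (simp add: filterlim_split_at)
  then show ?thesis using equal by (simp add: has_field_derivative_iff flat_def)
qed

lemma smooth_on_flat: "smooth_on UNIV (flat P)"
proof -
  have "Ck_on k UNIV (flat P)" for k
  proof (induction k arbitrary: P)
    case 0
    show ?case
      using flat_has_derivative by (auto intro!: continuous_at_imp_continuous_on DERIV_isCont)
  next
    case (Suc k)
    show ?case
    proof (rule Ck_on_SucI[where D="\<lambda>x v. flat ([:0, 0, 1:] * (P - pderiv P)) x * v"])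
      fix x :: real
      show "(flat P has_derivative (\<lambda>v. flat ([:0, 0, 1:] * (P - pderiv P)) x * v)) (at x)"
        using flat_has_derivative has_field_derivative_def by blast
    next
      fix v
      show "Ck_on k UNIV (\<lambda>x. flat ([:0, 0, 1:] * (P - pderiv P)) x * v)"
        using Suc.IH Ck_on_bounded_linear_comp[OF bounded_linear_mult_left] by blast
    qed simp
  qed
  then show ?thesis by (simp add: smooth_on_def)
qed

lemma smooth_bump_exists:
  fixes a :: "'a::euclidean_space"
  assumes "0 < r" "r < R"
  obtains \<psi> :: "'a \<Rightarrow> real" where "smooth_on UNIV \<psi>" "\<And>x. x \<in> cball a r \<Longrightarrow> \<psi> x = 1"
    "\<And>x. x \<notin> ball a R \<Longrightarrow> \<psi> x = 0" "\<And>x. 0 \<le> \<psi> x \<and> \<psi> x \<le> 1"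
proof
  \<comment> \<open>The squared distance is smooth even at the centre. \<open>u\<close> is positive
    exactly within distance \<open>R\<close> and \<open>w\<close> exactly beyond distance
    \<open>r\<close>; as r < R they never vanish together, and u / (u + w) is the bump.\<close>
  define N where "N = (\<lambda>x::'a. (x - a) \<bullet> (x - a))"
  define u where "u = (\<lambda>x. flat 1 (R\<^sup>2 - N x))"
  define w where "w = (\<lambda>x. flat 1 (N x - r\<^sup>2))"
  have N: "N x = (dist a x)\<^sup>2" for x
    by (simp add: N_def dist_norm power2_norm_eq_inner inner_commute inner_diff_left inner_diff_right)
  have id: "smooth_on UNIV (\<lambda>x::'a. x)"
    by (rule smooth_on_bounded_linear) (auto simp: bounded_linear_ident)
  have sN: "smooth_on UNIV N"
    unfolding N_def
    by (intro smooth_on_bilinear[OF bounded_bilinear_inner] smooth_on_diff smooth_on_const id) auto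
  have su: "smooth_on UNIV u" unfolding u_def
    by (rule smooth_on_compose[OF _ _ _ smooth_on_flat])
      (auto intro!: smooth_on_diff smooth_on_const sN)
  have sw: "smooth_on UNIV w" unfolding w_def
    by (rule smooth_on_compose[OF _ _ _ smooth_on_flat])
      (auto intro!: smooth_on_diff smooth_on_const sN)
  have u0: "u x \<ge> 0" and w0: "w x \<ge> 0" for x by (auto simp: u_def w_def flat_def)
  have upos: "u x > 0 \<longleftrightarrow> dist a x < R" for x
    using assms by (simp add: u_def flat_def N power_mono_iff flip: not_le)
  have wpos: "w x > 0 \<longleftrightarrow> r < dist a x" for x
    using assms by (simp add: w_def flat_def N power_mono_iff flip: not_le)
  have pos: "u x + w x > 0" for x
    using upos[of x] wpos[of x] u0[of x] w0[of x] assms by (cases "dist a x < R") (auto simp: add_pos_nonneg add_nonneg_pos)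
  show "smooth_on UNIV (\<lambda>x. u x * inverse (u x + w x))"
    by (intro smooth_on_mult smooth_on_inverse smooth_on_add su sw)
      (use pos in \<open>auto simp: less_imp_neq[THEN not_sym]\<close>)
  show "u x * inverse (u x + w x) = 1" if "x \<in> cball a r" for x
  proof -
    have "w x = 0" using wpos[of x] w0[of x] that by force
    then show ?thesis using pos[of x] by (simp add: field_simps)
  qed
  show "u x * inverse (u x + w x) = 0" if "x \<notin> ball a R" for x
    using upos[of x] u0[of x] that by force
  show "0 \<le> u x * inverse (u x + w x) \<and> u x * inverse (u x + w x) \<le> 1" for x
    using u0[of x] w0[of x] pos[of x] by (simp add: field_simps)
qed

section \<open>Analysis in Euclidean space\<close>

text \<open>In the Leibniz expansion a permutation other than the identity moves at least two
  indices. Differentiating one of the two off-diagonal factors leaves the other one, which is zero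
  at the identity matrix; only the diagonal term survives.\<close>

lemma det_has_derivative_at_1:
  fixes A :: "'a::real_normed_vector \<Rightarrow> real ^ 'n ^ 'n"
  assumes A: "(A has_derivative A') (at x)" and 1: "A x = mat 1"
  shows "((\<lambda>x. det (A x)) has_derivative (\<lambda>h. trace (A' h))) (at x)"
proof -
  have entry: "((\<lambda>x. A x $ i $ j) has_derivative (\<lambda>h. A' h $ i $ j)) (at x)" for i j
    using bounded_linear.has_derivative[OF bounded_linear_vec_nth
        bounded_linear.has_derivative[OF bounded_linear_vec_nth A]] .
  let ?D = "\<lambda>h. \<Sum>p | p permutes (UNIV::'n set).
      of_int (sign p) * (\<Sum>i\<in>UNIV. A' h $ i $ p i * (\<Prod>j\<in>UNIV - {i}. A x $ j $ p j))"
  have "((\<lambda>x. det (A x)) has_derivative ?D) (at x)"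
    unfolding det_def
    by (intro has_derivative_sum has_derivative_mult_right has_derivative_prod entry)
  moreover have "?D h = trace (A' h)" for h
  proof -
    have "(\<Sum>i\<in>UNIV. A' h $ i $ p i * (\<Prod>j\<in>UNIV - {i}. A x $ j $ p j)) = 0"
      if p: "p permutes (UNIV::'n set)" "p \<noteq> id" for p
    proof (intro sum.neutral ballI)
      fix i :: 'n
      have "\<exists>j. j \<noteq> i \<and> p j \<noteq> j"
      proof (rule ccontr)
        assume *: "\<not> ?thesis"
        then have "p i = i" using permutes_inj[OF p(1)] by (metis injD)
        with * have "p = id" by (auto simp: fun_eq_iff)
        with p(2) show False by simp
      qed
      then obtain j where j: "j \<noteq> i" "p j \<noteq> j" by blast
      then have "(\<Prod>j\<in>UNIV - {i}. A x $ j $ p j) = 0"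
        by (intro prod_zero) (auto simp: 1 mat_def intro!: bexI[of _ j])
      then show "A' h $ i $ p i * (\<Prod>j\<in>UNIV - {i}. A x $ j $ p j) = 0" by simp
    qed
    then have "?D h = (\<Sum>p\<in>{id}. of_int (sign p) * (\<Sum>i\<in>UNIV. A' h $ i $ p i * (\<Prod>j\<in>UNIV - {i}. A x $ j $ p j)))"
      by (intro sum.mono_neutral_right) (auto simp: permutes_id finite_permutations)
    also have "\<dots> = trace (A' h)" by (simp add: trace_def 1 mat_def)
    finally show ?thesis .
  qed
  ultimately show ?thesis by simp
qed

text \<open>Multiplication by the constant matrix \<open>K\<close> moves the base point to the
  identity and changes the logarithm only by the constant ln |det K|. The absolute value covers both
  signs of the determinant.\<close>

lemma ln_abs_det_has_derivative:
  fixes J :: "'a::real_normed_vector \<Rightarrow> real ^ 'n ^ 'n"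
  assumes J: "(J has_derivative J') (at x)" and K: "K ** J x = mat 1"
  shows "((\<lambda>x. ln \<bar>det (J x)\<bar>) has_derivative (\<lambda>h. trace (K ** J' h))) (at x)"
proof -
  have KJ: "((\<lambda>y. K ** J y) has_derivative (\<lambda>h. K ** J' h)) (at x)"
  proof (rule bounded_linear.has_derivative[OF _ J])
    have "linear (\<lambda>A. K ** A)"
      by (intro linearI) (simp_all add: matrix_add_ldistrib matrix_scalar_ac scalar_matrix_assoc flip: scalar_mult_eq_scaleR)
    then show "bounded_linear (\<lambda>A. K ** A)" by (simp add: linear_conv_bounded_linear)
  qed
  have d: "((\<lambda>y. det (K ** J y)) has_derivative (\<lambda>h. trace (K ** J' h))) (at x)"
    by (rule det_has_derivative_at_1[OF KJ K])
  have detK: "det K \<noteq> 0" using K det_mul[of K "J x"] by (metis det_I mult_zero_left zero_neq_one)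
  have "((\<lambda>y. ln (det (K ** J y))) has_derivative (\<lambda>h. trace (K ** J' h) * inverse (det (K ** J x)))) (at x)"
    using d K by (intro has_derivative_ln) auto
  then have "((\<lambda>y. ln (det (K ** J y))) has_derivative (\<lambda>h. trace (K ** J' h))) (at x)"
    by (simp add: K)
  then have "((\<lambda>y. ln (det (K ** J y)) - ln \<bar>det K\<bar>) has_derivative (\<lambda>h. trace (K ** J' h))) (at x)"
    using has_derivative_diff[OF _ has_derivative_const] by fastforce
  moreover have "\<forall>\<^sub>F y in at x. ln (det (K ** J y)) - ln \<bar>det K\<bar> = ln \<bar>det (J y)\<bar>"
  proof -
    have "((\<lambda>y. det (K ** J y)) \<longlongrightarrow> det (K ** J x)) (at x)"
      using has_derivative_continuous[OF d] by (simp add: continuous_at)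
    then have "\<forall>\<^sub>F y in at x. det (K ** J y) > 0"
      by (rule order_tendstoD) (simp add: K)
    then show ?thesis
    proof (rule eventually_mono)
      fix y assume pos: "det (K ** J y) > 0"
      then have "det (J y) \<noteq> 0" by (auto simp: det_mul)
      moreover have "det (K ** J y) = \<bar>det K\<bar> * \<bar>det (J y)\<bar>"
        using pos by (simp add: det_mul flip: abs_mult)
      ultimately show "ln (det (K ** J y)) - ln \<bar>det K\<bar> = ln \<bar>det (J y)\<bar>"
        using detK by (simp add: ln_mult)
    qed
  qed
  moreover have "ln (det (K ** J x)) - ln \<bar>det K\<bar> = ln \<bar>det (J x)\<bar>"
  proof -
    have "det K * det (J x) = 1" using K by (metis det_I det_mul)
    then have "\<bar>det K\<bar> * \<bar>det (J x)\<bar> = 1" by (metis abs_mult abs_1)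
    moreover have "det (J x) \<noteq> 0" using \<open>det K * det (J x) = 1\<close> by auto
    ultimately have "ln \<bar>det K\<bar> + ln \<bar>det (J x)\<bar> = 0"
      using detK by (metis ln_mult ln_one abs_eq_0)
    then show ?thesis by (simp add: K)
  qed
  ultimately show ?thesis by (rule has_derivative_transform_eventually) simp
qed

section \<open>Poincare lemma on a ball\<close>

text \<open>The primitive is the integral of the form along the radius from the centre.
  Differentiation under the integral sign gives its derivative, and symmetry of \<open>D\<close>,
  that is closedness, makes the resulting integrand an exact derivative in the radial
  parameter.\<close>

lemma primitive_on_ball:
  fixes \<alpha> :: "'a::euclidean_space \<Rightarrow> 'a"
  assumes r: "0 < r"
    and d\<alpha>: "\<And>x. x \<in> ball a r \<Longrightarrow> (\<alpha> has_derivative D x) (at x)"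
    and contD: "\<And>v. continuous_on (ball a r) (\<lambda>x. D x v)"
    and sym: "\<And>x u v. x \<in> ball a r \<Longrightarrow> D x u \<bullet> v = D x v \<bullet> u"
  obtains f :: "'a \<Rightarrow> real" where "\<And>x. x \<in> ball a r \<Longrightarrow> (f has_derivative (\<lambda>v. \<alpha> x \<bullet> v)) (at x)"
proof -
  let ?B = "ball a r"
  define p where "p = (\<lambda>x t. a + t *\<^sub>R (x - a))"
  have p: "p x t \<in> ?B" if "x \<in> ?B" "t \<in> {0..1::real}" for x t
  proof -
    have "dist a (p x t) = \<bar>t\<bar> * dist a x"
      by (simp add: p_def dist_norm norm_minus_commute)
    also have "\<dots> \<le> 1 * dist a x" using that by (intro mult_right_mono) auto
    finally show ?thesis using that by simp
  qed
  have lin: "bounded_linear (D x)" if "x \<in> ?B" for x using d\<alpha>[OF that] by (rule has_derivative_bounded_linear)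
  \<comment> \<open>The product rule for the radial integrand, packaged as a bounded linear function
    because differentiation under the integral sign is stated for those.\<close>
  define fx where "fx = (\<lambda>x t. Blinfun (\<lambda>v. \<alpha> (p x t) \<bullet> v + D (p x t) (t *\<^sub>R v) \<bullet> (x - a)))"
  have fx: "blinfun_apply (fx x t) = (\<lambda>v. \<alpha> (p x t) \<bullet> v + D (p x t) (t *\<^sub>R v) \<bullet> (x - a))"
    if "x \<in> ?B" "t \<in> {0..1}" for x t
    unfolding fx_def
  proof (rule bounded_linear_Blinfun_apply)
    have "bounded_linear (\<lambda>v. D (p x t) (t *\<^sub>R v))"
      by (rule bounded_linear_compose[OF lin[OF p[OF that]] bounded_linear_scaleR_right])
    then show "bounded_linear (\<lambda>v. \<alpha> (p x t) \<bullet> v + D (p x t) (t *\<^sub>R v) \<bullet> (x - a))"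
      by (intro bounded_linear_add bounded_linear_inner_right
          bounded_linear_compose[OF bounded_linear_inner_left])
  qed
  have contp: "continuous_on (?B \<times> {0..1}) (\<lambda>z. p (fst z) (snd z))"
    unfolding p_def by (intro continuous_intros)
  have cont\<alpha>: "continuous_on ?B \<alpha>"
    using d\<alpha> by (meson continuous_at_imp_continuous_on has_derivative_continuous)
  have contfx: "continuous_on (?B \<times> cbox 0 1) (\<lambda>(x, t). fx x t)"
  proof (rule continuous_on_blinfun_componentwise)
    fix v :: 'a
    have "continuous_on (?B \<times> {0..1}) (\<lambda>z. \<alpha> (p (fst z) (snd z)) \<bullet> v
        + snd z * (D (p (fst z) (snd z)) v \<bullet> (fst z - a)))"
      by (intro continuous_intros continuous_on_compose2[OF cont\<alpha> contp]
          continuous_on_compose2[OF contD contp]) (use p in auto)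
    then show "continuous_on (?B \<times> cbox 0 1) (\<lambda>z. blinfun_apply (case z of (x, t) \<Rightarrow> fx x t) v)"
      unfolding cbox_interval by (rule continuous_on_eq)
        (auto simp: fx linear_simps[OF lin[OF p]])
  qed
  define f where "f = (\<lambda>x. integral (cbox 0 1) (\<lambda>t. \<alpha> (p x t) \<bullet> (x - a)))"
  show thesis
  proof
    fix x assume x: "x \<in> ?B"
    have "(f has_derivative blinfun_apply (integral (cbox 0 1) (fx x))) (at x within ?B)"
      unfolding f_def
    proof (rule leibniz_rule[OF _ _ contfx x])
      fix x t assume xt: "x \<in> ?B" "t \<in> cbox 0 (1::real)"
      have dp: "((\<lambda>x. p x t) has_derivative (\<lambda>v. t *\<^sub>R v)) (at x within ?B)"
        unfolding p_def by (auto intro!: derivative_eq_intros)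
      have "(\<alpha> has_derivative D (p x t)) (at (p x t))" using p xt d\<alpha> by auto
      then have "((\<lambda>x. \<alpha> (p x t)) has_derivative (\<lambda>v. D (p x t) (t *\<^sub>R v))) (at x within ?B)"
        by (rule has_derivative_compose[OF dp])
      then have "((\<lambda>x. \<alpha> (p x t) \<bullet> (x - a)) has_derivative
          (\<lambda>v. \<alpha> (p x t) \<bullet> v + D (p x t) (t *\<^sub>R v) \<bullet> (x - a))) (at x within ?B)"
        by (auto intro!: derivative_eq_intros)
      then show "((\<lambda>x. \<alpha> (p x t) \<bullet> (x - a)) has_derivative blinfun_apply (fx x t)) (at x within ?B)"
        using fx xt by simp
    next
      fix x assume x: "x \<in> ?B"
      have "continuous_on {0..1} (p x)" unfolding p_def by (intro continuous_intros)
      then have "continuous_on {0..1} (\<lambda>t. \<alpha> (p x t) \<bullet> (x - a))"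
        by (intro continuous_intros continuous_on_compose2[OF cont\<alpha>]) (use p x in auto)
      then show "(\<lambda>t. \<alpha> (p x t) \<bullet> (x - a)) integrable_on cbox 0 1"
        by (simp add: integrable_continuous_real)
    qed (auto simp: convex_ball)
    then have df: "(f has_derivative blinfun_apply (integral (cbox 0 1) (fx x))) (at x)"
      using at_within_open[OF x] by simp
    have "blinfun_apply (integral (cbox 0 1) (fx x)) v = \<alpha> x \<bullet> v" for v
    proof -
      have "continuous_on (cbox 0 1) (\<lambda>t. (\<lambda>(x, t). fx x t) (x, t))"
        by (rule continuous_on_compose2[OF contfx]) (use x in \<open>auto intro!: continuous_intros\<close>)
      then have "fx x integrable_on cbox 0 1"
        using integrable_continuous[of 0 1 "fx x"] by simp
      then have "blinfun_apply (integral (cbox 0 1) (fx x)) v = integral (cbox 0 1) (\<lambda>t. blinfun_apply (fx x t) v)"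
        by (rule blinfun_apply_integral)
      also have "\<dots> = \<alpha> x \<bullet> v"
      proof (rule integral_unique)
        \<comment> \<open>The factor \<open>t\<close> kills the lower end point, so the fundamental
          theorem leaves exactly the value of the form at \<open>x\<close>. Symmetry of
          \<open>D\<close> exchanges the radial direction with \<open>v\<close>.\<close>
        have "((\<lambda>t. blinfun_apply (fx x t) v) has_integral (1 * (\<alpha> (p x 1) \<bullet> v) - 0 * (\<alpha> (p x 0) \<bullet> v))) {0..1}"
        proof (rule fundamental_theorem_of_calculus)
          fix t :: real assume t: "t \<in> {0..1}"
          have dp: "(p x has_derivative (\<lambda>h. h *\<^sub>R (x - a))) (at t within {0..1})"
            unfolding p_def by (auto intro!: derivative_eq_intros)
          have "(\<alpha> has_derivative D (p x t)) (at (p x t))" using p x t d\<alpha> by auto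
          then have "((\<lambda>t. \<alpha> (p x t)) has_derivative (\<lambda>h. D (p x t) (h *\<^sub>R (x - a)))) (at t within {0..1})"
            by (rule has_derivative_compose[OF dp])
          then have "((\<lambda>t. t * (\<alpha> (p x t) \<bullet> v)) has_derivative
              (\<lambda>h. t * (D (p x t) (h *\<^sub>R (x - a)) \<bullet> v) + h * (\<alpha> (p x t) \<bullet> v))) (at t within {0..1})"
            by (auto intro!: derivative_eq_intros)
          moreover have "t * (D (p x t) (h *\<^sub>R (x - a)) \<bullet> v) + h * (\<alpha> (p x t) \<bullet> v) =
              h *\<^sub>R blinfun_apply (fx x t) v" for h
          proof -
            have "D (p x t) (h *\<^sub>R (x - a)) \<bullet> v = h * (D (p x t) v \<bullet> (x - a))"
              using sym[OF p[OF x t], of "h *\<^sub>R (x - a)" v] by simp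
            moreover have "blinfun_apply (fx x t) v = \<alpha> (p x t) \<bullet> v + t * (D (p x t) v \<bullet> (x - a))"
              using x t by (simp add: fx linear_scale[OF bounded_linear.linear[OF lin[OF p[OF x t]]]])
            ultimately show ?thesis by (simp only: real_scaleR_def) argo
          qed
          ultimately show "((\<lambda>t. t * (\<alpha> (p x t) \<bullet> v)) has_vector_derivative blinfun_apply (fx x t) v) (at t within {0..1})"
            by (simp only: has_vector_derivative_def)
        qed simp
        then show "((\<lambda>t. blinfun_apply (fx x t) v) has_integral \<alpha> x \<bullet> v) (cbox 0 1)"
          by (simp add: p_def)
      qed
      finally show ?thesis .
    qed
    then have "blinfun_apply (integral (cbox 0 1) (fx x)) = (\<lambda>v. \<alpha> x \<bullet> v)" by (rule ext)
    with df show "(f has_derivative (\<lambda>v. \<alpha> x \<bullet> v)) (at x)" by simp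
  qed
qed

section \<open>Integrals of compactly supported functions and of their derivatives\<close>

lemma integrable_continuous_bounded_support:
  fixes f :: "'a::euclidean_space \<Rightarrow> real"
  assumes "continuous_on UNIV f" "\<And>x. x \<notin> cball a r \<Longrightarrow> f x = 0"
  shows "integrable lborel f"
proof -
  have "integrable lborel (\<lambda>x. indicator (cball a r) x *\<^sub>R f x)"
    by (rule borel_integrable_compact) (use assms in \<open>auto intro: continuous_on_subset\<close>)
  also have "(\<lambda>x. indicator (cball a r) x *\<^sub>R f x) = f"
    using assms(2) by (auto simp: fun_eq_iff indicator_def)
  finally show ?thesis .
qed

lemma lborel_integral_translation:
  fixes f :: "'a::euclidean_space \<Rightarrow> real"
  assumes "integrable lborel f"
  shows "integrable lborel (\<lambda>x. f (c + x))" "(\<integral>x. f (c + x) \<partial>lborel) = (\<integral>x. f x \<partial>lborel)"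
proof -
  have m: "f \<in> borel_measurable borel" using assms by auto
  show "integrable lborel (\<lambda>x. f (c + x))"
    using assms integrable_distr_eq[of "(+) c" lborel borel f] m by (simp add: lborel_distr_plus)
  show "(\<integral>x. f (c + x) \<partial>lborel) = (\<integral>x. f x \<partial>lborel)"
    using integral_distr[of "(+) c" lborel borel f] m by (simp add: lborel_distr_plus)
qed

text \<open>Difference quotients have integral zero because Lebesgue measure is translation
  invariant. By the mean value theorem they are bounded uniformly, so dominated convergence carries
  the zero over to the directional derivative without iterated integrals.\<close>

lemma integral_directional_derivative_0:
  fixes g :: "'a::euclidean_space \<Rightarrow> real"
  assumes dg: "\<And>x. (g has_derivative g' x) (at x)"
    and cont: "continuous_on UNIV (\<lambda>x. g' x v)"
    and supp: "\<And>x. x \<notin> cball a r \<Longrightarrow> g x = 0"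
  shows "integrable lborel (\<lambda>x. g' x v)" "(\<integral>x. g' x v \<partial>lborel) = 0"
proof -
  have supp': "g' x v = 0" if "x \<notin> cball a r" for x
  proof -
    have "((\<lambda>_. 0) has_derivative g' x) (at x)"
      by (rule has_derivative_transform_within_open[OF dg, of "- cball a r"]) (use supp that in auto)
    then have "g' x = (\<lambda>_. 0)" using has_derivative_unique has_derivative_const by blast
    then show ?thesis by simp
  qed
  show int': "integrable lborel (\<lambda>x. g' x v)"
    using integrable_continuous_bounded_support[OF cont supp'] .
  have "bounded ((\<lambda>x. g' x v) ` cball a r)"
    using cont by (intro compact_imp_bounded compact_continuous_image) (auto intro: continuous_on_subset)
  then obtain M where M0: "M > 0" "\<And>y. y \<in> (\<lambda>x. g' x v) ` cball a r \<Longrightarrow> norm y \<le> M"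
    unfolding bounded_pos by blast
  have M: "\<bar>g' x v\<bar> \<le> M" for x
    using supp'[of x] M0(1) M0(2)[of "g' x v"] by (cases "x \<in> cball a r") auto
  have gc: "continuous_on UNIV g" using dg by (meson continuous_at_imp_continuous_on has_derivative_continuous)
  have gi: "integrable lborel g" using integrable_continuous_bounded_support[OF gc supp] .
  \<comment> \<open>Steps of size at most 1 keep the supports of all difference quotients in the
    ball of radius \<open>r + norm v\<close>, where a constant is an integrable majorant.\<close>
  define e where "e = (\<lambda>n. inverse (real (Suc n)))"
  have e: "0 < e n" "e n \<le> 1" for n by (simp_all add: e_def field_simps)
  define h where "h = (\<lambda>n x. (g (e n *\<^sub>R v + x) - g x) / e n)"
  have lim: "(\<lambda>n. h n x) \<longlonglongrightarrow> g' x v" for x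
  proof -
    have "((\<lambda>t. x + t *\<^sub>R v) has_derivative (\<lambda>t. t *\<^sub>R v)) (at 0)"
      by (auto intro!: derivative_eq_intros)
    then have "((\<lambda>t. g (x + t *\<^sub>R v)) has_derivative (\<lambda>t. g' x (t *\<^sub>R v))) (at 0)"
      using has_derivative_compose[of "\<lambda>t. x + t *\<^sub>R v" _ 0 UNIV g "g' x"] dg[of x] by simp
    moreover have "g' x (t *\<^sub>R v) = g' x v * t" for t
      using has_derivative_bounded_linear[OF dg[of x]] by (simp add: linear_simps)
    ultimately have "((\<lambda>t. g (x + t *\<^sub>R v)) has_real_derivative g' x v) (at 0)"
      by (simp add: has_field_derivative_def)
    then have "((\<lambda>t. (g (x + t *\<^sub>R v) - g x) / t) \<longlongrightarrow> g' x v) (at 0)"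
      by (simp add: has_field_derivative_iff)
    moreover have "filterlim e (at 0) sequentially"
      unfolding filterlim_at e_def using LIMSEQ_inverse_real_of_nat by auto
    ultimately have "(\<lambda>n. (g (x + e n *\<^sub>R v) - g x) / e n) \<longlonglongrightarrow> g' x v"
      by (rule filterlim_compose)
    then show ?thesis by (simp add: h_def add.commute)
  qed
  have bound: "\<bar>h n x\<bar> \<le> M" for n x
  proof -
    have "\<exists>\<xi>\<in>{0..e n}. g (x + e n *\<^sub>R v) - g (x + 0 *\<^sub>R v) = g' (x + \<xi> *\<^sub>R v) ((e n - 0) *\<^sub>R v)"
    proof (rule mvt_very_simple)
      fix t
      have "((\<lambda>t. x + t *\<^sub>R v) has_derivative (\<lambda>t. t *\<^sub>R v)) (at t within {0..e n})"
        by (auto intro!: derivative_eq_intros)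
      then show "((\<lambda>t. g (x + t *\<^sub>R v)) has_derivative (\<lambda>s. g' (x + t *\<^sub>R v) (s *\<^sub>R v))) (at t within {0..e n})"
        using has_derivative_compose dg by blast
    qed (use e[of n] in simp)
    then obtain \<xi> where "g (x + e n *\<^sub>R v) - g x = g' (x + \<xi> *\<^sub>R v) (e n *\<^sub>R v)" by auto
    also have "\<dots> = e n * g' (x + \<xi> *\<^sub>R v) v"
      using has_derivative_bounded_linear[OF dg] by (simp add: linear_simps)
    finally have "h n x = g' (x + \<xi> *\<^sub>R v) v" using e[of n] by (simp add: h_def add.commute)
    then show ?thesis using M by simp
  qed
  have hsupp: "h n x = 0" if "x \<notin> cball a (r + norm v)" for n x
  proof -
    have far: "r + norm v < dist a x" using that by simp
    have "dist a x \<le> dist a (e n *\<^sub>R v + x) + norm (e n *\<^sub>R v)"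
      by (metis add_diff_cancel_right' dist_norm dist_triangle dist_commute)
    moreover have "norm (e n *\<^sub>R v) \<le> norm v" using e[of n] by (simp add: mult_left_le_one_le)
    ultimately have "e n *\<^sub>R v + x \<notin> cball a r" "x \<notin> cball a r"
      using far norm_ge_zero[of v] unfolding mem_cball by linarith+
    then show ?thesis using supp by (simp add: h_def)
  qed
  have "(\<lambda>n. \<integral>x. h n x \<partial>lborel) \<longlonglongrightarrow> (\<integral>x. g' x v \<partial>lborel)"
  proof (rule integral_dominated_convergence[where w = "\<lambda>x. indicator (cball a (r + norm v)) x *\<^sub>R M"])
    show "(\<lambda>x. g' x v) \<in> borel_measurable lborel" using int' by auto
    show "h n \<in> borel_measurable lborel" for n
    proof -
      have "g \<in> borel_measurable borel" using gc by (rule borel_measurable_continuous_onI)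
      then show ?thesis unfolding h_def by measurable
    qed
    show "integrable lborel (\<lambda>x. indicator (cball a (r + norm v)) x *\<^sub>R M)"
      by (rule borel_integrable_compact) auto
    show "AE x in lborel. (\<lambda>n. h n x) \<longlonglongrightarrow> g' x v" using lim by simp
    show "AE x in lborel. norm (h n x) \<le> indicator (cball a (r + norm v)) x *\<^sub>R M" for n
      using bound hsupp by (intro AE_I2) (auto simp: indicator_def)
  qed
  moreover have "(\<integral>x. h n x \<partial>lborel) = 0" for n
    unfolding h_def using lborel_integral_translation[OF gi, of "e n *\<^sub>R v"] gi by simp
  ultimately show "(\<integral>x. g' x v \<partial>lborel) = 0" by (simp add: LIMSEQ_const_iff)
qed

text \<open>The ball and the complement of \<open>K\<close> are open and cover the space. Extension
  by zero is therefore differentiable everywhere: on one set it is \<open>g\<close>, on the other it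
  vanishes. Nothing is asked of \<open>g\<close> near the boundary of the ball beyond its vanishing
  off \<open>K\<close>.\<close>

lemma cutoff_derivative_integral_0:
  fixes g :: "'a::euclidean_space \<Rightarrow> real"
  assumes K: "compact K" "K \<subseteq> ball a r" and supp: "\<And>y. y \<in> ball a r - K \<Longrightarrow> g y = 0"
    and dg: "\<And>y. y \<in> ball a r \<Longrightarrow> (g has_derivative g' y) (at y)"
    and cont: "continuous_on (ball a r) (\<lambda>y. g' y v)"
  shows "integrable lborel (\<lambda>y. if y \<in> ball a r then g' y v else 0)"
    "(\<integral>y. (if y \<in> ball a r then g' y v else 0) \<partial>lborel) = 0"
proof -
  let ?B = "ball a r"
  define G where "G = (\<lambda>y. if y \<in> ?B then g y else 0)"
  define G' where "G' = (\<lambda>y h. if y \<in> ?B then g' y h else 0)"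
  have oK: "open (- K)" using K(1) by (simp add: compact_imp_closed open_Compl)
  have off: "(G has_derivative (\<lambda>_. 0)) (at y)" if "y \<notin> K" for y
    by (rule has_derivative_transform_within_open[of "\<lambda>_. 0", OF _ oK]) (use that supp in \<open>auto simp: G_def\<close>)
  have dG: "(G has_derivative G' y) (at y)" for y
  proof (cases "y \<in> ?B")
    case True
    have "(G has_derivative g' y) (at y)"
      by (rule has_derivative_transform_within_open[OF dg[OF True] open_ball True]) (simp add: G_def)
    then show ?thesis using True by (simp add: G'_def)
  next
    case False
    then have "y \<notin> K" "G' y = (\<lambda>_. 0)" using K by (auto simp: G'_def)
    then show ?thesis using off by simp
  qed
  have zero: "G' y = (\<lambda>_. 0)" if "y \<notin> K" for y
    using has_derivative_unique[OF dG off[OF that]] .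
  have "continuous_on (?B \<union> - K) (\<lambda>y. G' y v)"
  proof (rule continuous_on_open_Un[OF open_ball oK])
    show "continuous_on ?B (\<lambda>y. G' y v)"
      using cont by (rule continuous_on_eq) (simp add: G'_def)
    show "continuous_on (- K) (\<lambda>y. G' y v)"
      using continuous_on_const[of "- K" 0] by (rule continuous_on_eq) (simp add: zero)
  qed
  moreover have "?B \<union> - K = UNIV" using K by blast
  ultimately have cG: "continuous_on UNIV (\<lambda>y. G' y v)" by simp
  have sG: "G y = 0" if "y \<notin> cball a r" for y using that by (auto simp: G_def)
  have eq: "(\<lambda>y. G' y v) = (\<lambda>y. if y \<in> ?B then g' y v else 0)" by (simp add: G'_def fun_eq_iff)
  show "integrable lborel (\<lambda>y. if y \<in> ?B then g' y v else 0)"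
    "(\<integral>y. (if y \<in> ?B then g' y v else 0) \<partial>lborel) = 0"
    using integral_directional_derivative_0[OF dG cG sG] unfolding eq by auto
qed

lemma continuous_cutoff:
  fixes h :: "'a::euclidean_space \<Rightarrow> real"
  assumes K: "compact K" "K \<subseteq> ball a r" and supp: "\<And>y. y \<in> ball a r - K \<Longrightarrow> h y = 0"
    and cont: "continuous_on (ball a r) h"
  shows "continuous_on UNIV (\<lambda>y. if y \<in> ball a r then h y else 0)"
    "integrable lborel (\<lambda>y. if y \<in> ball a r then h y else 0)"
proof -
  let ?H = "\<lambda>y. if y \<in> ball a r then h y else 0"
  have oK: "open (- K)" using K(1) by (simp add: compact_imp_closed open_Compl)
  have "continuous_on (ball a r \<union> - K) ?H"
  proof (rule continuous_on_open_Un[OF open_ball oK])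
    show "continuous_on (ball a r) ?H" using cont by (rule continuous_on_eq) simp
    show "continuous_on (- K) ?H"
      using continuous_on_const[of "- K" 0] by (rule continuous_on_eq) (use supp in auto)
  qed
  moreover have "ball a r \<union> - K = UNIV" using K by blast
  ultimately show c: "continuous_on UNIV ?H" by simp
  show "integrable lborel ?H"
    by (rule integrable_continuous_bounded_support[OF c, of a r]) auto
qed

text \<open>The set where \<open>F\<close> does not vanish is open and negligible, hence
  empty.\<close>

lemma continuous_nonneg_integral_0:
  fixes F :: "'a::euclidean_space \<Rightarrow> real"
  assumes cont: "continuous_on UNIV F" and nonneg: "\<And>y. 0 \<le> F y" and int: "integrable lborel F"
    and 0: "(\<integral>y. F y \<partial>lborel) = 0"
  shows "F y = 0"
proof (rule ccontr)
  assume y: "F y \<noteq> 0"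
  have "AE y in lborel. F y = 0"
    using integral_nonneg_eq_0_iff_AE[OF int] nonneg 0 by simp
  then have "{y. F y \<noteq> 0} \<in> null_sets lborel"
    using int by (subst (asm) AE_iff_null) auto
  then have "negligible {y. F y \<noteq> 0}"
    using null_sets_completionI negligible_iff_null_sets by blast
  moreover have "open {y. F y \<noteq> 0}"
    using cont by (intro open_Collect_neq continuous_on_const) auto
  ultimately show False using open_not_negligible y by blast
qed

section \<open>Change of variables for an arbitrary finite index type\<close>

text \<open>The library proves the change of variables formula for well-ordered index types only; the
  following copy of the index type provides one of the same cardinality.\<close>

typedef ('n::finite) wo_index = "{..<CARD('n)}"
  by (rule exI[of _ 0]) simp

setup_lifting type_definition_wo_index

instantiation wo_index :: (finite) linorder
begin
lift_definition less_eq_wo_index :: "'a wo_index \<Rightarrow> 'a wo_index \<Rightarrow> bool" is "(\<le>)" .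
lift_definition less_wo_index :: "'a wo_index \<Rightarrow> 'a wo_index \<Rightarrow> bool" is "(<)" .
instance by standard (transfer; auto)+
end

instance wo_index :: (finite) wellorder
proof
  fix P :: "'a wo_index \<Rightarrow> bool" and a
  assume step: "\<And>x. (\<And>y. y < x \<Longrightarrow> P y) \<Longrightarrow> P x"
  show "P a"
    by (induction a rule: measure_induct_rule[of Rep_wo_index]) (auto intro: step simp: less_wo_index.rep_eq)
qed

lemma card_wo_index: "finite (UNIV :: 'n::finite wo_index set)" "CARD('n wo_index) = CARD('n)"
proof -
  interpret type_definition "Rep_wo_index :: 'n wo_index \<Rightarrow> nat" Abs_wo_index "{..<CARD('n)}"
    by (rule type_definition_wo_index)
  show "finite (UNIV :: 'n wo_index set)" using Abs_image by (metis finite_imageI finite_lessThan)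
  show "CARD('n wo_index) = CARD('n)" using card by simp
qed

instance wo_index :: (finite) finite
  by standard (rule card_wo_index)

lemma wo_index_bij: obtains \<sigma> :: "'n::finite wo_index \<Rightarrow> 'n" where "bij \<sigma>"
  using finite_same_card_bij[of "UNIV :: 'n wo_index set" "UNIV :: 'n set"] card_wo_index by auto

section \<open>Relabelling of coordinates\<close>

definition reindex :: "('m \<Rightarrow> 'n) \<Rightarrow> real ^ 'n \<Rightarrow> real ^ 'm" where
  "reindex \<sigma> x = (\<chi> k. x $ \<sigma> k)"

lemma reindex_nth [simp]: "reindex \<sigma> x $ k = x $ \<sigma> k"
  by (simp add: reindex_def)

lemma bounded_linear_reindex: "bounded_linear (reindex \<sigma> :: real ^ 'n::finite \<Rightarrow> real ^ 'm::finite)"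
  by (simp add: linear_conv_bounded_linear[symmetric] linear_iff vec_eq_iff)

lemma reindex_inverse:
  assumes "bij \<sigma>"
  shows "reindex (inv_into UNIV \<sigma>) (reindex \<sigma> x) = x" "reindex \<sigma> (reindex (inv_into UNIV \<sigma>) y) = y"
  using assms by (simp_all add: vec_eq_iff bij_is_surj surj_f_inv_f bij_is_inj inv_f_f)

lemma prod_Basis_cart:
  fixes f :: "real ^ 'n::finite \<Rightarrow> 'b::comm_monoid_mult"
  shows "(\<Prod>b\<in>Basis. f b) = (\<Prod>i\<in>UNIV. f (axis i 1))"
proof -
  have B: "(Basis :: (real ^ 'n) set) = (\<lambda>i. axis i 1) ` UNIV" by (auto simp: Basis_vec_def)
  have I: "inj (\<lambda>i::'n. axis i (1::real))" by (auto simp: inj_on_def axis_eq_axis)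
  show ?thesis unfolding B prod.reindex[OF I] by (simp add: o_def)
qed

text \<open>Lebesgue measure is determined by the volumes of boxes, and relabelling permutes the
  side lengths of a box.\<close>

lemma lborel_distr_reindex:
  fixes \<sigma> :: "'m::finite \<Rightarrow> 'n::finite"
  assumes "bij \<sigma>"
  shows "distr lborel borel (reindex \<sigma>) = lborel"
proof (rule lborel_eqI[symmetric])
  fix l u :: "real ^ 'm"
  assume le: "\<And>b. b \<in> Basis \<Longrightarrow> l \<bullet> b \<le> u \<bullet> b"
  have le': "l $ i \<le> u $ i" for i using le[of "axis i 1"] by (simp add: inner_axis axis_in_Basis_iff)
  have m: "reindex \<sigma> \<in> borel_measurable borel"
    by (intro borel_measurable_continuous_onI linear_continuous_on bounded_linear_reindex)
  have "reindex \<sigma> -` box l u = box (reindex (inv_into UNIV \<sigma>) l) (reindex (inv_into UNIV \<sigma>) u)"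
    using assms by (auto simp: mem_box_cart) (metis bij_inv_eq_iff surj_f_inv_f bij_is_surj inv_f_f bij_is_inj)+
  then have "emeasure (distr lborel borel (reindex \<sigma>)) (box l u) =
      emeasure lborel (box (reindex (inv_into UNIV \<sigma>) l) (reindex (inv_into UNIV \<sigma>) u))"
    using m by (simp add: emeasure_distr)
  also have "\<dots> = (\<Prod>b\<in>Basis. (reindex (inv_into UNIV \<sigma>) u - reindex (inv_into UNIV \<sigma>) l) \<bullet> b)"
    by (rule emeasure_lborel_box) (use le' in \<open>auto simp: Basis_vec_def inner_axis\<close>)
  also have "\<dots> = (\<Prod>i\<in>UNIV. u $ inv_into UNIV \<sigma> i - l $ inv_into UNIV \<sigma> i)"
    by (simp add: prod_Basis_cart inner_axis)
  also have "\<dots> = (\<Prod>k\<in>UNIV. u $ k - l $ k)"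
    using prod.reindex_bij_betw[of "inv_into UNIV \<sigma>" UNIV UNIV "\<lambda>k. u $ k - l $ k"] bij_imp_bij_inv[OF assms] by simp
  also have "\<dots> = prod ((\<bullet>) (u - l)) Basis" by (simp add: prod_Basis_cart inner_axis)
  finally show "emeasure (distr lborel borel (reindex \<sigma>)) (box l u) = ennreal (prod ((\<bullet>) (u - l)) Basis)" .
qed simp

lemma lborel_integral_reindex:
  fixes \<sigma> :: "'m::finite \<Rightarrow> 'n::finite" and f :: "real ^ 'm \<Rightarrow> real"
  assumes "bij \<sigma>" "f \<in> borel_measurable borel"
  shows "integrable lborel (\<lambda>x. f (reindex \<sigma> x)) \<longleftrightarrow> integrable lborel f"
    "(\<integral>x. f (reindex \<sigma> x) \<partial>lborel) = (\<integral>y. f y \<partial>lborel)"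
proof -
  have m: "reindex \<sigma> \<in> borel_measurable borel"
    by (intro borel_measurable_continuous_onI linear_continuous_on bounded_linear_reindex)
  show "integrable lborel (\<lambda>x. f (reindex \<sigma> x)) \<longleftrightarrow> integrable lborel f"
    using integrable_distr_eq[of "reindex \<sigma>" lborel borel f] assms m by (simp add: lborel_distr_reindex)
  show "(\<integral>x. f (reindex \<sigma> x) \<partial>lborel) = (\<integral>y. f y \<partial>lborel)"
    using integral_distr[of "reindex \<sigma>" lborel borel f] assms m by (simp add: lborel_distr_reindex)
qed

text \<open>Rows and columns are relabelled alike, so the permutations in the Leibniz formula are
  conjugated by the bijection, which preserves their signs.\<close>

lemma det_reindex:
  fixes A :: "real ^ 'n::finite ^ 'n" and \<sigma> :: "'m::finite \<Rightarrow> 'n"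
  assumes \<sigma>: "bij \<sigma>"
  shows "det (\<chi> i j. A $ \<sigma> i $ \<sigma> j) = det A"
proof -
  have inj: "inj \<sigma>" and bb: "bij_betw \<sigma> UNIV UNIV" "bij_betw (inv_into UNIV \<sigma>) UNIV UNIV"
    using \<sigma> bij_imp_bij_inv by (auto simp: bij_is_inj)
  have summand: "of_int (sign p) * (\<Prod>i\<in>UNIV. A $ \<sigma> i $ \<sigma> (p i)) =
      of_int (sign (map_permutation UNIV \<sigma> p)) * (\<Prod>i\<in>UNIV. A $ i $ map_permutation UNIV \<sigma> p i)"
    if p: "p permutes UNIV" for p
  proof -
    have "(\<Prod>i\<in>UNIV. A $ i $ map_permutation UNIV \<sigma> p i) =
        (\<Prod>k\<in>UNIV. A $ \<sigma> k $ map_permutation UNIV \<sigma> p (\<sigma> k))"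
      using prod.reindex_bij_betw[OF bb(1), of "\<lambda>i. A $ i $ map_permutation UNIV \<sigma> p i"] by simp
    then show ?thesis
      using inj p by (simp add: map_permutation_apply sign_map_permutation)
  qed
  show ?thesis
    unfolding det_def
  proof (rule sum.reindex_bij_witness[where j = "map_permutation UNIV \<sigma>" and i = "map_permutation UNIV (inv_into UNIV \<sigma>)"])
    show "map_permutation UNIV (inv_into UNIV \<sigma>) (map_permutation UNIV \<sigma> p) = p" if "p \<in> {p. p permutes UNIV}" for p
      using map_permutation_compose_inv[OF bb(1)] that inj by simp
    show "map_permutation UNIV \<sigma> (map_permutation UNIV (inv_into UNIV \<sigma>) p) = p" if "p \<in> {p. p permutes UNIV}" for p
      using map_permutation_compose_inv[OF bb(2)] that \<sigma> by (simp add: bij_is_surj surj_f_inv_f)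
    show "map_permutation UNIV \<sigma> p \<in> {p. p permutes UNIV}" if "p \<in> {p. p permutes UNIV}" for p
      using map_permutation_permutes[OF bb(1)] that by simp
    show "map_permutation UNIV (inv_into UNIV \<sigma>) p \<in> {p. p permutes UNIV}" if "p \<in> {p. p permutes UNIV}" for p
      using map_permutation_permutes[OF bb(2)] that by simp
  qed (use summand in simp)
qed

text \<open>The known formula concerns absolutely integrable vector-valued functions on
  \<open>S\<close> and its image; \<open>real ^ 1\<close> makes scalar functions vector-valued.
  Since \<open>F1\<close> and \<open>F2\<close> vanish off these sets, the integrals over them are
  the Lebesgue integrals over the whole space.\<close>

lemma integral_change_of_variables_wellorder:
  fixes g :: "real ^ 'm::{finite,wellorder} \<Rightarrow> real ^ 'm::_" and F1 F2 :: "real ^ 'm::_ \<Rightarrow> real"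
  assumes S: "open S"
    and dg: "\<And>x. x \<in> S \<Longrightarrow> (g has_derivative g' x) (at x)" and inj: "inj_on g S"
    and int: "integrable lborel F1" "integrable lborel F2"
    and eq: "\<And>x. x \<in> S \<Longrightarrow> F1 x = \<bar>det (matrix (g' x))\<bar> * F2 (g x)"
    and supp: "\<And>x. x \<notin> S \<Longrightarrow> F1 x = 0" "\<And>y. y \<notin> g ` S \<Longrightarrow> F2 y = 0"
  shows "(\<integral>x. F1 x \<partial>lborel) = (\<integral>y. F2 y \<partial>lborel)"
proof -
  let ?v = "vec :: real \<Rightarrow> real ^ 1"
  have bl: "bounded_linear ?v"
    by (simp add: linear_conv_bounded_linear[symmetric] linear_iff vec_eq_iff)
  have restrict: "(\<lambda>x. ?v (F x)) absolutely_integrable_on T \<and> integral T (\<lambda>x. ?v (F x)) = ?v (\<integral>x. F x \<partial>lborel)"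
    if F: "integrable lborel F" and z: "\<And>x. x \<notin> T \<Longrightarrow> F x = 0" for F :: "real ^ 'm::_ \<Rightarrow> real" and T
  proof -
    have r: "(\<lambda>x. if x \<in> T then F x else 0) = F" using z by auto
    have "F absolutely_integrable_on UNIV"
      using F by (simp add: set_integrable_def integrable_completion)
    then have F': "F absolutely_integrable_on T"
      using absolutely_integrable_restrict_UNIV[of T F] r by simp
    have "integral T F = integral UNIV F"
      using Henstock_Kurzweil_Integration.integral_restrict_UNIV[of T F] r by simp
    then have "integral T F = (\<integral>x. F x \<partial>lborel)" using integral_lborel[OF F] by simp
    moreover have "integral T (?v \<circ> F) = ?v (integral T F)"
      using F' bl by (intro integral_linear) (auto simp: absolutely_integrable_on_def)
    ultimately show ?thesis
      using absolutely_integrable_linear[OF F' bl] by (simp add: o_def)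
  qed
  have "\<bar>det (matrix (g' x))\<bar> *\<^sub>R ?v (F2 (g x)) = ?v (F1 x)" if "x \<in> S" for x
    using eq[OF that] by (simp add: vec_eq_iff)
  moreover have "S \<in> sets lebesgue" using S by auto
  moreover have "(g has_derivative g' x) (at x within S)" if "x \<in> S" for x
    using dg[OF that] by (rule has_derivative_at_withinI)
  moreover have "(\<lambda>y. ?v (F2 y)) absolutely_integrable_on g ` S \<and>
      integral (g ` S) (\<lambda>y. ?v (F2 y)) = ?v (\<integral>x. F2 x \<partial>lborel)"
    using restrict[OF int(2) supp(2)] .
  ultimately have "integral S (\<lambda>x. \<bar>det (matrix (g' x))\<bar> *\<^sub>R ?v (F2 (g x))) = ?v (\<integral>x. F2 x \<partial>lborel)"
    using has_absolute_integral_change_of_variables[of S g g' "\<lambda>y. ?v (F2 y)" "?v (\<integral>x. F2 x \<partial>lborel)"] inj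
    by blast
  moreover have "integral S (\<lambda>x. \<bar>det (matrix (g' x))\<bar> *\<^sub>R ?v (F2 (g x))) = integral S (\<lambda>x. ?v (F1 x))"
    by (rule integral_cong) fact
  moreover have "integral S (\<lambda>x. ?v (F1 x)) = ?v (\<integral>x. F1 x \<partial>lborel)"
    using restrict[OF int(1) supp(1)] by simp
  ultimately show ?thesis by (simp add: vec_eq_iff)
qed

text \<open>Everything is conjugated by a relabelling \<open>?P\<close> with inverse
  \<open>?Q\<close>: integrals are unchanged by invariance of the measure, and the Jacobian
  determinant is unchanged by \<open>det_reindex\<close>.\<close>

proposition integral_change_of_variables:
  fixes g :: "real ^ 'n::finite \<Rightarrow> real ^ 'n" and F1 F2 :: "real ^ 'n \<Rightarrow> real"
  assumes S: "open S"
    and dg: "\<And>x. x \<in> S \<Longrightarrow> (g has_derivative g' x) (at x)" and inj: "inj_on g S"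
    and int: "integrable lborel F1" "integrable lborel F2"
    and eq: "\<And>x. x \<in> S \<Longrightarrow> F1 x = \<bar>det (matrix (g' x))\<bar> * F2 (g x)"
    and supp: "\<And>x. x \<notin> S \<Longrightarrow> F1 x = 0" "\<And>y. y \<notin> g ` S \<Longrightarrow> F2 y = 0"
  shows "(\<integral>x. F1 x \<partial>lborel) = (\<integral>y. F2 y \<partial>lborel)"
proof -
  obtain \<sigma> :: "'n wo_index \<Rightarrow> 'n" where \<sigma>: "bij \<sigma>" by (rule wo_index_bij)
  let ?P = "reindex \<sigma>" and ?Q = "reindex (inv_into UNIV \<sigma>)"
  have bij': "bij (inv_into UNIV \<sigma>)" using \<sigma> by (rule bij_imp_bij_inv)
  have PQ: "?Q (?P x) = x" "?P (?Q y) = y" for x y by (simp_all add: reindex_inverse[OF \<sigma>])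
  let ?S = "?Q -` S" and ?g = "\<lambda>y. ?P (g (?Q y))" and ?g' = "\<lambda>y h. ?P (g' (?Q y) (?Q h))"
  let ?F1 = "\<lambda>y. F1 (?Q y)" and ?F2 = "\<lambda>y. F2 (?Q y)"
  have meas: "F1 \<in> borel_measurable borel" "F2 \<in> borel_measurable borel" using int by auto
  have "(\<integral>y. ?F1 y \<partial>lborel) = (\<integral>y. ?F2 y \<partial>lborel)"
  proof (rule integral_change_of_variables_wellorder[of ?S ?g ?g'])
    show "open ?S"
      by (rule open_vimage[OF S]) (intro linear_continuous_on bounded_linear_reindex)
    show "(?g has_derivative ?g' y) (at y)" if "y \<in> ?S" for y
    proof -
      have "(?Q has_derivative ?Q) (at y)"
        by (rule bounded_linear_imp_has_derivative[OF bounded_linear_reindex])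
      moreover have "(g has_derivative g' (?Q y)) (at (?Q y))" using dg that by simp
      ultimately have "((\<lambda>y. g (?Q y)) has_derivative (\<lambda>h. g' (?Q y) (?Q h))) (at y)"
        by (rule has_derivative_compose)
      then show ?thesis by (rule bounded_linear.has_derivative[OF bounded_linear_reindex])
    qed
    show "inj_on ?g ?S"
      using inj by (auto simp: inj_on_def) (metis PQ)
    show "integrable lborel ?F1" "integrable lborel ?F2"
      using int meas by (simp_all add: lborel_integral_reindex[OF bij'])
    show "?F1 y = \<bar>det (matrix (?g' y))\<bar> * ?F2 (?g y)" if "y \<in> ?S" for y
    proof -
      have Q_axis: "?Q (axis j 1) = axis (\<sigma> j) 1" for j
      proof -
        have "inv_into UNIV \<sigma> i = j \<longleftrightarrow> i = \<sigma> j" for i using bij_inv_eq_iff[OF \<sigma>] by metis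
        then show ?thesis by (simp add: vec_eq_iff axis_def)
      qed
      have "matrix (?g' y) = (\<chi> i j. matrix (g' (?Q y)) $ \<sigma> i $ \<sigma> j)"
        by (simp add: matrix_def Q_axis)
      then have "det (matrix (?g' y)) = det (matrix (g' (?Q y)))" by (simp add: det_reindex[OF \<sigma>])
      then show ?thesis using eq that by (simp add: PQ)
    qed
    show "?F1 y = 0" if "y \<notin> ?S" for y using supp(1) that by simp
    show "?F2 y = 0" if "y \<notin> ?g ` ?S" for y
    proof (rule supp(2))
      show "?Q y \<notin> g ` S"
      proof
        assume "?Q y \<in> g ` S"
        then obtain x where "x \<in> S" "?Q y = g x" by blast
        then have "?P x \<in> ?S" "y = ?g (?P x)" by (metis PQ vimageI2, metis PQ)
        then show False using that by blast
      qed
    qed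
  qed
  then show ?thesis using lborel_integral_reindex(2)[OF bij'] meas by simp
qed

section \<open>Locally constant ambiguities and the first Betti number\<close>

text \<open>The Kronecker pairing of a real cochain with an integral chain.\<close>

definition chain_eval :: "(((nat \<Rightarrow> real) \<Rightarrow> 'a) \<Rightarrow> real) \<Rightarrow> 'a chain \<Rightarrow> real" where
  "chain_eval u c = (\<Sum>s\<in>Poly_Mapping.keys c. of_int (Poly_Mapping.lookup c s) * u s)"

abbreviation simplex_vertex :: "nat \<Rightarrow> nat \<Rightarrow> real" where
  "simplex_vertex i \<equiv> (\<lambda>j. if j = i then 1 else 0)"

lemma chain_eval_superset:
  assumes "finite F" "Poly_Mapping.keys c \<subseteq> F"
  shows "chain_eval u c = (\<Sum>s\<in>F. of_int (Poly_Mapping.lookup c s) * u s)"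
  unfolding chain_eval_def using assms
  by (intro sum.mono_neutral_left) (auto simp: in_keys_iff)

lemma chain_eval_0 [simp]: "chain_eval u 0 = 0"
  by (simp add: chain_eval_def)

lemma chain_eval_frag_of [simp]: "chain_eval u (frag_of s) = u s"
  by (simp add: chain_eval_def)

lemma chain_eval_diff: "chain_eval u (a - b) = chain_eval u a - chain_eval u b"
proof -
  let ?F = "Poly_Mapping.keys a \<union> Poly_Mapping.keys b"
  have "Poly_Mapping.keys (a - b) \<subseteq> ?F" by (rule keys_diff)
  then have "chain_eval u (a - b) = (\<Sum>s\<in>?F. of_int (Poly_Mapping.lookup (a - b) s) * u s)"
    by (intro chain_eval_superset) auto
  also have "\<dots> = (\<Sum>s\<in>?F. of_int (Poly_Mapping.lookup a s) * u s) - (\<Sum>s\<in>?F. of_int (Poly_Mapping.lookup b s) * u s)"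
    by (simp add: lookup_minus left_diff_distrib sum_subtractf)
  also have "\<dots> = chain_eval u a - chain_eval u b"
    by (simp add: chain_eval_superset[of ?F])
  finally show ?thesis .
qed

text \<open>Face 0 omits the initial vertex of an edge and is therefore its end point. This fixes
  the sign of the increments below.\<close>

lemma singular_face_vertex:
  "singular_face (Suc 0) 0 s (simplex_vertex 0) = s (simplex_vertex 1)"
  "singular_face (Suc 0) (Suc 0) s (simplex_vertex 0) = s (simplex_vertex 0)"
proof -
  have v: "simplex_vertex 0 \<in> standard_simplex 0" by simp
  have "simplical_face 0 (simplex_vertex 0) = (simplex_vertex 1 :: nat \<Rightarrow> real)"
    "simplical_face (Suc 0) (simplex_vertex 0) = (simplex_vertex 0 :: nat \<Rightarrow> real)"
    by (auto simp: simplical_face_def fun_eq_iff)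
  then show "singular_face (Suc 0) 0 s (simplex_vertex 0) = s (simplex_vertex 1)"
    "singular_face (Suc 0) (Suc 0) s (simplex_vertex 0) = s (simplex_vertex 0)"
    using v by (simp_all add: singular_face_def)
qed

lemma chain_boundary_edge:
  "chain_boundary (Suc 0) (frag_of s) =
    frag_of (singular_face (Suc 0) 0 s) - frag_of (singular_face (Suc 0) (Suc 0) s)"
  by (simp add: chain_boundary_of)

lemma chain_boundary_triangle:
  "chain_boundary (Suc (Suc 0)) (frag_of s) =
    frag_of (singular_face (Suc (Suc 0)) 0 s) - (frag_of (singular_face (Suc (Suc 0)) (Suc 0) s)
      - frag_of (singular_face (Suc (Suc 0)) (Suc (Suc 0)) s))"
  by (simp add: chain_boundary_of)

text \<open>On the edges of \<open>c\<close> the cochain \<open>u\<close> is the coboundary of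
  \<open>g\<close>; the claim is the duality of boundary and coboundary, extended additively from
  single edges. In particular the value depends on the boundary of the chain only.\<close>

lemma chain_eval_potential:
  assumes "Poly_Mapping.keys c \<subseteq> {s. u s = g (s (simplex_vertex 1)) - g (s (simplex_vertex 0))}"
  shows "chain_eval u c = chain_eval (\<lambda>s. g (s (simplex_vertex 0))) (chain_boundary (Suc 0) c)"
  using assms
proof (induction rule: frag_induction)
  case (one s)
  then show ?case
    by (simp add: chain_boundary_edge chain_eval_diff singular_face_vertex)
qed (simp_all add: chain_eval_diff chain_boundary_diff)

lemma singular_chain_iterated_subdivision:
  "singular_chain p X c \<Longrightarrow> singular_chain p X ((singular_subdivision p ^^ m) c)"
  by (induction m) (auto simp: singular_chain_singular_subdivision)

lemma chain_boundary_iterated_subdivision: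
  "singular_chain p X c \<Longrightarrow> chain_boundary p ((singular_subdivision p ^^ m) c) =
    (singular_subdivision (p - Suc 0) ^^ m) (chain_boundary p c)"
  by (induction m)
    (simp_all add: chain_boundary_singular_subdivision[OF singular_chain_iterated_subdivision])

lemma connected_singular_simplex_image:
  assumes "singular_simplex p euclidean s"
  shows "connected (s ` standard_simplex p)"
proof -
  have "connectedin euclidean (s ` standard_simplex p)"
    using assms connectedin_standard_simplex[of p]
    by (intro connectedin_continuous_map_image[of "subtopology (powertop_real UNIV) (standard_simplex p)"])
      (auto simp: singular_simplex_def connectedin_subtopology)
  then show ?thesis by simp
qed

text \<open>A supremum equal to zero excludes even independent singletons. Hence some nonzero
  multiple of the cocycle is a coboundary, and the factor can be divided out over the reals.\<close>

lemma betti_number_1_zero: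
  assumes "betti_number 1 T = 0" "u \<in> cocycles (Suc 0) T"
  obtains w where "w \<in> singular_cochains 0 T" "u = singular_coboundary 0 T w"
proof -
  have "\<not> independent_modulo (coboundaries 1 T) {u}"
  proof
    assume "independent_modulo (coboundaries 1 T) {u}"
    then have "enat (card {u}) \<le> quotient_dim (cocycles 1 T) (coboundaries 1 T)"
      unfolding quotient_dim_def using assms(2) by (intro SUP_upper) auto
    then show False using assms(1) by (simp add: betti_number_def enat_0_iff flip: zero_enat_def)
  qed
  then obtain a where a: "(\<lambda>x. a * u x) \<in> coboundaries (Suc 0) T" "a \<noteq> 0"
    by (auto simp: independent_modulo_def)
  then obtain w where w: "w \<in> singular_cochains 0 T" "(\<lambda>x. a * u x) = singular_coboundary 0 T w"
    by auto
  show ?thesis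
  proof
    show "(\<lambda>x. w x / a) \<in> singular_cochains 0 T" using w by (simp add: singular_cochains_def)
    show "u = singular_coboundary 0 T (\<lambda>x. w x / a)"
    proof
      fix s
      have "a * u s = singular_coboundary 0 T w s" using w(2) by metis
      then show "u s = singular_coboundary 0 T (\<lambda>x. w x / a) s"
        using a(2) by (auto simp: singular_coboundary_def field_simps)
    qed
  qed
qed

text \<open>The increments of the potentials \<open>G i\<close> along small paths agree, and subdivision extends them
  to a singular 1-cocycle. No continuity of the potentials is needed.\<close>

proposition compatible_potentials:
  fixes V :: "'i \<Rightarrow> 'a::topological_space set" and G :: "'i \<Rightarrow> 'a \<Rightarrow> real"
  assumes opn: "\<And>i. i \<in> I \<Longrightarrow> open (V i)"
    and cover: "(\<Union>i\<in>I. V i) = UNIV"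
    and pc: "\<And>i. i \<in> I \<Longrightarrow> path_connected (V i)"
    and const: "\<And>i j C x y. \<lbrakk>i \<in> I; j \<in> I; connected C; C \<subseteq> V i \<inter> V j; x \<in> C; y \<in> C\<rbrakk>
      \<Longrightarrow> G i x - G j x = G i y - G j y"
    and betti: "betti_number 1 (euclidean :: 'a topology) = 0"
  obtains W k where "\<And>i x. i \<in> I \<Longrightarrow> x \<in> V i \<Longrightarrow> W x = G i x + k i"
proof -
  let ?E = "euclidean :: 'a topology"
  let ?v0 = "simplex_vertex 0 :: nat \<Rightarrow> real" and ?v1 = "simplex_vertex 1 :: nat \<Rightarrow> real"
  \<comment> \<open>Any member containing the edge would do: two choices give the same increment
    because the image of an edge is connected. On an edge that fits into no member the value is
    arbitrary and is never relied upon.\<close>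
  define idx where "idx = (\<lambda>s. SOME i. i \<in> I \<and> s \<in> standard_simplex (Suc 0) \<rightarrow> V i)"
  define u0 where "u0 = (\<lambda>s. G (idx s) (s ?v1) - G (idx s) (s ?v0))"
  have u0: "u0 s = G i (s ?v1) - G i (s ?v0)"
    if s: "singular_simplex (Suc 0) ?E s" "s \<in> standard_simplex (Suc 0) \<rightarrow> V i" and i: "i \<in> I" for s i
  proof -
    have j: "idx s \<in> I \<and> s \<in> standard_simplex (Suc 0) \<rightarrow> V (idx s)"
      unfolding idx_def by (rule someI[of _ i]) (use s i in auto)
    have "G i (s ?v1) - G (idx s) (s ?v1) = G i (s ?v0) - G (idx s) (s ?v0)"
      by (rule const[OF i _ connected_singular_simplex_image[OF s(1)]]) (use s j in auto)
    then show ?thesis by (simp add: u0_def)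
  qed
  have patch: "chain_eval u0 c = chain_eval (\<lambda>s. G i (s ?v0)) (chain_boundary (Suc 0) c)"
    if "i \<in> I" "singular_chain (Suc 0) (subtopology ?E (V i)) c" for i c
  proof (rule chain_eval_potential, rule subsetI)
    fix s assume "s \<in> Poly_Mapping.keys c"
    then have "singular_simplex (Suc 0) (subtopology ?E (V i)) s"
      using that(2) by (auto simp: singular_chain_def)
    then have "singular_simplex (Suc 0) ?E s" "s \<in> standard_simplex (Suc 0) \<rightarrow> V i"
      by (auto simp: singular_simplex_subtopology)
    from u0[OF this that(1)] show "s \<in> {s. u0 s = G i (s ?v1) - G i (s ?v0)}" by simp
  qed
  \<comment> \<open>Subdivision does not change 0-chains, so a chain in one member of the cover and
    its subdivisions have the same boundary, and inside that member \<open>u0\<close> sees the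
    boundary only.\<close>
  have patch_subdivision: "chain_eval u0 ((singular_subdivision (Suc 0) ^^ m) c) = chain_eval u0 c"
    if i: "i \<in> I" and c: "singular_chain (Suc 0) (subtopology ?E (V i)) c" for i c m
  proof -
    have c0: "singular_chain 0 (subtopology ?E (V i)) (chain_boundary (Suc 0) c)"
      using c singular_chain_boundary_alt by blast
    have "(singular_subdivision 0 ^^ m) (chain_boundary (Suc 0) c) = chain_boundary (Suc 0) c"
      by (induction m) (simp_all add: singular_subdivision_zero[OF c0])
    then show ?thesis
      using patch[OF i c] patch[OF i singular_chain_iterated_subdivision[OF c]]
        chain_boundary_iterated_subdivision[OF c] by simp
  qed
  have small_simplex: "singular_chain p (subtopology ?E (V i)) (frag_of s)"
    if "singular_simplex p ?E s" "s \<in> standard_simplex p \<rightarrow> V i" for p s i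
    using that by (auto simp: singular_chain_of singular_simplex_subtopology)
  have small_subdivision: "chain_eval u0 (singular_subdivision (Suc 0) c) = chain_eval u0 c"
    if "Poly_Mapping.keys c \<subseteq> {s. singular_simplex (Suc 0) ?E s \<and> (\<exists>i\<in>I. s \<in> standard_simplex (Suc 0) \<rightarrow> V i)}" for c
    using that
  proof (induction rule: frag_induction)
    case (one s)
    then obtain i where "i \<in> I" "singular_chain (Suc 0) (subtopology ?E (V i)) (frag_of s)"
      using small_simplex by blast
    then show ?case using patch_subdivision[of i "frag_of s" 1] by simp
  qed (simp_all add: chain_eval_diff singular_subdivision_diff)
  have small_boundary: "chain_eval u0 (chain_boundary (Suc (Suc 0)) c) = 0"
    if "Poly_Mapping.keys c \<subseteq> {s. singular_simplex (Suc (Suc 0)) ?E s \<and> (\<exists>i\<in>I. s \<in> standard_simplex (Suc (Suc 0)) \<rightarrow> V i)}" for c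
    using that
  proof (induction rule: frag_induction)
    case (one s)
    then obtain i where i: "i \<in> I" and s: "singular_chain (Suc (Suc 0)) (subtopology ?E (V i)) (frag_of s)"
      using small_simplex by blast
    have "chain_boundary (Suc 0) (chain_boundary (Suc (Suc 0)) (frag_of s)) = 0"
      using chain_boundary_boundary[OF s] by simp
    then show ?case using patch[OF i singular_chain_boundary_alt[OF s]] by simp
  qed (simp_all add: chain_eval_diff chain_boundary_diff)
  \<comment> \<open>The Lebesgue number argument, for all sufficiently fine iterated subdivisions of
    a chain at once.\<close>
  have eventually_small: "\<exists>n. \<forall>m\<ge>n. Poly_Mapping.keys ((singular_subdivision p ^^ m) c) \<subseteq>
      {s. singular_simplex p ?E s \<and> (\<exists>i\<in>I. s \<in> standard_simplex p \<rightarrow> V i)}"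
    if c: "singular_chain p ?E c" for p c
  proof -
    obtain n where n: "\<And>m f. \<lbrakk>n \<le> m; f \<in> Poly_Mapping.keys ((singular_subdivision p ^^ m) c)\<rbrakk>
        \<Longrightarrow> \<exists>U \<in> V ` I. f \<in> standard_simplex p \<rightarrow> U"
      by (rule sufficient_iterated_singular_subdivision_exists[of "V ` I" ?E p c])
        (use opn cover c in auto)
    have "singular_simplex p ?E f" if "f \<in> Poly_Mapping.keys ((singular_subdivision p ^^ m) c)" for m f
      using singular_chain_iterated_subdivision[OF c, of m] that by (auto simp: singular_chain_def)
    with n show ?thesis by blast
  qed
  \<comment> \<open>The sequence is eventually constant by \<open>small_subdivision\<close>. Writing
    its eventual value as a limit avoids choosing a number of subdivisions for each chain and
    reduces additivity to the limit of a difference.\<close>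
  define L where "L = (\<lambda>c. lim (\<lambda>m. chain_eval u0 ((singular_subdivision (Suc 0) ^^ m) c)))"
  have L: "(\<lambda>m. chain_eval u0 ((singular_subdivision (Suc 0) ^^ m) c)) \<longlonglongrightarrow> L c"
    if c: "singular_chain (Suc 0) ?E c" for c
  proof -
    let ?x = "\<lambda>m. chain_eval u0 ((singular_subdivision (Suc 0) ^^ m) c)"
    obtain n where n: "\<And>m. n \<le> m \<Longrightarrow> Poly_Mapping.keys ((singular_subdivision (Suc 0) ^^ m) c) \<subseteq>
      {s. singular_simplex (Suc 0) ?E s \<and> (\<exists>i\<in>I. s \<in> standard_simplex (Suc 0) \<rightarrow> V i)}"
      using eventually_small[OF c] by blast
    have "?x m = ?x n" if "n \<le> m" for m
      using that by (induction m rule: dec_induct) (simp_all add: small_subdivision[OF n])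
    then have "?x \<longlonglongrightarrow> ?x n"
      by (intro tendsto_eventually eventually_sequentiallyI[of n])
    then show ?thesis unfolding L_def using convergentI convergent_LIMSEQ_iff by blast
  qed
  define u where "u = (\<lambda>s. if singular_simplex (Suc 0) ?E s then L (frag_of s) else 0)"
  have "singular_coboundary (Suc 0) ?E u t = 0" for t
  proof (cases "singular_simplex (Suc (Suc 0)) ?E t")
    case True
    let ?f = "\<lambda>k. frag_of (singular_face (Suc (Suc 0)) k t)"
    have face: "singular_simplex (Suc 0) ?E (singular_face (Suc (Suc 0)) k t)" if "k \<le> Suc (Suc 0)" for k
      using singular_simplex_singular_face[OF True, of k] that by simp
    have f: "singular_chain (Suc 0) ?E (?f k)" if "k \<le> Suc (Suc 0)" for k
      using face[OF that] by (simp add: singular_chain_of)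
    have t: "singular_chain (Suc (Suc 0)) ?E (frag_of t)"
      using True by (simp add: singular_chain_of)
    let ?b = "chain_boundary (Suc (Suc 0)) (frag_of t)"
    obtain n where n: "\<And>m. n \<le> m \<Longrightarrow> Poly_Mapping.keys ((singular_subdivision (Suc (Suc 0)) ^^ m) (frag_of t)) \<subseteq>
      {s. singular_simplex (Suc (Suc 0)) ?E s \<and> (\<exists>i\<in>I. s \<in> standard_simplex (Suc (Suc 0)) \<rightarrow> V i)}"
      using eventually_small[OF t] by blast
    \<comment> \<open>Subdivision commutes with the boundary. Once the triangle is cut into small
      pieces, each piece lies in one member and contributes zero.\<close>
    have "chain_eval u0 ((singular_subdivision (Suc 0) ^^ m) ?b) = 0" if "n \<le> m" for m
      using small_boundary[OF n[OF that]] chain_boundary_iterated_subdivision[OF t, of m] by simp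
    then have "(\<lambda>m. chain_eval u0 ((singular_subdivision (Suc 0) ^^ m) ?b)) \<longlonglongrightarrow> 0"
      by (intro tendsto_eventually eventually_sequentiallyI[of n])
    moreover have "(\<lambda>m. chain_eval u0 ((singular_subdivision (Suc 0) ^^ m) ?b)) \<longlonglongrightarrow>
        L (?f 0) - (L (?f (Suc 0)) - L (?f (Suc (Suc 0))))"
      unfolding chain_boundary_triangle singular_subdivision_power_diff chain_eval_diff
      by (intro tendsto_diff L f) auto
    ultimately have "L (?f 0) - (L (?f (Suc 0)) - L (?f (Suc (Suc 0)))) = 0"
      using LIMSEQ_unique by blast
    then show ?thesis using True face by (simp add: singular_coboundary_def u_def)
  qed (simp add: singular_coboundary_def)
  then have "u \<in> cocycles (Suc 0) ?E"
    by (auto simp: cocycles_def singular_cochains_def u_def)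
  with betti obtain w where w: "u = singular_coboundary 0 ?E w"
    using betti_number_1_zero by blast
  have u_small: "u s = G i (s ?v1) - G i (s ?v0)"
    if s: "singular_simplex (Suc 0) ?E s" "s \<in> standard_simplex (Suc 0) \<rightarrow> V i" and i: "i \<in> I" for s i
  proof -
    have "chain_eval u0 ((singular_subdivision (Suc 0) ^^ m) (frag_of s)) = u0 s" for m
      using patch_subdivision[OF i small_simplex[OF s]] by simp
    then have "L (frag_of s) = u0 s" by (simp add: L_def)
    then show ?thesis using u0[OF s i] s by (simp add: u_def)
  qed
  \<comment> \<open>A 0-cochain becomes a function of points through constant 0-simplices. The
    restriction is needed because singular simplices are extensional functions.\<close>
  define W where "W = (\<lambda>x. w (\<lambda>t\<in>standard_simplex 0. x))"
  have step: "W y - W x = G i y - G i x" if i: "i \<in> I" and xy: "x \<in> V i" "y \<in> V i" for i x y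
  proof -
    obtain g where g: "path g" "path_image g \<subseteq> V i" "pathstart g = x" "pathfinish g = y"
      using pc[OF i] xy by (metis path_connected_def)
    \<comment> \<open>The barycentric coordinate \<open>t 1\<close> is the parameter of the path: it
      is 0 at the initial vertex and 1 at the final one.\<close>
    define s where "s = restrict (\<lambda>t. g (t 1)) (standard_simplex (Suc 0))"
    have t01: "t 1 \<in> {0..1}" if "t \<in> standard_simplex (Suc 0)" for t
      using that by (simp add: standard_simplex_def)
    have sV: "s \<in> standard_simplex (Suc 0) \<rightarrow> V i"
      using g(2) t01 by (auto simp: s_def path_image_def)
    have "continuous_map (subtopology (powertop_real UNIV) (standard_simplex (Suc 0)))
        (subtopology euclideanreal {0..1}) (\<lambda>t. t 1)"
      using t01 by (auto simp: continuous_map_in_subtopology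
          intro!: continuous_map_from_subtopology continuous_map_product_projection)
    moreover have "continuous_map (subtopology euclideanreal {0..1}) ?E g"
      using g(1) by (simp add: path_def)
    ultimately have "continuous_map (subtopology (powertop_real UNIV) (standard_simplex (Suc 0))) ?E (g \<circ> (\<lambda>t. t 1))"
      by (rule continuous_map_compose)
    then have s: "singular_simplex (Suc 0) ?E s"
      by (auto simp: singular_simplex_def s_def o_def intro: continuous_map_eq)
    have sv: "s ?v0 = x" "s ?v1 = y" using g(3,4) by (simp_all add: s_def pathstart_def pathfinish_def)
    have "singular_face (Suc 0) k s = (\<lambda>t\<in>standard_simplex 0. singular_face (Suc 0) k s ?v0)" for k
      by (rule ext) (auto simp: restrict_def standard_simplex_0 singular_face_def)
    then have "singular_face (Suc 0) 0 s = (\<lambda>t\<in>standard_simplex 0. y)"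
      "singular_face (Suc 0) (Suc 0) s = (\<lambda>t\<in>standard_simplex 0. x)"
      using singular_face_vertex[of s] sv by metis+
    then have "u s = W y - W x" using s by (simp add: w singular_coboundary_def W_def)
    then show ?thesis using u_small[OF s sV i] sv by simp
  qed
  define k where "k = (\<lambda>i. let x = SOME x. x \<in> V i in W x - G i x)"
  have "W x = G i x + k i" if "i \<in> I" "x \<in> V i" for i x
  proof -
    have "(SOME x. x \<in> V i) \<in> V i" using that by (metis someI_ex)
    from step[OF that(1) this that(2)] show ?thesis by (simp add: k_def Let_def)
  qed
  then show thesis using that by blast
qed

section \<open>Charts and vector fields\<close>

locale atlas =
  fixes A :: "('m::t2_space, 'n::finite) chart set"
  assumes smooth_atlas: "smooth_atlas A"
begin

abbreviation jac :: "('m, 'n) chart \<Rightarrow> ('m, 'n) chart \<Rightarrow> 'm \<Rightarrow> real ^ 'n \<Rightarrow> real ^ 'n" where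
  "jac c d p \<equiv> chart_deriv c (snd d) p"

lemma is_chart: "c \<in> A \<Longrightarrow> is_chart c"
  using smooth_atlas by (simp add: smooth_atlas_def)

lemma chart_at: obtains c where "c \<in> A" "p \<in> fst c"
proof -
  have "p \<in> (\<Union>c\<in>A. fst c)" using smooth_atlas by (simp add: smooth_atlas_def)
  then show thesis using that by blast
qed

lemma chart_inj: "c \<in> A \<Longrightarrow> inj_on (snd c) (fst c)"
  using is_chart[of c] unfolding is_chart_def homeomorphism_def by (metis inj_on_inverseI)

lemma chart_inverse [simp]: "c \<in> A \<Longrightarrow> p \<in> fst c \<Longrightarrow> inv_into (fst c) (snd c) (snd c p) = p"
  by (simp add: chart_inj)

lemma in_chart_apply [simp]: "c \<in> A \<Longrightarrow> p \<in> fst c \<Longrightarrow> in_chart c f (snd c p) = f p"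
  by (simp add: in_chart_def)

lemma open_chart_domain: "c \<in> A \<Longrightarrow> open (fst c)"
  using is_chart[of c] by (simp add: is_chart_def)

lemma continuous_chart: "c \<in> A \<Longrightarrow> continuous_on (fst c) (snd c)"
  using is_chart[of c] by (simp add: is_chart_def homeomorphism_def)

lemma continuous_chart_inverse: "c \<in> A \<Longrightarrow> continuous_on (snd c ` fst c) (inv_into (fst c) (snd c))"
  using is_chart[of c] by (simp add: is_chart_def homeomorphism_def)

lemma open_chart_image: "c \<in> A \<Longrightarrow> open (snd c ` fst c)"
  using is_chart[of c] by (simp add: is_chart_def)

lemma open_chart_image_subset:
  assumes c: "c \<in> A" and T: "open T" "T \<subseteq> fst c"
  shows "open (snd c ` T)"
proof -
  have "snd c ` T = inv_into (fst c) (snd c) -` T \<inter> snd c ` fst c"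
    using c T by (auto simp: in_mono)
  moreover have "open (inv_into (fst c) (snd c) -` T \<inter> snd c ` fst c)"
    using continuous_chart_inverse[OF c] open_chart_image[OF c] T
    by (simp add: continuous_on_open_vimage)
  ultimately show ?thesis by simp
qed

lemma open_chart_preimage:
  assumes c: "c \<in> A" and T: "open T"
  shows "open {p \<in> fst c. snd c p \<in> T}"
proof -
  have "open (snd c -` T \<inter> fst c)"
    using continuous_chart[OF c] open_chart_domain[OF c] T by (simp add: continuous_on_open_vimage)
  then show ?thesis by (simp add: vimage_def Int_def conj_commute)
qed

lemma smooth_transition: "c \<in> A \<Longrightarrow> d \<in> A \<Longrightarrow> smooth_on (snd c ` (fst c \<inter> fst d)) (in_chart c (snd d))"
  using smooth_atlas by (simp add: smooth_atlas_def)

lemma in_chart_transition: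
  "c \<in> A \<Longrightarrow> d \<in> A \<Longrightarrow> y \<in> snd c ` (fst c \<inter> fst d) \<Longrightarrow>
    in_chart d f (in_chart c (snd d) y) = in_chart c f y"
  by auto

lemma transition_has_derivative:
  assumes "c \<in> A" "d \<in> A" "p \<in> fst c" "p \<in> fst d"
  shows "(in_chart c (snd d) has_derivative jac c d p) (at (snd c p))"
  using smooth_on_has_derivative[OF smooth_transition[OF assms(1,2)], of "snd c p"] assms
  by (simp add: chart_deriv_def[abs_def])

lemma jac_linear: "c \<in> A \<Longrightarrow> d \<in> A \<Longrightarrow> p \<in> fst c \<Longrightarrow> p \<in> fst d \<Longrightarrow> linear (jac c d p)"
  using transition_has_derivative has_derivative_linear by blast

lemma has_derivative_in_chart_change:
  assumes cd: "c \<in> A" "d \<in> A" "p \<in> fst c" "p \<in> fst d"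
    and f: "(in_chart d f has_derivative D) (at (snd d p))"
  shows "(in_chart c f has_derivative (\<lambda>v. D (jac c d p v))) (at (snd c p))"
proof -
  let ?T = "snd c ` (fst c \<inter> fst d)"
  have "((\<lambda>y. in_chart d f (in_chart c (snd d) y)) has_derivative (\<lambda>v. D (jac c d p v))) (at (snd c p))"
    by (rule has_derivative_compose[OF transition_has_derivative[OF cd]]) (use cd f in simp)
  then show ?thesis
    by (rule has_derivative_transform_within_open[of _ _ _ _ ?T])
      (use cd in_chart_transition in \<open>auto intro!: open_chart_image_subset open_Int open_chart_domain\<close>)
qed

lemma chart_deriv_change:
  assumes cd: "c \<in> A" "d \<in> A" "p \<in> fst c" "p \<in> fst d" and f: "in_chart d f differentiable (at (snd d p))"
  shows "chart_deriv c f p v = chart_deriv d f p (jac c d p v)"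
  using has_derivative_in_chart_change[OF cd has_derivative_frechet[OF f]]
  by (simp add: chart_deriv_def frechet_derivative_eqI)

lemma jac_self:
  assumes "c \<in> A" "p \<in> fst c"
  shows "jac c c p v = v"
proof -
  have "((\<lambda>x. x) has_derivative (\<lambda>v. v)) (at (snd c p))" by simp
  then have "(in_chart c (snd c) has_derivative (\<lambda>v. v)) (at (snd c p))"
    by (rule has_derivative_transform_within_open[of _ _ _ _ "snd c ` fst c"])
      (use assms open_chart_image in auto)
  then show ?thesis by (simp add: chart_deriv_def frechet_derivative_eqI)
qed

lemma jac_comp:
  assumes "c \<in> A" "d \<in> A" "e \<in> A" "p \<in> fst c" "p \<in> fst d" "p \<in> fst e"
  shows "jac d e p (jac c d p v) = jac c e p v"
proof -
  have "in_chart d (snd e) differentiable (at (snd d p))"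
    using transition_has_derivative[of d e p] assms unfolding differentiable_def by blast
  then show ?thesis using chart_deriv_change[of c d p "snd e" v] assms by simp
qed

lemma jac_inverse:
  "c \<in> A \<Longrightarrow> d \<in> A \<Longrightarrow> p \<in> fst c \<Longrightarrow> p \<in> fst d \<Longrightarrow> jac d c p (jac c d p v) = v"
  by (simp add: jac_comp jac_self)

lemma smooth_on_in_chart_change:
  fixes f :: "'m \<Rightarrow> 'b::real_normed_vector"
  assumes c: "c \<in> A" and d: "d \<in> A" and T: "open T" "T \<subseteq> fst c" "T \<subseteq> fst d"
    and f: "smooth_on (snd d ` T) (in_chart d f)"
  shows "smooth_on (snd c ` T) (in_chart c f)"
proof -
  have oT: "open (snd c ` T)" "open (snd d ` T)" using open_chart_image_subset c d T by auto
  have sub: "snd c ` T \<subseteq> snd c ` (fst c \<inter> fst d)" using T by auto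
  have "in_chart c (snd d) ` snd c ` T \<subseteq> snd d ` T"
    using c T by (auto simp: image_iff) (metis in_chart_apply subsetD)
  then have "smooth_on (snd c ` T) (\<lambda>y. in_chart d f (in_chart c (snd d) y))"
    by (rule smooth_on_compose[OF oT smooth_on_subset[OF smooth_transition[OF c d] sub] f])
  then show ?thesis
    by (rule smooth_on_cong[OF oT(1), rotated]) (use in_chart_transition[OF c d] sub in blast)
qed

lemma smooth_on_jac:
  assumes "c \<in> A" "d \<in> A"
  shows "smooth_on (snd c ` (fst c \<inter> fst d)) (in_chart c (\<lambda>p. jac c d p v))"
proof (rule smooth_on_cong[OF _ _ smooth_on_frechet_derivative[OF smooth_transition[OF assms], of v]])
  show "open (snd c ` (fst c \<inter> fst d))"
    using assms by (intro open_chart_image_subset open_Int open_chart_domain) auto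
qed (use assms in \<open>auto simp: chart_deriv_def\<close>)

text \<open>A compact set is closed in a Hausdorff space, so the domain of \<open>d\<close> is the
  union of two open sets: the overlap with \<open>c\<close>, where smoothness is transported by the
  transition map, and the complement of \<open>K\<close>, where \<open>F\<close> vanishes.\<close>

lemma smooth_on_extend:
  fixes F :: "'m \<Rightarrow> 'b::real_normed_vector"
  assumes c: "c \<in> A" and d: "d \<in> A" and K: "compact K" "K \<subseteq> fst c"
    and 0: "\<And>p. p \<in> fst d - K \<Longrightarrow> F p = 0"
    and F: "smooth_on (snd c ` (fst c \<inter> fst d)) (in_chart c F)"
  shows "smooth_on (snd d ` fst d) (in_chart d F)"
proof (rule smooth_on_local)
  fix y assume "y \<in> snd d ` fst d"
  then obtain q where q: "q \<in> fst d" "y = snd d q" by blast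
  show "\<exists>T. open T \<and> y \<in> T \<and> smooth_on T (in_chart d F)"
  proof (cases "q \<in> fst c")
    case True
    let ?T = "fst c \<inter> fst d"
    have oT: "open ?T" using c d open_chart_domain by blast
    have "smooth_on (snd d ` ?T) (in_chart d F)"
      using smooth_on_in_chart_change[OF d c oT _ _ F] by simp
    moreover have "open (snd d ` ?T)" using open_chart_image_subset d oT by simp
    moreover have "y \<in> snd d ` ?T" using q True by auto
    ultimately show ?thesis by blast
  next
    case False
    let ?T = "fst d - K"
    have oT: "open ?T" using K(1) d by (intro open_Diff compact_imp_closed open_chart_domain)
    then have oT': "open (snd d ` ?T)" using open_chart_image_subset d by simp
    have "smooth_on (snd d ` ?T) (in_chart d F)"
      by (rule smooth_on_cong[OF oT' _ smooth_on_const[OF oT', of 0]]) (use 0 d in auto)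
    moreover have "y \<in> snd d ` ?T" using q False K by auto
    ultimately show ?thesis using oT' by blast
  qed
qed

lemma smooth_function_extend:
  assumes "c \<in> A" "compact K" "K \<subseteq> fst c" "\<And>p. p \<notin> K \<Longrightarrow> F p = 0"
    "smooth_on (snd c ` fst c) (in_chart c F)"
  shows "F \<in> smooth_functions A"
proof -
  have "smooth_on (snd d ` fst d) (in_chart d F)" if d: "d \<in> A" for d
  proof (rule smooth_on_extend[OF assms(1) d assms(2,3)])
    show "smooth_on (snd c ` (fst c \<inter> fst d)) (in_chart c F)"
      by (rule smooth_on_subset[OF assms(5)]) auto
  qed (use assms(4) in auto)
  then show ?thesis by (simp add: smooth_functions_def)
qed

lemma smooth_functions_const: "(\<lambda>_. a) \<in> smooth_functions A"
proof -
  have "in_chart c (\<lambda>_. a) = (\<lambda>_. a)" for c :: "('m, 'n) chart" by (simp add: in_chart_def fun_eq_iff)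
  then show ?thesis by (simp add: smooth_functions_def smooth_on_const open_chart_image)
qed

text \<open>A Euclidean bump read in the chart. The compact set is the preimage of a closed
  coordinate ball, so extension by zero stays smooth across the edge of the chart domain.\<close>

lemma bump_exists:
  assumes c: "c \<in> A" and p: "p \<in> fst c" and T: "open T" "p \<in> T"
  obtains \<psi> K W where "\<psi> \<in> smooth_functions A" "compact K" "K \<subseteq> fst c \<inter> T" "open W" "p \<in> W" "W \<subseteq> K"
    "\<And>q. q \<in> W \<Longrightarrow> \<psi> q = 1" "\<And>q. q \<notin> K \<Longrightarrow> \<psi> q = 0" "\<And>q. 0 \<le> \<psi> q \<and> \<psi> q \<le> 1"
proof -
  let ?N = "snd c ` (fst c \<inter> T)"
  have "open ?N" using c T by (intro open_chart_image_subset open_Int open_chart_domain) auto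
  moreover have "snd c p \<in> ?N" using p T by blast
  ultimately obtain r where r: "r > 0" "cball (snd c p) r \<subseteq> ?N"
    using open_contains_cball by blast
  obtain \<phi> :: "real ^ 'n \<Rightarrow> real" where \<phi>: "smooth_on UNIV \<phi>" "\<And>x. x \<in> cball (snd c p) (r/2) \<Longrightarrow> \<phi> x = 1"
    "\<And>x. x \<notin> ball (snd c p) r \<Longrightarrow> \<phi> x = 0" "\<And>x. 0 \<le> \<phi> x \<and> \<phi> x \<le> 1"
    by (rule smooth_bump_exists[of "r/2" r "snd c p"]) (use r in auto)
  define K where "K = inv_into (fst c) (snd c) ` cball (snd c p) r"
  define \<psi> where "\<psi> = (\<lambda>q. if q \<in> fst c then \<phi> (snd c q) else 0)"
  define W where "W = {q \<in> fst c. snd c q \<in> ball (snd c p) (r/2)}"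
  have Kc: "compact K"
    unfolding K_def using r(2) continuous_chart_inverse[OF c]
    by (intro compact_continuous_image) (auto intro: continuous_on_subset)
  have KT: "K \<subseteq> fst c \<inter> T" using r(2) c by (auto simp: K_def subset_iff image_iff)
  have inK: "q \<in> K" if "q \<in> fst c" "snd c q \<in> cball (snd c p) r" for q
    using that c unfolding K_def by (metis chart_inverse imageI)
  have z: "\<psi> q = 0" if "q \<notin> K" for q
  proof (cases "q \<in> fst c \<and> snd c q \<in> ball (snd c p) r")
    case True
    then have "q \<in> K" using inK ball_subset_cball by blast
    then show ?thesis using that by simp
  next
    case False
    then show ?thesis using \<phi>(3)[of "snd c q"] unfolding \<psi>_def by presburger
  qed
  show thesis
  proof
    have "smooth_on (snd c ` fst c) (in_chart c \<psi>)"
      by (rule smooth_on_cong[OF open_chart_image[OF c] _ smooth_on_subset[OF \<phi>(1)]])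
        (use c in \<open>auto simp: \<psi>_def\<close>)
    with KT show "\<psi> \<in> smooth_functions A"
      by (intro smooth_function_extend[OF c Kc _ z]) auto
    show "open W" unfolding W_def by (rule open_chart_preimage[OF c]) simp
    show "p \<in> W" using p r by (simp add: W_def)
    show "W \<subseteq> K" using inK r by (auto simp: W_def)
    show "\<psi> q = 1" if "q \<in> W" for q using that \<phi>(2)[of "snd c q"] by (auto simp: W_def \<psi>_def)
    show "0 \<le> \<psi> q \<and> \<psi> q \<le> 1" for q using \<phi>(4) by (simp add: \<psi>_def)
  qed (use Kc KT z in auto)
qed

section \<open>Vector fields and their extension from a single chart\<close>

lemma vector_fieldD:
  assumes "X \<in> vector_fields A"
  shows "\<forall>c p. \<not> (c \<in> A \<and> p \<in> fst c) \<longrightarrow> X c p = 0"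
    and "\<forall>c\<in>A. \<forall>d\<in>A. \<forall>p \<in> fst c \<inter> fst d. X d p = jac c d p (X c p)"
    and "\<forall>c\<in>A. smooth_on (snd c ` fst c) (in_chart c (X c))"
  using assms unfolding vector_fields_def mem_Collect_eq by - ((elim conjE, assumption)+)

lemma vector_field_off: "X \<in> vector_fields A \<Longrightarrow> \<not> (c \<in> A \<and> p \<in> fst c) \<Longrightarrow> X c p = 0"
  using vector_fieldD(1) by iprover

lemma vector_field_change:
  assumes "X \<in> vector_fields A" "c \<in> A" "d \<in> A" "p \<in> fst c" "p \<in> fst d"
  shows "X d p = jac c d p (X c p)"
  by (rule vector_fieldD(2)[OF assms(1), rule_format]) (use assms in auto)

lemma vector_field_smooth: "X \<in> vector_fields A \<Longrightarrow> c \<in> A \<Longrightarrow> smooth_on (snd c ` fst c) (in_chart c (X c))"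
  by (rule vector_fieldD(3)[rule_format])

lemma vector_field_has_derivative:
  "X \<in> vector_fields A \<Longrightarrow> c \<in> A \<Longrightarrow> p \<in> fst c \<Longrightarrow>
    (in_chart c (X c) has_derivative chart_deriv c (X c) p) (at (snd c p))"
  using smooth_on_has_derivative[OF vector_field_smooth, of X c "snd c p"]
  by (simp add: chart_deriv_def[abs_def])

lemma vector_field_eqI:
  assumes X: "X \<in> vector_fields A" "Y \<in> vector_fields A"
    and eq: "\<And>p. \<exists>c\<in>A. p \<in> fst c \<and> X c p = Y c p"
  shows "X = Y"
proof (intro ext)
  fix d p
  show "X d p = Y d p"
  proof (cases "d \<in> A \<and> p \<in> fst d")
    case True
    obtain c where "c \<in> A" "p \<in> fst c" "X c p = Y c p" using eq by blast
    then show ?thesis using True vector_field_change X by metis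
  qed (simp add: vector_field_off[OF X(1)] vector_field_off[OF X(2)])
qed

lemma in_chart_binop: "in_chart c (\<lambda>p. F (f p) (g p)) = (\<lambda>y. F (in_chart c f y) (in_chart c g y))"
  by (simp add: in_chart_def fun_eq_iff)

lemma vector_fields_add:
  assumes X: "X \<in> vector_fields A" "Y \<in> vector_fields A"
  shows "(\<lambda>c p. X c p + Y c p) \<in> vector_fields A"
  unfolding vector_fields_def
proof (intro CollectI conjI allI ballI impI)
  fix c d p assume cd: "c \<in> A" "d \<in> A" "p \<in> fst c \<inter> fst d"
  then show "X d p + Y d p = jac c d p (X c p + Y c p)"
    using vector_field_change[of X c d p] vector_field_change[of Y c d p] X
      linear_add[OF jac_linear[of c d p]] by simp
next
  fix c assume "c \<in> A"
  then show "smooth_on (snd c ` fst c) (in_chart c (\<lambda>p. X c p + Y c p))"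
    unfolding in_chart_binop by (intro smooth_on_add open_chart_image vector_field_smooth X)
qed (simp add: vector_field_off[OF X(1)] vector_field_off[OF X(2)])

lemma vector_fields_scale:
  assumes f: "f \<in> smooth_functions A" and X: "X \<in> vector_fields A"
  shows "(\<lambda>c p. f p *\<^sub>R X c p) \<in> vector_fields A"
  unfolding vector_fields_def
proof (intro CollectI conjI allI ballI impI)
  fix c d p assume cd: "c \<in> A" "d \<in> A" "p \<in> fst c \<inter> fst d"
  then show "f p *\<^sub>R X d p = jac c d p (f p *\<^sub>R X c p)"
    using vector_field_change[of X c d p] X linear_scale[OF jac_linear[of c d p]] by simp
next
  fix c assume "c \<in> A"
  then show "smooth_on (snd c ` fst c) (in_chart c (\<lambda>p. f p *\<^sub>R X c p))"
    unfolding in_chart_binop using f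
    by (intro smooth_on_scaleR open_chart_image vector_field_smooth X) (auto simp: smooth_functions_def)
qed (simp add: vector_field_off[OF X])

lemma vector_fields_0: "(\<lambda>c p. 0) \<in> vector_fields A"
proof -
  have "in_chart c (\<lambda>_. 0) = (\<lambda>_. 0 :: real ^ 'n)" for c :: "('m, 'n) chart"
    by (simp add: in_chart_def fun_eq_iff)
  then show ?thesis
    by (simp add: vector_fields_def smooth_on_const open_chart_image linear_0[OF jac_linear])
qed

lemma vector_fields_sum:
  assumes "finite I" "\<And>i. i \<in> I \<Longrightarrow> f i \<in> smooth_functions A" "\<And>i. i \<in> I \<Longrightarrow> X i \<in> vector_fields A"
  shows "(\<lambda>c p. \<Sum>i\<in>I. f i p *\<^sub>R X i c p) \<in> vector_fields A"
  using assms
  by (induction I) (simp_all add: vector_fields_0 vector_fields_add vector_fields_scale)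

lemma vector_fields_diff:
  assumes X: "X \<in> vector_fields A" "Y \<in> vector_fields A"
  shows "(\<lambda>c p. X c p - Y c p) \<in> vector_fields A"
  using vector_fields_add[OF X(1) vector_fields_scale[OF smooth_functions_const[of "-1"] X(2)]] by simp

text \<open>The tangent vectors with components \<open>h\<close> in the chart \<open>c\<close>, read
  off in all charts. This is how a global field is made from data in one chart once \<open>h\<close>
  has been cut off.\<close>

definition extend_field :: "('m, 'n) chart \<Rightarrow> ('m \<Rightarrow> real ^ 'n) \<Rightarrow> ('m, 'n) field" where
  "extend_field c h = (\<lambda>d p. if d \<in> A \<and> p \<in> fst d \<and> p \<in> fst c then jac c d p (h p) else 0)"

lemma extend_field_apply: "c \<in> A \<Longrightarrow> p \<in> fst c \<Longrightarrow> extend_field c h c p = h p"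
  by (simp add: extend_field_def jac_self)

lemma extend_field:
  assumes c: "c \<in> A" and K: "compact K" "K \<subseteq> fst c" and 0: "\<And>p. p \<notin> K \<Longrightarrow> h p = 0"
    and h: "smooth_on (snd c ` fst c) (in_chart c h)"
  shows "extend_field c h \<in> vector_fields A"
  unfolding vector_fields_def
proof (intro CollectI conjI allI ballI impI)
  fix d e p assume de: "d \<in> A" "e \<in> A" "p \<in> fst d \<inter> fst e"
  show "extend_field c h e p = jac d e p (extend_field c h d p)"
  proof (cases "p \<in> fst c")
    case True
    then show ?thesis using de c by (simp add: extend_field_def jac_comp)
  next
    case False
    have "jac d e p 0 = 0" using de by (intro linear_0 jac_linear) auto
    then show ?thesis using False by (simp add: extend_field_def)
  qed
next
  fix d assume d: "d \<in> A"
  show "smooth_on (snd d ` fst d) (in_chart d (extend_field c h d))"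
  proof (rule smooth_on_extend[OF c d K])
    fix p assume "p \<in> fst d - K"
    then show "extend_field c h d p = 0"
      using 0 linear_0[OF jac_linear[of c d p]] d c by (simp add: extend_field_def)
  next
    let ?T = "snd c ` (fst c \<inter> fst d)"
    have oT: "open ?T"
      using c d by (intro open_chart_image_subset open_Int open_chart_domain) auto
    have h': "smooth_on ?T (in_chart c h)" by (rule smooth_on_subset[OF h]) auto
    have "smooth_on ?T (\<lambda>y. \<Sum>b\<in>Basis. (in_chart c h y \<bullet> b) *\<^sub>R in_chart c (\<lambda>p. jac c d p b) y)"
      by (intro smooth_on_sum smooth_on_scaleR oT smooth_on_jac c d
          smooth_on_bounded_linear_comp[OF bounded_linear_inner_left] h')
    then show "smooth_on ?T (in_chart c (extend_field c h d))"
    proof (rule smooth_on_cong[OF oT, rotated])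
      fix y assume "y \<in> ?T"
      then obtain p where p: "p \<in> fst c" "p \<in> fst d" "y = snd c p" by blast
      interpret J: linear "jac c d p" using jac_linear c d p by blast
      have "jac c d p (h p) = jac c d p (\<Sum>b\<in>Basis. (h p \<bullet> b) *\<^sub>R b)" by (simp add: euclidean_representation)
      then show "(\<Sum>b\<in>Basis. (in_chart c h y \<bullet> b) *\<^sub>R in_chart c (\<lambda>p. jac c d p b) y) =
          in_chart c (extend_field c h d) y"
        using p c d by (simp add: extend_field_def J.sum J.scale)
    qed
  qed
qed (auto simp: extend_field_def)

text \<open>Connections act on global vector fields only, so the coordinate fields of the ball are cut off
  outside it.\<close>

definition coordinate_ball :: "('m, 'n) chart \<Rightarrow> real ^ 'n \<Rightarrow> real \<Rightarrow> 'm set" where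
  "coordinate_ball c a r = {p \<in> fst c. snd c p \<in> ball a r}"

definition frame :: "('m, 'n) chart \<Rightarrow> real ^ 'n \<Rightarrow> real \<Rightarrow> (real ^ 'n \<Rightarrow> ('m, 'n) field) \<Rightarrow> bool" where
  "frame c a r e \<longleftrightarrow> c \<in> A \<and> r > 0 \<and> ball a r \<subseteq> snd c ` fst c \<and> (\<forall>v. e v \<in> vector_fields A) \<and>
     (\<forall>v. \<forall>p \<in> coordinate_ball c a r. e v c p = v) \<and> (\<forall>d p. linear (\<lambda>v. e v d p))"

text \<open>One cut-off function multiplies all constant fields, which keeps the dependence on the
  direction linear at every point. It equals 1 on the ball of half the radius, and that smaller ball
  is the frame's.\<close>

lemma frame_exists:
  assumes c: "c \<in> A" and p: "p \<in> fst c"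
  obtains r e where "frame c (snd c p) r e"
proof -
  obtain R where R: "R > 0" "cball (snd c p) R \<subseteq> snd c ` fst c"
    using open_chart_image[OF c] p open_contains_cball by blast
  obtain \<phi> :: "real ^ 'n \<Rightarrow> real" where \<phi>: "smooth_on UNIV \<phi>" "\<And>x. x \<in> cball (snd c p) (R/2) \<Longrightarrow> \<phi> x = 1"
    "\<And>x. x \<notin> ball (snd c p) R \<Longrightarrow> \<phi> x = 0"
    by (rule smooth_bump_exists[of "R/2" R "snd c p"]) (use R in auto)
  define K where "K = inv_into (fst c) (snd c) ` cball (snd c p) R"
  have Kc: "compact K"
    unfolding K_def using R(2) continuous_chart_inverse[OF c]
    by (intro compact_continuous_image) (auto intro: continuous_on_subset)
  have KT: "K \<subseteq> fst c" using R(2) c by (auto simp: K_def subset_iff image_iff)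
  have inK: "q \<in> K" if "q \<in> fst c" "snd c q \<in> cball (snd c p) R" for q
    using that c unfolding K_def by (metis chart_inverse imageI)
  define h where "h = (\<lambda>v q. if q \<in> fst c then \<phi> (snd c q) *\<^sub>R v else 0 :: real ^ 'n)"
  have z: "h v q = 0" if "q \<notin> K" for q v
  proof (cases "q \<in> fst c \<and> snd c q \<in> ball (snd c p) R")
    case True
    then have "q \<in> K" using inK ball_subset_cball by blast
    then show ?thesis using that by simp
  next
    case False
    then have "q \<in> fst c \<Longrightarrow> \<phi> (snd c q) = 0" using \<phi>(3) by blast
    then show ?thesis by (simp add: h_def)
  qed
  show thesis
  proof
    have "extend_field c (h v) \<in> vector_fields A" for v
    proof (rule extend_field[OF c Kc KT z])
      have "smooth_on UNIV (\<lambda>x. \<phi> x *\<^sub>R v)"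
        by (intro smooth_on_scaleR \<phi> smooth_on_const) auto
      then show "smooth_on (snd c ` fst c) (in_chart c (h v))"
        by (intro smooth_on_cong[OF open_chart_image[OF c] _ smooth_on_subset])
          (use c in \<open>auto simp: h_def\<close>)
    qed
    moreover have "linear (\<lambda>v. extend_field c (h v) d q)" for d q
    proof (cases "d \<in> A \<and> q \<in> fst d \<and> q \<in> fst c")
      case True
      then interpret J: linear "jac c d q" by (simp add: jac_linear c)
      show ?thesis using True
        by (intro linearI) (simp_all add: extend_field_def h_def J.add J.scale scaleR_add_right)
    next
      case False
      then have "extend_field c (h v) d q = 0" for v unfolding extend_field_def by presburger
      then show ?thesis by (simp add: linear_iff)
    qed
    moreover have "ball (snd c p) (R/2) \<subseteq> cball (snd c p) R"
      using R(1) by (auto simp: subset_iff)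
    ultimately show "frame c (snd c p) (R/2) (\<lambda>v. extend_field c (h v))"
      using R c \<phi>(2) by (auto simp: frame_def coordinate_ball_def extend_field_apply h_def)
  qed
qed

lemma frame_sum:
  assumes "frame c a r e"
  shows "e v d p = (\<Sum>i\<in>UNIV. v $ i *\<^sub>R e (axis i 1) d p)"
proof -
  interpret linear "\<lambda>v. e v d p" using assms unfolding frame_def by blast
  have "e v d p = e (\<Sum>i\<in>UNIV. v $ i *\<^sub>R axis i 1) d p"
    using basis_expansion[of v] by (simp add: scalar_mult_eq_scaleR)
  then show ?thesis by (simp add: sum scale)
qed

lemma open_coordinate_ball: "c \<in> A \<Longrightarrow> open (coordinate_ball c a r)"
  unfolding coordinate_ball_def by (rule open_chart_preimage) auto

end

section \<open>Affine connections in coordinates\<close>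

lemma linear_coordinate_sum: "linear (\<lambda>v :: real ^ 'n. \<Sum>i\<in>UNIV. v $ i *\<^sub>R (g i :: 'b::real_vector))"
  by (intro linearI) (simp_all add: scaleR_add_left sum.distrib scaleR_sum_right)

lemma trace_matrix: "trace (matrix f) = (\<Sum>k\<in>UNIV. f (axis k 1) $ k)"
  by (simp add: trace_def matrix_def)

lemma trace_matrix_compose_commute:
  fixes f g :: "real ^ 'n \<Rightarrow> real ^ 'n"
  assumes "linear f" "linear g"
  shows "trace (matrix (\<lambda>v. f (g v))) = trace (matrix (\<lambda>v. g (f v)))"
  using matrix_compose[OF assms] matrix_compose[OF assms(2,1)] trace_mul_sym[of "matrix f" "matrix g"]
  by (simp add: o_def)

text \<open>Cyclicity of the trace brings \<open>J\<close> next to \<open>L\<close>, where they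
  cancel. With Jacobians in these places the lemma makes traces independent of the chart.\<close>

lemma trace_matrix_conjugate:
  fixes J K L :: "real ^ 'n \<Rightarrow> real ^ 'n"
  assumes "linear J" "linear K" "linear L" and LJ: "\<And>v. L (J v) = v"
  shows "trace (matrix (\<lambda>v. J (K (L v)))) = trace (matrix K)"
  using trace_matrix_compose_commute[of J "\<lambda>v. K (L v)"] linear_compose[OF assms(3,2)] assms(1) LJ
  by (simp add: o_def)

lemma (in atlas) chart_deriv_const: "chart_deriv c (\<lambda>_. a) p v = 0"
proof -
  have "in_chart c (\<lambda>_. a) = (\<lambda>_. a)" by (simp add: in_chart_def fun_eq_iff)
  then show ?thesis by (simp add: chart_deriv_def)
qed

lemma (in atlas) chart_deriv_eqI:
  "(in_chart c f has_derivative D) (at (snd c p)) \<Longrightarrow> chart_deriv c f p v = D v"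
  by (simp add: chart_deriv_def frechet_derivative_eqI)

lemma (in atlas) chart_deriv_cong:
  assumes c: "c \<in> A" and W: "open W" "p \<in> W" "p \<in> fst c" and eq: "\<And>q. q \<in> W \<Longrightarrow> q \<in> fst c \<Longrightarrow> f q = g q"
  shows "chart_deriv c f p = chart_deriv c g p"
proof -
  have "frechet_derivative (in_chart c f) (at (snd c p)) = frechet_derivative (in_chart c g) (at (snd c p))"
  proof (rule frechet_derivative_cong_open[of "snd c ` (W \<inter> fst c)"])
    show "open (snd c ` (W \<inter> fst c))"
      using c W by (intro open_chart_image_subset open_Int open_chart_domain) auto
  qed (use c W eq in auto)
  then show ?thesis by (simp add: chart_deriv_def[abs_def])
qed

locale connection = atlas A for A :: "('m::t2_space, 'n::finite) chart set" +
  fixes nabla :: "('m, 'n) connection"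
  assumes affine: "affine_connection A nabla"
begin

lemma affineD:
  shows "\<forall>X\<in>vector_fields A. \<forall>Y\<in>vector_fields A. nabla X Y \<in> vector_fields A"
    and "\<forall>X\<in>vector_fields A. \<forall>X'\<in>vector_fields A. \<forall>Y\<in>vector_fields A.
      nabla (\<lambda>c p. X c p + X' c p) Y = (\<lambda>c p. nabla X Y c p + nabla X' Y c p)"
    and "\<forall>f\<in>smooth_functions A. \<forall>X\<in>vector_fields A. \<forall>Y\<in>vector_fields A.
      nabla (\<lambda>c p. f p *\<^sub>R X c p) Y = (\<lambda>c p. f p *\<^sub>R nabla X Y c p)"
    and "\<forall>X\<in>vector_fields A. \<forall>Y\<in>vector_fields A. \<forall>Y'\<in>vector_fields A.
      nabla X (\<lambda>c p. Y c p + Y' c p) = (\<lambda>c p. nabla X Y c p + nabla X Y' c p)"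
    and "\<forall>f\<in>smooth_functions A. \<forall>X\<in>vector_fields A. \<forall>Y\<in>vector_fields A.
      nabla X (\<lambda>c p. f p *\<^sub>R Y c p) =
        (\<lambda>c p. f p *\<^sub>R nabla X Y c p + chart_deriv c f p (X c p) *\<^sub>R Y c p)"
  using affine unfolding affine_connection_def by - ((elim conjE, assumption)+)

lemma nabla_field: "X \<in> vector_fields A \<Longrightarrow> Y \<in> vector_fields A \<Longrightarrow> nabla X Y \<in> vector_fields A"
  by (rule affineD(1)[rule_format])

lemmas nabla_add_left = affineD(2)[rule_format, THEN fun_cong, THEN fun_cong]
lemmas nabla_scale_left = affineD(3)[rule_format, THEN fun_cong, THEN fun_cong]
lemmas nabla_add_right = affineD(4)[rule_format, THEN fun_cong, THEN fun_cong]
lemmas nabla_scale_right = affineD(5)[rule_format, THEN fun_cong, THEN fun_cong]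

lemma nabla_sum_left:
  assumes "finite I" "\<And>i. i \<in> I \<Longrightarrow> f i \<in> smooth_functions A" "\<And>i. i \<in> I \<Longrightarrow> X i \<in> vector_fields A"
    and Y: "Y \<in> vector_fields A"
  shows "nabla (\<lambda>c p. \<Sum>i\<in>I. f i p *\<^sub>R X i c p) Y d q = (\<Sum>i\<in>I. f i q *\<^sub>R nabla (X i) Y d q)"
  using assms(1-3)
proof (induction I)
  case empty
  then show ?case using nabla_scale_left[OF smooth_functions_const[of 0] Y Y] by simp
next
  case (insert i I)
  have "nabla (\<lambda>c p. f i p *\<^sub>R X i c p + (\<Sum>i\<in>I. f i p *\<^sub>R X i c p)) Y d q =
      nabla (\<lambda>c p. f i p *\<^sub>R X i c p) Y d q + nabla (\<lambda>c p. \<Sum>i\<in>I. f i p *\<^sub>R X i c p) Y d q"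
    by (rule nabla_add_left[OF _ _ Y])
      (use insert in \<open>auto intro: vector_fields_scale vector_fields_sum\<close>)
  with insert Y show ?case by (simp add: nabla_scale_left)
qed

lemma nabla_sum_right:
  assumes "finite I" "\<And>i. i \<in> I \<Longrightarrow> f i \<in> smooth_functions A" "\<And>i. i \<in> I \<Longrightarrow> Y i \<in> vector_fields A"
    and X: "X \<in> vector_fields A"
  shows "nabla X (\<lambda>c p. \<Sum>i\<in>I. f i p *\<^sub>R Y i c p) d q =
    (\<Sum>i\<in>I. f i q *\<^sub>R nabla X (Y i) d q + chart_deriv d (f i) q (X d q) *\<^sub>R Y i d q)"
  using assms(1-3)
proof (induction I)
  case empty
  then show ?case
    using nabla_scale_right[OF smooth_functions_const[of 0] X X] by (simp add: chart_deriv_const)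
next
  case (insert i I)
  have "nabla X (\<lambda>c p. f i p *\<^sub>R Y i c p + (\<Sum>i\<in>I. f i p *\<^sub>R Y i c p)) d q =
      nabla X (\<lambda>c p. f i p *\<^sub>R Y i c p) d q + nabla X (\<lambda>c p. \<Sum>i\<in>I. f i p *\<^sub>R Y i c p) d q"
    by (rule nabla_add_right[OF X])
      (use insert in \<open>auto intro: vector_fields_scale vector_fields_sum\<close>)
  with insert X show ?case by (simp add: nabla_scale_right)
qed

end

section \<open>Christoffel symbols on a coordinate ball\<close>

locale framed_connection = connection A nabla for A :: "('m::t2_space, 'n::finite) chart set" and nabla +
  fixes c :: "('m, 'n) chart" and a :: "real ^ 'n" and r :: real and e :: "real ^ 'n \<Rightarrow> ('m, 'n) field"
  assumes is_frame: "frame c a r e"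
begin

abbreviation "patch \<equiv> coordinate_ball c a r"

lemma c: "c \<in> A" using is_frame unfolding frame_def by blast
lemma frame_field: "e v \<in> vector_fields A" using is_frame unfolding frame_def by blast
lemma frame_apply: "p \<in> patch \<Longrightarrow> e v c p = v" using is_frame unfolding frame_def by blast
lemma patch_chart: "p \<in> patch \<Longrightarrow> p \<in> fst c" by (simp add: coordinate_ball_def)
lemma open_patch: "open patch" using open_coordinate_ball c by blast

lemma frame_field_sum: "e v = (\<lambda>d p. \<Sum>i\<in>UNIV. v $ i *\<^sub>R e (axis i 1) d p)"
  using frame_sum[OF is_frame] by (intro ext)

text \<open>The components of \<open>X\<close> are functions on one chart only, but the axioms of a
  connection admit global coefficients. After multiplication by a bump supported in the patch,
  \<open>X\<close> is a combination of the frame fields with global smooth coefficients, and nothing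
  has changed near \<open>p\<close>.\<close>

lemma localize:
  assumes X: "X \<in> vector_fields A" and p: "p \<in> patch"
  obtains \<psi> W where "\<psi> \<in> smooth_functions A" "open W" "p \<in> W" "\<And>q. q \<in> W \<Longrightarrow> \<psi> q = 1"
    "\<And>i. (\<lambda>q. \<psi> q * X c q $ i) \<in> smooth_functions A"
    "(\<lambda>d q. \<psi> q *\<^sub>R X d q) = (\<lambda>d q. \<Sum>i\<in>UNIV. (\<psi> q * X c q $ i) *\<^sub>R e (axis i 1) d q)"
proof -
  obtain \<psi> K W where \<psi>: "\<psi> \<in> smooth_functions A" "compact K" "K \<subseteq> fst c \<inter> patch" "open W" "p \<in> W" "W \<subseteq> K"
    "\<And>q. q \<in> W \<Longrightarrow> \<psi> q = 1" "\<And>q. q \<notin> K \<Longrightarrow> \<psi> q = 0"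
    "\<And>q. 0 \<le> \<psi> q \<and> \<psi> q \<le> 1"
    by (rule bump_exists[OF c patch_chart[OF p] open_patch p]) (rule that)
  have sf: "(\<lambda>q. \<psi> q * X c q $ i) \<in> smooth_functions A" for i
  proof (rule smooth_function_extend[OF c \<psi>(2)])
    have "smooth_on (snd c ` fst c) (\<lambda>y. in_chart c \<psi> y * in_chart c (X c) y $ i)"
      using \<psi>(1) c
      by (intro smooth_on_mult open_chart_image
          smooth_on_bounded_linear_comp[OF bounded_linear_vec_nth] vector_field_smooth X)
        (auto simp: smooth_functions_def)
    then show "smooth_on (snd c ` fst c) (in_chart c (\<lambda>q. \<psi> q * X c q $ i))"
      by (simp add: in_chart_def o_def)
  qed (use \<psi> in auto)
  have "(\<lambda>d q. \<psi> q *\<^sub>R X d q) = (\<lambda>d q. \<Sum>i\<in>UNIV. (\<psi> q * X c q $ i) *\<^sub>R e (axis i 1) d q)"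
  proof (rule vector_field_eqI)
    show "(\<lambda>d q. \<psi> q *\<^sub>R X d q) \<in> vector_fields A" by (rule vector_fields_scale[OF \<psi>(1) X])
    show "(\<lambda>d q. \<Sum>i\<in>UNIV. (\<psi> q * X c q $ i) *\<^sub>R e (axis i 1) d q) \<in> vector_fields A"
      by (intro vector_fields_sum sf frame_field) auto
    fix q
    show "\<exists>d\<in>A. q \<in> fst d \<and> \<psi> q *\<^sub>R X d q = (\<Sum>i\<in>UNIV. (\<psi> q * X c q $ i) *\<^sub>R e (axis i 1) d q)"
    proof (cases "q \<in> patch")
      case True
      have "(\<Sum>i\<in>UNIV. (\<psi> q * X c q $ i) *\<^sub>R e (axis i 1) c q) = \<psi> q *\<^sub>R (\<Sum>i\<in>UNIV. X c q $ i *\<^sub>R axis i 1)"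
        using frame_apply[OF True] by (simp add: scaleR_sum_right)
      also have "\<dots> = \<psi> q *\<^sub>R X c q" using basis_expansion[of "X c q"] by (simp add: scalar_mult_eq_scaleR)
      finally have "\<psi> q *\<^sub>R X c q = (\<Sum>i\<in>UNIV. (\<psi> q * X c q $ i) *\<^sub>R e (axis i 1) c q)" ..
      with c patch_chart[OF True] show ?thesis by blast
    next
      case False
      then have "\<psi> q = 0" using \<psi> by blast
      moreover obtain d where "d \<in> A" "q \<in> fst d" by (rule chart_at)
      ultimately show ?thesis by auto
    qed
  qed
  with \<psi> sf show thesis using that by blast
qed

lemma nabla_frame_left:
  assumes Y: "Y \<in> vector_fields A"
  shows "nabla (e v) Y d q = (\<Sum>i\<in>UNIV. v $ i *\<^sub>R nabla (e (axis i 1)) Y d q)"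
proof -
  have "nabla (\<lambda>d q. \<Sum>i\<in>UNIV. v $ i *\<^sub>R e (axis i 1) d q) Y d q =
      (\<Sum>i\<in>UNIV. v $ i *\<^sub>R nabla (e (axis i 1)) Y d q)"
    using nabla_sum_left[of UNIV "\<lambda>i _. v $ i" "\<lambda>i. e (axis i 1)" Y d q,
        OF finite_class.finite_UNIV smooth_functions_const frame_field Y] .
  then show ?thesis unfolding frame_field_sum[of v, symmetric] .
qed

lemma nabla_frame_right:
  assumes X: "X \<in> vector_fields A"
  shows "nabla X (e v) d q = (\<Sum>i\<in>UNIV. v $ i *\<^sub>R nabla X (e (axis i 1)) d q)"
proof -
  have "nabla X (\<lambda>d q. \<Sum>i\<in>UNIV. v $ i *\<^sub>R e (axis i 1) d q) d q =
      (\<Sum>i\<in>UNIV. v $ i *\<^sub>R nabla X (e (axis i 1)) d q + chart_deriv d (\<lambda>_. v $ i) q (X d q) *\<^sub>R e (axis i 1) d q)"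
    using nabla_sum_right[of UNIV "\<lambda>i _. v $ i" "\<lambda>i. e (axis i 1)" X d q,
        OF finite_class.finite_UNIV smooth_functions_const frame_field X] .
  then show ?thesis
    unfolding frame_field_sum[of v, symmetric] chart_deriv_const scaleR_zero_left add_0_right .
qed

lemma nabla_linear_left:
  assumes "Y \<in> vector_fields A"
  shows "linear (\<lambda>v. nabla (e v) Y d q)"
proof -
  have "(\<lambda>v. nabla (e v) Y d q) = (\<lambda>v. \<Sum>i\<in>UNIV. v $ i *\<^sub>R nabla (e (axis i 1)) Y d q)"
    by (intro ext nabla_frame_left assms)
  then show ?thesis by (simp only: linear_coordinate_sum)
qed

lemma nabla_linear_right:
  assumes "X \<in> vector_fields A"
  shows "linear (\<lambda>v. nabla X (e v) d q)"
proof -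
  have "(\<lambda>v. nabla X (e v) d q) = (\<lambda>v. \<Sum>i\<in>UNIV. v $ i *\<^sub>R nabla X (e (axis i 1)) d q)"
    by (intro ext nabla_frame_right assms)
  then show ?thesis by (simp only: linear_coordinate_sum)
qed

text \<open>Linearity over smooth functions turns the expansion of \<open>localize\<close> into one
  involving the components of \<open>X\<close> at \<open>p\<close> alone, so the first argument
  enters pointwise.\<close>

lemma nabla_at_left:
  assumes X: "X \<in> vector_fields A" and Y: "Y \<in> vector_fields A" and p: "p \<in> patch"
  shows "nabla X Y c p = nabla (e (X c p)) Y c p"
proof -
  obtain \<psi> W where \<psi>: "\<psi> \<in> smooth_functions A" "open W" "p \<in> W" "\<And>q. q \<in> W \<Longrightarrow> \<psi> q = 1"
    "\<And>i. (\<lambda>q. \<psi> q * X c q $ i) \<in> smooth_functions A"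
    "(\<lambda>d q. \<psi> q *\<^sub>R X d q) = (\<lambda>d q. \<Sum>i\<in>UNIV. (\<psi> q * X c q $ i) *\<^sub>R e (axis i 1) d q)"
    by (rule localize[OF X p]) (rule that)
  have "nabla X Y c p = nabla (\<lambda>d q. \<psi> q *\<^sub>R X d q) Y c p"
    using nabla_scale_left[OF \<psi>(1) X Y] \<psi>(3,4) by simp
  also have "\<dots> = (\<Sum>i\<in>UNIV. X c p $ i *\<^sub>R nabla (e (axis i 1)) Y c p)"
    unfolding \<psi>(6) using nabla_sum_left[of UNIV "\<lambda>i q. \<psi> q * X c q $ i" "\<lambda>i. e (axis i 1)" Y c p]
      \<psi>(3,4,5) Y by (simp add: frame_field)
  finally show ?thesis using nabla_frame_left[OF Y, of "X c p" c p] by (simp only:)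
qed

text \<open>The Leibniz rule applied to the expansion of \<open>localize\<close>. The bump is
  constant near \<open>p\<close>, so its derivative vanishes there and only the components of
  \<open>Y\<close> get differentiated.\<close>

lemma nabla_at_right:
  assumes X: "X \<in> vector_fields A" and Y: "Y \<in> vector_fields A" and p: "p \<in> patch"
  shows "nabla X Y c p = chart_deriv c (Y c) p (X c p) + nabla X (e (Y c p)) c p"
proof -
  obtain \<psi> W where \<psi>: "\<psi> \<in> smooth_functions A" "open W" "p \<in> W" "\<And>q. q \<in> W \<Longrightarrow> \<psi> q = 1"
    "\<And>i. (\<lambda>q. \<psi> q * Y c q $ i) \<in> smooth_functions A"
    "(\<lambda>d q. \<psi> q *\<^sub>R Y d q) = (\<lambda>d q. \<Sum>i\<in>UNIV. (\<psi> q * Y c q $ i) *\<^sub>R e (axis i 1) d q)"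
    by (rule localize[OF Y p]) (rule that)
  have pc: "p \<in> fst c" using p by (rule patch_chart)
  have "chart_deriv c \<psi> p = chart_deriv c (\<lambda>_. 1) p"
    by (rule chart_deriv_cong[OF c \<psi>(2,3) pc]) (use \<psi>(4) in simp)
  then have "nabla X Y c p = nabla X (\<lambda>d q. \<psi> q *\<^sub>R Y d q) c p"
    using nabla_scale_right[OF \<psi>(1) X Y] \<psi>(3,4) by (simp add: chart_deriv_const)
  also have "\<dots> = (\<Sum>i\<in>UNIV. Y c p $ i *\<^sub>R nabla X (e (axis i 1)) c p +
      chart_deriv c (\<lambda>q. \<psi> q * Y c q $ i) p (X c p) *\<^sub>R axis i 1)"
    unfolding \<psi>(6) using nabla_sum_right[of UNIV "\<lambda>i q. \<psi> q * Y c q $ i" "\<lambda>i. e (axis i 1)" X c p]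
      \<psi>(3,4,5) X p by (simp add: frame_field frame_apply)
  also have "\<dots> = nabla X (e (Y c p)) c p + (\<Sum>i\<in>UNIV. chart_deriv c (Y c) p (X c p) $ i *\<^sub>R axis i 1)"
  proof -
    have "chart_deriv c (\<lambda>q. \<psi> q * Y c q $ i) p (X c p) = chart_deriv c (Y c) p (X c p) $ i" for i
    proof -
      have "chart_deriv c (\<lambda>q. \<psi> q * Y c q $ i) p = chart_deriv c (\<lambda>q. Y c q $ i) p"
        by (rule chart_deriv_cong[OF c \<psi>(2,3) pc]) (use \<psi>(4) in simp)
      moreover have "(in_chart c (\<lambda>q. Y c q $ i) has_derivative (\<lambda>h. chart_deriv c (Y c) p h $ i)) (at (snd c p))"
        using bounded_linear.has_derivative[OF bounded_linear_vec_nth vector_field_has_derivative[OF Y c pc], of i]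
        by (simp add: in_chart_def o_def)
      ultimately show ?thesis by (simp add: chart_deriv_eqI)
    qed
    then show ?thesis using nabla_frame_right[OF X, of "Y c p" c p] by (simp only: sum.distrib)
  qed
  also have "(\<Sum>i\<in>UNIV. chart_deriv c (Y c) p (X c p) $ i *\<^sub>R axis i 1) = chart_deriv c (Y c) p (X c p)"
    using basis_expansion[of "chart_deriv c (Y c) p (X c p)"] by (simp add: scalar_mult_eq_scaleR)
  finally show ?thesis by simp
qed

text \<open>The usual coordinate expression: the vectors \<open>nabla (e v) (e w) c p\<close> are
  the Christoffel symbols, bilinear in \<open>v\<close> and \<open>w\<close>.\<close>

lemma nabla_at:
  assumes "X \<in> vector_fields A" "Y \<in> vector_fields A" "p \<in> patch"
  shows "nabla X Y c p = chart_deriv c (Y c) p (X c p) + nabla (e (X c p)) (e (Y c p)) c p"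
  using nabla_at_right[OF assms] nabla_at_left[OF assms(1) frame_field assms(3)] by simp

lemma chart_deriv_frame:
  assumes p: "p \<in> patch"
  shows "chart_deriv c (e v c) p w = 0"
proof -
  have "chart_deriv c (e v c) p = chart_deriv c (\<lambda>_. v) p"
    by (rule chart_deriv_cong[OF c open_patch p patch_chart[OF p]]) (simp add: frame_apply)
  then show ?thesis by (simp add: chart_deriv_const)
qed

text \<open>For a torsion-free connection this is the trace of the connection form in the direction \<open>w\<close>.\<close>

definition trace_form :: "real ^ 'n \<Rightarrow> 'm \<Rightarrow> real" where
  "trace_form w p = trace (matrix (\<lambda>v. nabla (e v) (e w) c p))"

lemma trace_form_sum: "trace_form w p = (\<Sum>k\<in>UNIV. nabla (e (axis k 1)) (e w) c p $ k)"
  by (simp add: trace_form_def trace_matrix)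

lemma trace_form_linear: "linear (\<lambda>w. trace_form w p)"
  unfolding trace_form_sum
  by (intro linear_compose_sum ballI linear_compose[OF nabla_linear_right, unfolded o_def]
      bounded_linear.linear[OF bounded_linear_vec_nth] frame_field)

lemma trace_form_has_derivative:
  assumes p: "p \<in> fst c"
  shows "(in_chart c (trace_form w) has_derivative
    (\<lambda>h. \<Sum>k\<in>UNIV. chart_deriv c (nabla (e (axis k 1)) (e w) c) p h $ k)) (at (snd c p))"
proof -
  have "((\<lambda>y. \<Sum>k\<in>UNIV. in_chart c (nabla (e (axis k 1)) (e w) c) y $ k) has_derivative
    (\<lambda>h. \<Sum>k\<in>UNIV. chart_deriv c (nabla (e (axis k 1)) (e w) c) p h $ k)) (at (snd c p))"
    by (intro has_derivative_sum bounded_linear.has_derivative[OF bounded_linear_vec_nth]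
        vector_field_has_derivative nabla_field frame_field c p)
  then show ?thesis by (simp add: in_chart_def trace_form_sum o_def)
qed

end

section \<open>Curvature and Ricci tensor in coordinates\<close>

locale symmetric_framed_connection = framed_connection A nabla c a r e
  for A :: "('m::t2_space, 'n::finite) chart set" and nabla c a r e +
  assumes torsion: "torsion_free A nabla"
begin

lemma lie_bracket_eq:
  "X \<in> vector_fields A \<Longrightarrow> Y \<in> vector_fields A \<Longrightarrow> lie_bracket A X Y = (\<lambda>c p. nabla X Y c p - nabla Y X c p)"
  using torsion by (simp add: torsion_free_def)

lemma lie_bracket_field: "X \<in> vector_fields A \<Longrightarrow> Y \<in> vector_fields A \<Longrightarrow> lie_bracket A X Y \<in> vector_fields A"
  by (simp add: lie_bracket_eq vector_fields_diff nabla_field)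

text \<open>Frame fields have constant components on the patch and so commute there; without torsion
  the Christoffel symbols are symmetric.\<close>

lemma nabla_frame_sym:
  assumes p: "p \<in> patch"
  shows "nabla (e v) (e w) c p = nabla (e w) (e v) c p"
proof -
  have "lie_bracket A (e v) (e w) c p = 0"
    by (simp add: lie_bracket_def chart_deriv_frame[OF p])
  then show ?thesis by (simp add: lie_bracket_eq frame_field)
qed

text \<open>\<open>Z\<close> must be an arbitrary extension of \<open>z\<close>, since the
  definition of Ricci curvature picks one by choice. Its first derivative \<open>?dZ\<close> arises
  from differentiating \<open>nabla Z (e w)\<close> and again from the Lie bracket, and the two
  contributions cancel.\<close>

lemma curvature_frame:
  assumes Z: "Z \<in> vector_fields A" and p: "p \<in> patch" and z: "Z c p = z"
  shows "curvature A nabla Z (e u) (e w) c p =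
    chart_deriv c (nabla (e u) (e w) c) p z + nabla (e z) (e (nabla (e u) (e w) c p)) c p
    - (\<Sum>i\<in>UNIV. z $ i *\<^sub>R chart_deriv c (nabla (e (axis i 1)) (e w) c) p u)
    - nabla (e u) (e (nabla (e z) (e w) c p)) c p"
proof -
  let ?N = "\<lambda>i. nabla (e (axis i 1)) (e w) c"
  have pc: "p \<in> fst c" using p by (rule patch_chart)
  let ?dZ = "chart_deriv c (Z c) p u"
  have 1: "nabla Z (nabla (e u) (e w)) c p =
      chart_deriv c (nabla (e u) (e w) c) p z + nabla (e z) (e (nabla (e u) (e w) c p)) c p"
    using nabla_at[OF Z nabla_field[OF frame_field frame_field] p] by (simp add: z)
  have N: "nabla Z (e w) c q = (\<Sum>i\<in>UNIV. Z c q $ i *\<^sub>R ?N i q)" if "q \<in> patch" for q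
    using nabla_at_left[OF Z frame_field that] nabla_frame_left[OF frame_field, of "Z c q" w c q]
    by (simp only:)
  have "((\<lambda>y. \<Sum>i\<in>UNIV. in_chart c (Z c) y $ i *\<^sub>R in_chart c (?N i) y) has_derivative
      (\<lambda>h. \<Sum>i\<in>UNIV. in_chart c (Z c) (snd c p) $ i *\<^sub>R chart_deriv c (?N i) p h +
        (chart_deriv c (Z c) p h $ i) *\<^sub>R in_chart c (?N i) (snd c p))) (at (snd c p))"
    by (intro has_derivative_sum has_derivative_scaleR bounded_linear.has_derivative[OF bounded_linear_vec_nth]
        vector_field_has_derivative nabla_field frame_field c Z pc)
  then have "(in_chart c (\<lambda>q. \<Sum>i\<in>UNIV. Z c q $ i *\<^sub>R ?N i q) has_derivative
      (\<lambda>h. \<Sum>i\<in>UNIV. z $ i *\<^sub>R chart_deriv c (?N i) p h + (chart_deriv c (Z c) p h $ i) *\<^sub>R ?N i p))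
      (at (snd c p))"
    using c pc z by (simp add: in_chart_def o_def)
  moreover have "chart_deriv c (nabla Z (e w) c) p = chart_deriv c (\<lambda>q. \<Sum>i\<in>UNIV. Z c q $ i *\<^sub>R ?N i q) p"
    by (rule chart_deriv_cong[OF c open_patch p pc]) (rule N)
  ultimately have "chart_deriv c (nabla Z (e w) c) p u =
      (\<Sum>i\<in>UNIV. z $ i *\<^sub>R chart_deriv c (?N i) p u + ?dZ $ i *\<^sub>R ?N i p)"
    by (simp add: chart_deriv_eqI)
  then have "chart_deriv c (nabla Z (e w) c) p u =
      (\<Sum>i\<in>UNIV. z $ i *\<^sub>R chart_deriv c (?N i) p u) + nabla (e ?dZ) (e w) c p"
    using nabla_frame_left[OF frame_field, of ?dZ w c p] by (simp add: sum.distrib)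
  then have 2: "nabla (e u) (nabla Z (e w)) c p = (\<Sum>i\<in>UNIV. z $ i *\<^sub>R chart_deriv c (?N i) p u)
      + nabla (e ?dZ) (e w) c p + nabla (e u) (e (nabla (e z) (e w) c p)) c p"
    using nabla_at[OF frame_field nabla_field[OF Z frame_field] p] nabla_at_left[OF Z frame_field p] p z
    by (simp add: frame_apply)
  have "lie_bracket A Z (e u) c p = - ?dZ"
    using c pc p by (simp add: lie_bracket_def chart_deriv_frame frame_apply)
  then have 3: "nabla (lie_bracket A Z (e u)) (e w) c p = - nabla (e ?dZ) (e w) c p"
    using nabla_at_left[OF lie_bracket_field[OF Z frame_field] frame_field p]
      linear_neg[OF nabla_linear_left[OF frame_field]] by simp
  show ?thesis unfolding curvature_def 1 2 3 by simp
qed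

lemma curvature_field:
  assumes "X \<in> vector_fields A" "Y \<in> vector_fields A" "Z \<in> vector_fields A"
  shows "curvature A nabla X Y Z \<in> vector_fields A"
  unfolding curvature_def
  by (intro vector_fields_diff nabla_field lie_bracket_field assms)

text \<open>The definition evaluates the trace in some chart \<open>d\<close> around
  \<open>p\<close>. Since curvature is a vector field, the endomorphism in \<open>d\<close> is the
  one in \<open>c\<close> conjugated by mutually inverse Jacobians, and the trace is the
  same.\<close>

lemma ricci_frame:
  assumes p: "p \<in> patch"
  shows "ricci A nabla (e u) (e w) p = trace (matrix (\<lambda>z.
    chart_deriv c (nabla (e u) (e w) c) p z + nabla (e z) (e (nabla (e u) (e w) c p)) c p
    - (\<Sum>i\<in>UNIV. z $ i *\<^sub>R chart_deriv c (nabla (e (axis i 1)) (e w) c) p u)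
    - nabla (e u) (e (nabla (e z) (e w) c p)) c p))" (is "_ = trace (matrix ?K)")
proof -
  define d where "d = (SOME d. d \<in> A \<and> p \<in> fst d)"
  have pc: "p \<in> fst c" using p by (rule patch_chart)
  have d: "d \<in> A \<and> p \<in> fst d"
    unfolding d_def by (rule someI[of _ c]) (use c pc in blast)
  have endo: "curvature_endo A nabla (e u) (e w) d p v = jac c d p (?K (jac d c p v))" for v
  proof -
    define Z where "Z = (SOME Z. Z \<in> vector_fields A \<and> Z d p = v)"
    \<comment> \<open>A frame at \<open>p\<close> in the chart \<open>d\<close> shows that every
      vector has a global extension, so the choice of \<open>Z\<close> is not vacuous.\<close>
    obtain \<rho> f where f: "frame d (snd d p) \<rho> f" using frame_exists[of d p] d by blast
    then have "f v \<in> vector_fields A" "f v d p = v"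
      using d by (auto simp: frame_def coordinate_ball_def)
    then have Z: "Z \<in> vector_fields A \<and> Z d p = v"
      unfolding Z_def by (intro someI_ex[of "\<lambda>Z. Z \<in> vector_fields A \<and> Z d p = v"]) blast
    have "curvature_endo A nabla (e u) (e w) d p v = curvature A nabla Z (e u) (e w) d p"
      by (simp add: curvature_endo_def Z_def)
    also have "\<dots> = jac c d p (curvature A nabla Z (e u) (e w) c p)"
      using Z d c pc curvature_field[of Z "e u" "e w"] frame_field by (intro vector_field_change) auto
    also have "curvature A nabla Z (e u) (e w) c p = ?K (Z c p)"
      using Z by (intro curvature_frame p) auto
    also have "Z c p = jac d c p v" using vector_field_change[of Z d c p] Z d c pc by simp
    finally show ?thesis .
  qed
  have "linear ?K"
    by (intro linear_compose_sub linear_compose_add nabla_linear_left frame_field linear_coordinate_sum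
        linear_compose[OF nabla_linear_left nabla_linear_right, unfolded o_def]
        has_derivative_linear[OF vector_field_has_derivative] nabla_field c pc)
  then have "trace (matrix (\<lambda>v. jac c d p (?K (jac d c p v)))) = trace (matrix ?K)"
    using d c pc by (intro trace_matrix_conjugate jac_linear jac_inverse) auto
  moreover have "curvature_endo A nabla (e u) (e w) d p = (\<lambda>v. jac c d p (?K (jac d c p v)))"
    by (rule ext) (rule endo)
  ultimately show ?thesis by (simp only: ricci_def d_def[symmetric] Let_def)
qed

text \<open>Of the four terms of the Ricci tensor in coordinates, three are symmetric in
  \<open>u\<close> and \<open>w\<close>: two by symmetry of the Christoffel symbols, the quadratic
  one also by cyclicity of the trace. The remaining term is minus the derivative of
  \<open>trace_form w\<close> along \<open>u\<close>. Hence the antisymmetric part of Ricci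
  curvature is, up to sign, the exterior derivative of the trace form; the Bianchi identity is
  implicit in this computation.\<close>

lemma trace_form_closed:
  assumes ric: "ricci_symmetric A nabla" and p: "p \<in> patch"
  shows "chart_deriv c (trace_form w) p u = chart_deriv c (trace_form u) p w"
proof -
  have pc: "p \<in> fst c" using p by (rule patch_chart)
  let ?D = "\<lambda>u w. chart_deriv c (nabla (e u) (e w) c) p"
  let ?N = "\<lambda>u w. nabla (e u) (e w) c p"
  have d: "chart_deriv c (trace_form w) p u = (\<Sum>k\<in>UNIV. ?D (axis k 1) w u $ k)" for u w
    by (rule chart_deriv_eqI[OF trace_form_has_derivative[OF pc]])
  have ax: "(\<Sum>i\<in>UNIV. axis k 1 $ i *\<^sub>R g i) = g k" for k :: 'n and g :: "'n \<Rightarrow> real ^ 'n"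
    by (simp add: axis_def if_distrib[of "\<lambda>x. x *\<^sub>R _"] cong: if_cong)
  have R: "ricci A nabla (e u) (e w) p = (\<Sum>k\<in>UNIV. ?D u w (axis k 1) $ k)
     + (\<Sum>k\<in>UNIV. ?N (axis k 1) (?N u w) $ k) - (\<Sum>k\<in>UNIV. ?D (axis k 1) w u $ k)
     - (\<Sum>k\<in>UNIV. ?N u (?N (axis k 1) w) $ k)" for u w
    unfolding ricci_frame[OF p] trace_matrix ax
    by (simp add: sum.distrib sum_subtractf)
  have "?D u w = ?D w u"
    by (rule chart_deriv_cong[OF c open_patch p pc]) (rule nabla_frame_sym)
  moreover have "?N u w = ?N w u" by (rule nabla_frame_sym[OF p])
  moreover have "(\<Sum>k\<in>UNIV. ?N u (?N (axis k 1) w) $ k) = (\<Sum>k\<in>UNIV. ?N w (?N (axis k 1) u) $ k)"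
  proof -
    have "trace (matrix (\<lambda>v. ?N u (?N w v))) = trace (matrix (\<lambda>v. ?N w (?N u v)))"
      by (intro trace_matrix_compose_commute nabla_linear_right frame_field)
    then show ?thesis
      unfolding trace_matrix using nabla_frame_sym[OF p] by simp
  qed
  moreover have "ricci A nabla (e u) (e w) p = ricci A nabla (e w) (e u) p"
    using ric frame_field by (simp add: ricci_symmetric_def)
  ultimately show ?thesis unfolding d R[of u w] R[of w u] by simp
qed

end

section \<open>Parallel densities\<close>

context symmetric_framed_connection
begin

lemma ball_patch:
  assumes "y \<in> ball a r"
  obtains p where "p \<in> patch" "y = snd c p"
proof -
  have "ball a r \<subseteq> snd c ` fst c" using is_frame unfolding frame_def by blast
  with assms obtain p where "p \<in> fst c" "y = snd c p" by blast
  then show thesis using that assms by (simp add: coordinate_ball_def)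
qed

lemma smooth_on_trace_form: "smooth_on (snd c ` fst c) (in_chart c (trace_form w))"
proof -
  have "smooth_on (snd c ` fst c) (\<lambda>y. \<Sum>k\<in>UNIV. in_chart c (nabla (e (axis k 1)) (e w) c) y $ k)"
    by (intro smooth_on_sum open_chart_image c smooth_on_bounded_linear_comp[OF bounded_linear_vec_nth]
        vector_field_smooth nabla_field frame_field)
  then show ?thesis by (simp add: in_chart_def trace_form_sum o_def)
qed

lemma trace_form_coordinates: "trace_form w p = (\<Sum>j\<in>UNIV. trace_form (axis j 1) p * w $ j)"
proof -
  interpret linear "\<lambda>w. trace_form w p" by (rule trace_form_linear)
  have "trace_form w p = trace_form (\<Sum>j\<in>UNIV. w $ j *\<^sub>R axis j 1) p"
    using basis_expansion[of w] by (simp add: scalar_mult_eq_scaleR)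
  then show ?thesis by (simp add: sum scale mult.commute)
qed

text \<open>The Poincare lemma for the components \<open>?t j\<close> of the trace form;
  \<open>trace_form_closed\<close> supplies the symmetry of their derivatives.\<close>

lemma trace_form_primitive:
  assumes ric: "ricci_symmetric A nabla"
  obtains f where "\<And>p. p \<in> patch \<Longrightarrow> (f has_derivative (\<lambda>h. trace_form h p)) (at (snd c p))"
proof -
  let ?t = "\<lambda>j. in_chart c (trace_form (axis j 1))"
  let ?\<alpha> = "\<lambda>y. \<Sum>j\<in>UNIV. ?t j y *\<^sub>R axis j (1::real)"
  let ?D = "\<lambda>y h. \<Sum>j\<in>UNIV. frechet_derivative (?t j) (at y) h *\<^sub>R axis j (1::real)"
  have sub: "ball a r \<subseteq> snd c ` fst c" and r: "r > 0" using is_frame unfolding frame_def by blast+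
  have t: "smooth_on (ball a r) (?t j)" for j
    by (rule smooth_on_subset[OF smooth_on_trace_form sub])
  have expand: "(\<Sum>j\<in>UNIV. g j *\<^sub>R axis j (1::real)) \<bullet> v = (\<Sum>j\<in>UNIV. g j * v $ j)"
    for g and v :: "real ^ 'n"
    by (simp add: inner_sum_left inner_axis')
  obtain f where f: "\<And>y. y \<in> ball a r \<Longrightarrow> (f has_derivative (\<lambda>v. ?\<alpha> y \<bullet> v)) (at y)"
  proof (rule primitive_on_ball[OF r, of a ?\<alpha> ?D])
    fix y assume y: "y \<in> ball a r"
    show "(?\<alpha> has_derivative ?D y) (at y)"
      by (intro has_derivative_sum has_derivative_scaleR_left smooth_on_has_derivative[OF t y])
  next
    show "continuous_on (ball a r) (\<lambda>y. ?D y v)" for v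
      by (intro continuous_intros smooth_on_imp_continuous_on smooth_on_frechet_derivative t)
  next
    fix y u v assume y: "y \<in> ball a r"
    then obtain p where p: "p \<in> patch" "y = snd c p" by (rule ball_patch)
    have "?D y u \<bullet> v = chart_deriv c (trace_form v) p u" for u v
    proof -
      have "in_chart c (trace_form v) = (\<lambda>y. \<Sum>j\<in>UNIV. ?t j y * v $ j)"
        unfolding in_chart_def o_def by (rule ext, rule trace_form_coordinates)
      moreover have "((\<lambda>y. \<Sum>j\<in>UNIV. ?t j y * v $ j) has_derivative
          (\<lambda>u. \<Sum>j\<in>UNIV. frechet_derivative (?t j) (at y) u * v $ j)) (at y)"
        by (intro has_derivative_sum has_derivative_mult_left smooth_on_has_derivative[OF t y])
      ultimately have "(in_chart c (trace_form v) has_derivative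
          (\<lambda>u. \<Sum>j\<in>UNIV. frechet_derivative (?t j) (at y) u * v $ j)) (at (snd c p))"
        using p(2) by simp
      then show ?thesis using p(2) by (simp add: expand chart_deriv_eqI)
    qed
    then show "?D y u \<bullet> v = ?D y v \<bullet> u" using trace_form_closed[OF ric p(1)] by simp
  qed (rule that)
  have "(f has_derivative (\<lambda>h. trace_form h p)) (at (snd c p))" if p: "p \<in> patch" for p
  proof -
    have "?\<alpha> (snd c p) \<bullet> h = trace_form h p" for h
      using trace_form_coordinates[of h p] c patch_chart[OF p] by (simp add: expand)
    moreover have "snd c p \<in> ball a r" using p by (simp add: coordinate_ball_def)
    ultimately show ?thesis using f[of "snd c p"] by simp
  qed
  then show thesis by (rule that)
qed

text \<open>The trace of the covariant derivative of \<open>E\<close>, which is the identity. Its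
  coordinate expression splits into the ordinary derivative of the components and a Christoffel term
  whose trace is the trace form at \<open>E\<close>.\<close>

lemma divergence_formula:
  assumes E: "E \<in> vector_fields A" "\<And>v. nabla (e v) E = e v" and p: "p \<in> patch"
  shows "trace (matrix (chart_deriv c (E c) p)) + trace_form (E c p) p = real CARD('n)"
proof -
  have "axis k 1 = chart_deriv c (E c) p (axis k 1) + nabla (e (axis k 1)) (e (E c p)) c p" for k
    using nabla_at[OF frame_field E(1) p, of "axis k 1"] E(2) frame_apply[OF p] by simp
  then have "(axis k 1 :: real ^ 'n) $ k = chart_deriv c (E c) p (axis k 1) $ k + nabla (e (axis k 1)) (e (E c p)) c p $ k" for k
    by (metis vector_add_component)
  then have "1 = chart_deriv c (E c) p (axis k 1) $ k + nabla (e (axis k 1)) (e (E c p)) c p $ k" for k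
    by simp
  then have "(\<Sum>k\<in>(UNIV :: 'n set). 1) = (\<Sum>k\<in>UNIV. chart_deriv c (E c) p (axis k 1) $ k + nabla (e (axis k 1)) (e (E c p)) c p $ k)"
    by (intro sum.cong refl)
  then show ?thesis by (simp add: trace_matrix trace_form_sum sum.distrib)
qed

end

lemma (in atlas) jac_matrix_inverse:
  assumes "c \<in> A" "d \<in> A" "p \<in> fst c" "p \<in> fst d"
  shows "matrix (jac d c p) ** matrix (jac c d p) = mat 1"
proof -
  have "matrix (jac d c p) ** matrix (jac c d p) = matrix (jac d c p \<circ> jac c d p)"
    using matrix_compose[of "jac c d p" "jac d c p"] jac_linear assms by simp
  also have "jac d c p \<circ> jac c d p = id" using assms by (simp add: fun_eq_iff jac_inverse)
  finally show ?thesis by (simp only: matrix_id_mat_1)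
qed

lemma (in atlas) det_jac_nonzero:
  assumes "c \<in> A" "d \<in> A" "p \<in> fst c" "p \<in> fst d"
  shows "det (matrix (jac c d p)) \<noteq> 0"
  using jac_matrix_inverse[OF assms] by (metis det_I det_mul mult_zero_right zero_neq_one)

lemma (in atlas) det_jac_comp:
  assumes "c \<in> A" "d \<in> A" "e \<in> A" "p \<in> fst c" "p \<in> fst d" "p \<in> fst e"
  shows "det (matrix (jac c e p)) = det (matrix (jac d e p)) * det (matrix (jac c d p))"
proof -
  have "jac c e p = jac d e p \<circ> jac c d p" using assms by (simp add: fun_eq_iff jac_comp)
  then show ?thesis
    using matrix_compose[of "jac c d p" "jac d e p"] jac_linear assms by (simp add: det_mul)
qed

lemma trace_matrix_mult:
  fixes L g :: "real ^ 'n \<Rightarrow> real ^ 'n"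
  assumes "linear L"
  shows "trace (matrix L ** matrix g) = (\<Sum>k\<in>UNIV. L (g (axis k 1)) $ k)"
proof -
  have "(matrix L ** matrix g) $ k $ k = L (g (axis k 1)) $ k" for k
  proof -
    have "L (g (axis k 1)) = matrix L *v g (axis k 1)" using assms by (simp add: matrix_works)
    then show ?thesis by (simp add: matrix_matrix_mult_def matrix_vector_mult_def matrix_def[of g])
  qed
  then show ?thesis by (simp add: trace_def)
qed

lemma has_derivative_matrix:
  fixes M :: "'a::real_normed_vector \<Rightarrow> real ^ 'n \<Rightarrow> real ^ 'n"
  assumes "\<And>j. ((\<lambda>x. M x (axis j 1)) has_derivative (\<lambda>h. M' h (axis j 1))) (at x)"
  shows "((\<lambda>x. matrix (M x)) has_derivative (\<lambda>h. matrix (M' h))) (at x)"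
proof -
  have "((\<lambda>x. matrix (M x) \<bullet> b) has_derivative (\<lambda>h. matrix (M' h) \<bullet> b)) (at x)" if b: "b \<in> Basis" for b
  proof -
    obtain i j where "b = axis i (axis j 1)" using b by (auto simp: Basis_vec_def)
    moreover have "((\<lambda>x. M x (axis j 1) $ i) has_derivative (\<lambda>h. M' h (axis j 1) $ i)) (at x)"
      by (rule bounded_linear.has_derivative[OF bounded_linear_vec_nth assms])
    ultimately show ?thesis by (simp add: inner_axis matrix_def)
  qed
  then show ?thesis by (subst has_derivative_componentwise_within) blast
qed

section \<open>Local parallel densities and their transition constants\<close>

locale symmetric_connection = connection A nabla for A :: "('m::t2_space, 'n::finite) chart set" and nabla +
  assumes torsion: "torsion_free A nabla"
begin

lemma symmetric_framed: "frame c a r e \<Longrightarrow> symmetric_framed_connection A nabla c a r e"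
  by unfold_locales (auto simp: torsion)

abbreviation "tr_form \<equiv> framed_connection.trace_form nabla"

text \<open>The transformation law of Christoffel symbols contains the derivative of the Jacobian.
  Its trace, after multiplication by the inverse Jacobian, is the logarithmic derivative of the
  determinant; the tensorial part conjugates away under the trace.\<close>

lemma ln_det_jac_has_derivative:
  assumes fr: "frame c a r e" and fr': "frame d b s f"
    and p: "p \<in> coordinate_ball c a r" "p \<in> coordinate_ball d b s"
  shows "(in_chart c (\<lambda>q. ln \<bar>det (matrix (jac c d q))\<bar>) has_derivative
    (\<lambda>h. tr_form c e h p - tr_form d f (jac c d p h) p)) (at (snd c p))"
proof -
  interpret F: symmetric_framed_connection A nabla c a r e using fr by (rule symmetric_framed)
  interpret G: symmetric_framed_connection A nabla d b s f using fr' by (rule symmetric_framed)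
  note c = F.c and d = G.c and pc = F.patch_chart[OF p(1)] and pd = G.patch_chart[OF p(2)]
  let ?J = "jac c d p" and ?L = "jac d c p"
  let ?dJ = "\<lambda>u w. chart_deriv c (\<lambda>q. jac c d q w) p u"
  have dJ: "(in_chart c (\<lambda>q. jac c d q w) has_derivative (\<lambda>u. ?dJ u w)) (at (snd c p))" for w
    using smooth_on_has_derivative[OF smooth_on_jac[OF c d]] pc pd by (simp add: chart_deriv_def)
  have transform: "nabla (e u) (e w) c p = ?L (?dJ u w) + ?L (nabla (f (?J u)) (f (?J w)) d p)" for u w
  proof -
    have eJ: "e v d q = jac c d q v" if "q \<in> F.patch" "q \<in> fst d" for v q
      using vector_field_change[OF F.frame_field c d F.patch_chart[OF that(1)] that(2)] F.frame_apply[OF that(1)] by simp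
    \<comment> \<open>The components of \<open>e w\<close> in the chart \<open>d\<close> are a
      column combination of the Jacobian near \<open>p\<close>. Differentiating them in
      \<open>c\<close> rather than in \<open>d\<close> is what produces the second derivatives of
      the transition map.\<close>
    have "chart_deriv d (e w d) p (?J u) = chart_deriv c (e w d) p u"
      using smooth_on_differentiable[OF vector_field_smooth[OF F.frame_field d]] c d pc pd
      by (intro chart_deriv_change[symmetric]) auto
    also have "chart_deriv c (e w d) p = chart_deriv c (\<lambda>q. jac c d q w) p"
      using eJ p(1) pd by (intro chart_deriv_cong[of c "F.patch \<inter> fst d"] c pc open_Int F.open_patch open_chart_domain d) auto
    finally have "nabla (e u) (e w) d p = ?dJ u w + nabla (f (?J u)) (f (?J w)) d p"
      using G.nabla_at[OF F.frame_field F.frame_field p(2), of u w] eJ[OF p(1) pd] by simp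
    moreover have "nabla (e u) (e w) c p = ?L (nabla (e u) (e w) d p)"
      by (rule vector_field_change[OF nabla_field[OF F.frame_field F.frame_field] d c pd pc])
    ultimately show ?thesis using linear_add[OF jac_linear[OF d c pd pc]] by simp
  qed
  have "((\<lambda>y. matrix (\<lambda>w. in_chart c (\<lambda>q. jac c d q w) y)) has_derivative (\<lambda>u. matrix (\<lambda>w. ?dJ u w))) (at (snd c p))"
    by (rule has_derivative_matrix) (rule dJ)
  then have "((\<lambda>y. ln \<bar>det (matrix (\<lambda>w. in_chart c (\<lambda>q. jac c d q w) y))\<bar>) has_derivative
      (\<lambda>u. trace (matrix ?L ** matrix (\<lambda>w. ?dJ u w)))) (at (snd c p))"
    by (rule ln_abs_det_has_derivative) (use jac_matrix_inverse[OF c d pc pd] c pc in simp)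
  moreover have "trace (matrix ?L ** matrix (\<lambda>w. ?dJ u w)) = F.trace_form u p - G.trace_form (?J u) p" for u
  proof -
    have "F.trace_form u p = (\<Sum>k\<in>UNIV. nabla (e u) (e (axis k 1)) c p $ k)"
      unfolding F.trace_form_sum using F.nabla_frame_sym[OF p(1)] by simp
    also have "\<dots> = (\<Sum>k\<in>UNIV. ?L (?dJ u (axis k 1)) $ k) + trace (matrix (\<lambda>w. ?L (nabla (f (?J u)) (f (?J w)) d p)))"
      unfolding transform trace_matrix by (simp add: sum.distrib)
    also have "trace (matrix (\<lambda>w. ?L (nabla (f (?J u)) (f (?J w)) d p))) = trace (matrix (\<lambda>w. nabla (f (?J u)) (f w) d p))"
      using c d pc pd
      by (intro trace_matrix_conjugate jac_linear jac_inverse G.nabla_linear_right G.frame_field)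
    also have "\<dots> = G.trace_form (?J u) p"
      unfolding G.trace_form_def using G.nabla_frame_sym[OF p(2)] by simp
    finally show ?thesis by (simp add: trace_matrix_mult[OF jac_linear[OF d c pd pc]])
  qed
  ultimately show ?thesis by (simp add: in_chart_def o_def)
qed

text \<open>The equation says that \<open>exp f\<close> times the Lebesgue density of the chart
  \<open>c\<close> is parallel on the coordinate ball.\<close>

definition log_density :: "('m, 'n) chart \<Rightarrow> real ^ 'n \<Rightarrow> real \<Rightarrow> (real ^ 'n \<Rightarrow> ('m, 'n) field) \<Rightarrow>
    (real ^ 'n \<Rightarrow> real) \<Rightarrow> bool" where
  "log_density c a r e f \<longleftrightarrow> frame c a r e \<and>
    (\<forall>p\<in>coordinate_ball c a r. (f has_derivative (\<lambda>h. tr_form c e h p)) (at (snd c p)))"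

lemma log_density_exists:
  assumes "ricci_symmetric A nabla" and c: "c \<in> A" "p \<in> fst c"
  obtains r e f where "log_density c (snd c p) r e f"
proof -
  obtain r e where fr: "frame c (snd c p) r e" using frame_exists[OF c] .
  interpret F: symmetric_framed_connection A nabla c "snd c p" r e using fr by (rule symmetric_framed)
  obtain f where "\<And>q. q \<in> F.patch \<Longrightarrow> (f has_derivative (\<lambda>h. F.trace_form h q)) (at (snd c q))"
    by (rule F.trace_form_primitive[OF assms(1)]) (rule that)
  with fr have "log_density c (snd c p) r e f" by (simp add: log_density_def)
  then show thesis by (rule that)
qed

text \<open>By \<open>ln_det_jac_has_derivative\<close> the differentials of the three terms cancel.
  The overlap may be disconnected, so constancy can be claimed on connected subsets only.\<close>

lemma log_density_transition_constant:
  assumes ld: "log_density c a r e f" and ld': "log_density d b s e' g"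
    and C: "connected C" "C \<subseteq> coordinate_ball c a r \<inter> coordinate_ball d b s" and xy: "x \<in> C" "y \<in> C"
  shows "f (snd c x) - g (snd d x) - ln \<bar>det (matrix (jac c d x))\<bar> =
    f (snd c y) - g (snd d y) - ln \<bar>det (matrix (jac c d y))\<bar>"
proof -
  have fr: "frame c a r e" "frame d b s e'" using ld ld' by (auto simp: log_density_def)
  then have cd: "c \<in> A" "d \<in> A" unfolding frame_def by blast+
  let ?P = "coordinate_ball c a r \<inter> coordinate_ball d b s"
  let ?u = "\<lambda>q. f (snd c q) - g (snd d q) - ln \<bar>det (matrix (jac c d q))\<bar>"
  let ?S = "snd c ` ?P"
  have P: "?P \<subseteq> fst c" "?P \<subseteq> fst d" by (auto simp: coordinate_ball_def)
  have oS: "open ?S"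
    using cd P by (intro open_chart_image_subset open_Int open_coordinate_ball) auto
  have deriv: "(in_chart c ?u has_derivative (\<lambda>h. 0)) (at z)" if z: "z \<in> ?S" for z
  proof -
    obtain p where p: "p \<in> ?P" "z = snd c p" using z by blast
    have pc: "p \<in> fst c" "p \<in> fst d" using p P by auto
    have "(f has_derivative (\<lambda>h. tr_form c e h p)) (at (snd c p))"
      using ld p by (simp add: log_density_def)
    then have 1: "(in_chart c (\<lambda>q. f (snd c q)) has_derivative (\<lambda>h. tr_form c e h p)) (at (snd c p))"
      by (rule has_derivative_transform_within_open[OF _ open_chart_image[OF cd(1)]]) (use cd pc in auto)
    have "(g has_derivative (\<lambda>h. tr_form d e' h p)) (at (snd d p))"
      using ld' p by (simp add: log_density_def)
    then have "(in_chart d (\<lambda>q. g (snd d q)) has_derivative (\<lambda>h. tr_form d e' h p)) (at (snd d p))"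
      by (rule has_derivative_transform_within_open[OF _ open_chart_image[OF cd(2)]]) (use cd pc in auto)
    then have 2: "(in_chart c (\<lambda>q. g (snd d q)) has_derivative (\<lambda>h. tr_form d e' (jac c d p h) p)) (at (snd c p))"
      by (rule has_derivative_in_chart_change[OF cd pc])
    have 3: "(in_chart c (\<lambda>q. ln \<bar>det (matrix (jac c d q))\<bar>) has_derivative
        (\<lambda>h. tr_form c e h p - tr_form d e' (jac c d p h) p)) (at (snd c p))"
      using ln_det_jac_has_derivative[OF fr] p by simp
    have "((\<lambda>y. in_chart c (\<lambda>q. f (snd c q)) y - in_chart c (\<lambda>q. g (snd d q)) y -
        in_chart c (\<lambda>q. ln \<bar>det (matrix (jac c d q))\<bar>) y) has_derivative
        (\<lambda>h. tr_form c e h p - tr_form d e' (jac c d p h) p -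
          (tr_form c e h p - tr_form d e' (jac c d p h) p))) (at (snd c p))"
      by (intro has_derivative_diff 1 2 3)
    then show ?thesis using p(2) by (simp add: in_chart_def o_def)
  qed
  \<comment> \<open>The image of \<open>C\<close> need not be open. The component of the open set
    \<open>?S\<close> around it is open and connected, so a function with zero derivative is
    constant there.\<close>
  let ?T = "connected_component_set ?S (snd c x)"
  have CS: "snd c ` C \<subseteq> ?S" using C(2) by blast
  have "connected (snd c ` C)"
    using C P by (intro connected_continuous_image continuous_on_subset[OF continuous_chart[OF cd(1)]]) auto
  then have "snd c ` C \<subseteq> ?T" using CS xy by (intro connected_component_maximal) auto
  then have T: "snd c x \<in> ?T" "snd c y \<in> ?T" using xy by auto
  have TS: "?T \<subseteq> ?S" by (rule connected_component_subset)
  have "in_chart c ?u constant_on ?T"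
  proof (rule has_derivative_zero_connected_constant_on[of ?T "{}"])
    show "continuous_on ?T (in_chart c ?u)"
      using has_derivative_continuous[OF deriv] TS by (intro continuous_at_imp_continuous_on) blast
    show "\<forall>z\<in>?T - {}. (in_chart c ?u has_derivative (\<lambda>h. 0)) (at z within ?T)"
      using has_derivative_at_withinI[OF deriv] TS by blast
  qed (use oS open_connected_component in auto)
  then obtain k where k: "\<forall>z\<in>?T. in_chart c ?u z = k" unfolding constant_on_def ..
  have "in_chart c ?u (snd c x) = in_chart c ?u (snd c y)"
    unfolding bspec[OF k T(1)] bspec[OF k T(2)] ..
  moreover have "x \<in> fst c" "y \<in> fst c" using xy C(2) P by blast+
  ultimately show ?thesis using cd by simp
qed

lemma path_connected_coordinate_ball:
  assumes "frame c a r e"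
  shows "path_connected (coordinate_ball c a r)"
proof -
  have c: "c \<in> A" and sub: "ball a r \<subseteq> snd c ` fst c" using assms unfolding frame_def by blast+
  have "coordinate_ball c a r = inv_into (fst c) (snd c) ` ball a r"
  proof (intro equalityI subsetI)
    fix p assume "p \<in> coordinate_ball c a r"
    then show "p \<in> inv_into (fst c) (snd c) ` ball a r"
      using c by (intro image_eqI[of _ _ "snd c p"]) (simp_all add: coordinate_ball_def)
  next
    fix p assume "p \<in> inv_into (fst c) (snd c) ` ball a r"
    then obtain y where y: "y \<in> ball a r" "p = inv_into (fst c) (snd c) y" by blast
    then obtain q where "q \<in> fst c" "y = snd c q" using sub by blast
    then show "p \<in> coordinate_ball c a r" using y c by (simp add: coordinate_ball_def)
  qed
  then show ?thesis
    using continuous_on_subset[OF continuous_chart_inverse[OF c] sub]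
    by (simp add: path_connected_continuous_image convex_imp_path_connected)
qed

proposition parallel_density:
  assumes ric: "ricci_symmetric A nabla" and betti: "betti_number 1 (euclidean :: 'm topology) = 0"
  obtains c a r e f where
    "\<And>p. log_density (c p) (a p) (r p) (e p) (f p)" "\<And>p. p \<in> coordinate_ball (c p) (a p) (r p)"
    "\<And>p q x. x \<in> coordinate_ball (c p) (a p) (r p) \<Longrightarrow> x \<in> coordinate_ball (c q) (a q) (r q) \<Longrightarrow>
      exp (f p (snd (c p) x)) = \<bar>det (matrix (jac (c p) (c q) x))\<bar> * exp (f q (snd (c q) x))"
proof -
  have "\<exists>c r e f. c \<in> A \<and> p \<in> fst c \<and> log_density c (snd c p) r e f" for p
    using chart_at[of p] log_density_exists[OF ric] by metis
  then obtain c r e f where D: "\<And>p. c p \<in> A" "\<And>p. p \<in> fst (c p)"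
    "\<And>p. log_density (c p) (snd (c p) p) (r p) (e p) (f p)"
    by metis
  let ?V = "\<lambda>p. coordinate_ball (c p) (snd (c p) p) (r p)"
  have fr: "frame (c p) (snd (c p) p) (r p) (e p)" for p using D(3) by (simp add: log_density_def)
  have rpos: "r p > 0" for p using fr[of p] unfolding frame_def by blast
  have pV: "p \<in> ?V p" for p using D(2) rpos by (simp add: coordinate_ball_def)
  have Vc: "x \<in> fst (c p)" if "x \<in> ?V p" for x p using that by (simp add: coordinate_ball_def)
  \<comment> \<open>Potentials must be functions of the point alone, yet a density has a value only
    relative to a chart. The chart \<open>c x\<close> attached to \<open>x\<close> serves as
    reference. It may jump with \<open>x\<close>, but the chain rule for determinants cancels it
    from the differences \<open>G p x - G q x\<close>.\<close>
  define G where "G = (\<lambda>p x. f p (snd (c p) x) - ln \<bar>det (matrix (jac (c p) (c x) x))\<bar>)"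
  have diff: "G p x - G q x = f p (snd (c p) x) - f q (snd (c q) x) - ln \<bar>det (matrix (jac (c p) (c q) x))\<bar>"
    if "x \<in> ?V p" "x \<in> ?V q" for p q x
  proof -
    have "det (matrix (jac (c p) (c x) x)) = det (matrix (jac (c q) (c x) x)) * det (matrix (jac (c p) (c q) x))"
      by (rule det_jac_comp[OF D(1) D(1) D(1) Vc[OF that(1)] Vc[OF that(2)] D(2)])
    moreover have "det (matrix (jac (c q) (c x) x)) \<noteq> 0" "det (matrix (jac (c p) (c q) x)) \<noteq> 0"
      using D Vc that by (intro det_jac_nonzero; blast)+
    ultimately have "ln \<bar>det (matrix (jac (c p) (c x) x))\<bar> =
        ln \<bar>det (matrix (jac (c q) (c x) x))\<bar> + ln \<bar>det (matrix (jac (c p) (c q) x))\<bar>"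
      by (simp add: abs_mult ln_mult)
    then show ?thesis by (simp add: G_def)
  qed
  obtain W k where W: "\<And>p x. p \<in> UNIV \<Longrightarrow> x \<in> ?V p \<Longrightarrow> W x = G p x + k p"
  proof (rule compatible_potentials[of UNIV ?V G])
    show "open (?V p)" for p using open_coordinate_ball D(1) by blast
    show "(\<Union>p\<in>UNIV. ?V p) = UNIV" using pV by blast
    show "path_connected (?V p)" for p using fr by (rule path_connected_coordinate_ball)
    show "betti_number 1 (euclidean :: 'm topology) = 0" by (rule betti)
    fix p q C x y
    assume C: "connected C" "C \<subseteq> ?V p \<inter> ?V q" and xy: "x \<in> C" "y \<in> C"
    have "x \<in> ?V p" "x \<in> ?V q" "y \<in> ?V p" "y \<in> ?V q" using C xy by blast+
    then show "G p x - G q x = G p y - G q y"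
      using log_density_transition_constant[OF D(3) D(3) C xy] by (simp add: diff)
  qed (rule that)
  show thesis
  proof (rule that[of c "\<lambda>p. snd (c p) p" r e "\<lambda>p y. f p y + k p"])
    show "p \<in> ?V p" for p by (rule pV)
    \<comment> \<open>Adding the constant \<open>k p\<close> preserves the differential and absorbs
      the transition constants, so the local densities now agree exactly on overlaps.\<close>
    show "log_density (c p) (snd (c p) p) (r p) (e p) (\<lambda>y. f p y + k p)" for p
      using D(3)[of p] by (auto simp: log_density_def intro: has_derivative_add_const)
    fix p q x assume x: "x \<in> ?V p" "x \<in> ?V q"
    have "f p (snd (c p) x) + k p = ln \<bar>det (matrix (jac (c p) (c q) x))\<bar> + (f q (snd (c q) x) + k q)"
      using W[of p x] W[of q x] diff[OF x] x by simp
    moreover have "\<bar>det (matrix (jac (c p) (c q) x))\<bar> > 0"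
      using det_jac_nonzero[OF D(1) D(1) Vc[OF x(1)] Vc[OF x(2)]] by simp
    ultimately show "exp (f p (snd (c p) x) + k p) =
        \<bar>det (matrix (jac (c p) (c q) x))\<bar> * exp (f q (snd (c q) x) + k q)"
      by (simp add: exp_add)
  qed
qed

end

section \<open>Integration against the parallel density\<close>

context atlas
begin

lemma smooth_functions_mult:
  "f \<in> smooth_functions A \<Longrightarrow> g \<in> smooth_functions A \<Longrightarrow> (\<lambda>p. f p * g p) \<in> smooth_functions A"
  unfolding smooth_functions_def mem_Collect_eq in_chart_binop
  by (intro ballI smooth_on_mult open_chart_image) auto

lemma smooth_functions_diff:
  "f \<in> smooth_functions A \<Longrightarrow> g \<in> smooth_functions A \<Longrightarrow> (\<lambda>p. f p - g p) \<in> smooth_functions A"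
  unfolding smooth_functions_def mem_Collect_eq in_chart_binop
  by (intro ballI smooth_on_diff open_chart_image) auto

lemma smooth_functionD: "f \<in> smooth_functions A \<Longrightarrow> c \<in> A \<Longrightarrow> smooth_on (snd c ` fst c) (in_chart c f)"
  by (simp add: smooth_functions_def)

lemma smooth_function_has_derivative:
  "f \<in> smooth_functions A \<Longrightarrow> c \<in> A \<Longrightarrow> p \<in> fst c \<Longrightarrow>
    (in_chart c f has_derivative chart_deriv c f p) (at (snd c p))"
  using smooth_on_has_derivative[OF smooth_functionD, of f c "snd c p"]
  by (simp add: chart_deriv_def[abs_def])

text \<open>Functions are added one at a time: a new bump takes its share, and the earlier functions
  are multiplied by what remains. No division by a sum of bumps is involved. The family is indexed
  by all points, but only those of the finite set \<open>S\<close> enter the sum.\<close>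

lemma partition_of_unity:
  assumes cpt: "compact (UNIV :: 'm set)"
    and c: "\<And>p. c p \<in> A" "\<And>p. p \<in> V p" "\<And>p. open (V p)" "\<And>p. V p \<subseteq> fst (c p)"
  obtains S \<eta> K where "finite S" "\<And>p. \<eta> p \<in> smooth_functions A" "\<And>p. compact (K p)" "\<And>p. K p \<subseteq> V p"
    "\<And>p q. q \<notin> K p \<Longrightarrow> \<eta> p q = 0" "\<And>p q. 0 \<le> \<eta> p q" "\<And>q. (\<Sum>p\<in>S. \<eta> p q) = 1"
proof -
  have "\<exists>\<psi> K W. \<psi> \<in> smooth_functions A \<and> compact K \<and> K \<subseteq> V p \<and> open W \<and> p \<in> W \<and>
      (\<forall>q\<in>W. \<psi> q = 1) \<and> (\<forall>q. q \<notin> K \<longrightarrow> \<psi> q = 0) \<and> (\<forall>q. 0 \<le> \<psi> q \<and> \<psi> q \<le> 1)" for p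
  proof -
    have "p \<in> fst (c p)" using c by blast
    from bump_exists[OF c(1) this c(3) c(2)] show ?thesis by (metis le_inf_iff)
  qed
  then obtain \<psi> K W where \<psi>: "\<And>p. \<psi> p \<in> smooth_functions A" "\<And>p. compact (K p)" "\<And>p. K p \<subseteq> V p"
    "\<And>p. open (W p)" "\<And>p. p \<in> W p" "\<And>p q. q \<in> W p \<Longrightarrow> \<psi> p q = 1" "\<And>p q. q \<notin> K p \<Longrightarrow> \<psi> p q = 0"
    "\<And>p q. 0 \<le> \<psi> p q \<and> \<psi> p q \<le> 1"
    by metis
  obtain S where S: "finite S" "(\<Union>p\<in>S. W p) = UNIV"
    using compactE_image[OF cpt, of UNIV W] \<psi>(4,5) by (metis UNIV_I UN_I subsetI top.extremum_uniqueI)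
  have "\<exists>\<eta>. (\<forall>p. \<eta> p \<in> smooth_functions A \<and> (\<forall>q. q \<notin> K p \<longrightarrow> \<eta> p q = 0) \<and> (\<forall>q. 0 \<le> \<eta> p q)) \<and>
      (\<forall>q\<in>(\<Union>p\<in>S. W p). (\<Sum>p\<in>S. \<eta> p q) = 1)"
    using S(1)
  proof induction
    case empty
    show ?case by (rule exI[of _ "\<lambda>_ _. 0"]) (simp add: smooth_functions_const)
  next
    case (insert s S)
    then obtain \<eta> where \<eta>: "\<And>p. \<eta> p \<in> smooth_functions A" "\<And>p q. q \<notin> K p \<Longrightarrow> \<eta> p q = 0"
      "\<And>p q. 0 \<le> \<eta> p q" "\<And>q. q \<in> (\<Union>p\<in>S. W p) \<Longrightarrow> (\<Sum>p\<in>S. \<eta> p q) = 1"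
      by blast
    \<comment> \<open>Where the new bump is 1 the old functions are multiplied by zero; elsewhere on
      the covered set they already sum to 1, so the total is again 1.\<close>
    define \<zeta> where "\<zeta> = (\<lambda>p. if p = s then \<psi> s else (\<lambda>q. (1 - \<psi> s q) * \<eta> p q))"
    have "(\<lambda>q. (1 - \<psi> s q) * \<eta> p q) \<in> smooth_functions A" for p
      by (intro smooth_functions_mult smooth_functions_diff smooth_functions_const \<psi> \<eta>)
    then have "\<zeta> p \<in> smooth_functions A \<and> (\<forall>q. q \<notin> K p \<longrightarrow> \<zeta> p q = 0) \<and> (\<forall>q. 0 \<le> \<zeta> p q)" for p
      using \<psi>(1,7,8) \<eta>(2,3) by (simp add: \<zeta>_def)
    moreover have "(\<Sum>p\<in>insert s S. \<zeta> p q) = 1" if q: "q \<in> (\<Union>p\<in>insert s S. W p)" for q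
    proof -
      have "(\<Sum>p\<in>S. \<zeta> p q) = (\<Sum>p\<in>S. (1 - \<psi> s q) * \<eta> p q)"
        using insert(2) by (intro sum.cong) (auto simp: \<zeta>_def)
      then have "(\<Sum>p\<in>insert s S. \<zeta> p q) = \<psi> s q + (1 - \<psi> s q) * (\<Sum>p\<in>S. \<eta> p q)"
        using insert(1,2) by (simp add: \<zeta>_def sum_distrib_left)
      then show ?thesis using q \<psi>(6)[of q s] \<eta>(4)[of q] by (cases "q \<in> W s") auto
    qed
    ultimately show ?case by blast
  qed
  then obtain \<eta> where "\<And>p. \<eta> p \<in> smooth_functions A" "\<And>p q. q \<notin> K p \<Longrightarrow> \<eta> p q = 0"
      "\<And>p q. 0 \<le> \<eta> p q" "\<And>q. (\<Sum>p\<in>S. \<eta> p q) = 1"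
    unfolding S(2) by blast
  from that[OF S(1) this(1) \<psi>(2,3) this(2-4)] show thesis .
qed

end

section \<open>The divergence theorem for a parallel density\<close>

locale parallel_volume = symmetric_connection A nabla for A :: "('m::t2_space, 'n::finite) chart set" and nabla +
  fixes E :: "('m, 'n) field" and c :: "'m \<Rightarrow> ('m, 'n) chart" and a r e f
  assumes ld: "log_density (c p) (a p) (r p) (e p) (f p)"
    and cover: "p \<in> coordinate_ball (c p) (a p) (r p)"
    and compat: "x \<in> coordinate_ball (c p) (a p) (r p) \<Longrightarrow> x \<in> coordinate_ball (c q) (a q) (r q) \<Longrightarrow>
      exp (f p (snd (c p) x)) = \<bar>det (matrix (jac (c p) (c q) x))\<bar> * exp (f q (snd (c q) x))"
    and E: "E \<in> vector_fields A" "X \<in> vector_fields A \<Longrightarrow> nabla X E = X"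
begin

abbreviation "V p \<equiv> coordinate_ball (c p) (a p) (r p)"
abbreviation "B p \<equiv> ball (a p) (r p)"

lemma fr: "frame (c p) (a p) (r p) (e p)"
  using ld by (simp add: log_density_def)

lemma c: "c p \<in> A" using fr[of p] unfolding frame_def by blast

lemma V_chart: "x \<in> V p \<Longrightarrow> x \<in> fst (c p)" by (simp add: coordinate_ball_def)

lemma B_sub: "B p \<subseteq> snd (c p) ` fst (c p)" using fr[of p] unfolding frame_def by blast

lemma B_V:
  assumes "y \<in> B p"
  obtains x where "x \<in> V p" "y = snd (c p) x"
proof -
  interpret F: symmetric_framed_connection A nabla "c p" "a p" "r p" "e p" using fr by (rule symmetric_framed)
  show thesis using F.ball_patch[OF assms] that by blast
qed

lemma V_B: "x \<in> V p \<Longrightarrow> snd (c p) x \<in> B p" by (simp add: coordinate_ball_def)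

definition integrand :: "'m \<Rightarrow> ('m \<Rightarrow> real) \<Rightarrow> real ^ 'n \<Rightarrow> real" where
  "integrand p h = (\<lambda>y. if y \<in> B p then in_chart (c p) h y * exp (f p y) else 0)"

text \<open>Stands for the integral of \<open>h\<close> over the manifold when \<open>h\<close> has
  compact support in the ball \<open>V p\<close>.\<close>

definition mass :: "'m \<Rightarrow> ('m \<Rightarrow> real) \<Rightarrow> real" where
  "mass p h = (\<integral>y. integrand p h y \<partial>lborel)"

definition supported :: "'m set \<Rightarrow> ('m \<Rightarrow> real) \<Rightarrow> bool" where
  "supported U h \<longleftrightarrow> h \<in> smooth_functions A \<and> (\<exists>K. compact K \<and> K \<subseteq> U \<and> (\<forall>q. q \<notin> K \<longrightarrow> h q = 0))"

lemma continuous_f: "continuous_on (B p) (f p)"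
proof (rule continuous_at_imp_continuous_on, rule ballI)
  fix y assume "y \<in> B p"
  then obtain x where "x \<in> V p" "y = snd (c p) x" by (rule B_V)
  then show "isCont (f p) y"
    using ld[of p] has_derivative_continuous unfolding log_density_def by blast
qed

lemma chart_image_compact:
  assumes "compact K" "K \<subseteq> V p"
  shows "compact (snd (c p) ` K)" "snd (c p) ` K \<subseteq> B p"
    "\<And>y. y \<in> B p - snd (c p) ` K \<Longrightarrow> inv_into (fst (c p)) (snd (c p)) y \<notin> K"
proof -
  show "compact (snd (c p) ` K)"
    using assms V_chart
    by (intro compact_continuous_image continuous_on_subset[OF continuous_chart[OF c]]) auto
  show "snd (c p) ` K \<subseteq> B p" using assms V_B by blast
  fix y assume y: "y \<in> B p - snd (c p) ` K"
  then obtain x where "x \<in> V p" "y = snd (c p) x" using B_V by blast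
  then show "inv_into (fst (c p)) (snd (c p)) y \<notin> K" using y V_chart c by auto
qed

lemma integrand_continuous:
  assumes "supported (V p) h"
  shows "continuous_on UNIV (integrand p h)" "integrable lborel (integrand p h)"
proof -
  obtain K where h: "h \<in> smooth_functions A" and K: "compact K" "K \<subseteq> V p" "\<And>q. q \<notin> K \<Longrightarrow> h q = 0"
    using assms unfolding supported_def by blast
  note K' = chart_image_compact[OF K(1,2)]
  have ch: "continuous_on (B p) (\<lambda>y. in_chart (c p) h y * exp (f p y))"
    by (intro continuous_intros continuous_f continuous_on_subset[OF _ B_sub]
        smooth_on_imp_continuous_on smooth_functionD h c)
  have zh: "in_chart (c p) h y * exp (f p y) = 0" if "y \<in> B p - snd (c p) ` K" for y
    using K'(3)[OF that] K(3) by (simp add: in_chart_def)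
  show "continuous_on UNIV (integrand p h)" "integrable lborel (integrand p h)"
    unfolding integrand_def
    by (rule continuous_cutoff(1)[OF K'(1,2) zh ch], assumption)
      (rule continuous_cutoff(2)[OF K'(1,2) zh ch], assumption)
qed

lemma supported_mult:
  assumes "supported U h" "supported U' k"
  shows "supported (U \<inter> U') (\<lambda>q. h q * k q)"
proof -
  obtain K K' where K: "compact K" "K \<subseteq> U" "\<And>q. q \<notin> K \<Longrightarrow> h q = 0"
    "compact K'" "K' \<subseteq> U'" "\<And>q. q \<notin> K' \<Longrightarrow> k q = 0"
    using assms unfolding supported_def by blast
  then have "compact (K \<inter> K')" "K \<inter> K' \<subseteq> U \<inter> U'" "\<forall>q. q \<notin> K \<inter> K' \<longrightarrow> h q * k q = 0"
    by (auto intro: compact_Int)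
  moreover have "(\<lambda>q. h q * k q) \<in> smooth_functions A"
    using assms by (intro smooth_functions_mult) (auto simp: supported_def)
  ultimately show ?thesis unfolding supported_def by blast
qed

lemma supported_mono: "supported U h \<Longrightarrow> U \<subseteq> U' \<Longrightarrow> supported U' h"
  unfolding supported_def by blast

lemma mass_sum:
  assumes "finite S" "\<And>i. i \<in> S \<Longrightarrow> supported (V p) (h i)"
  shows "mass p (\<lambda>q. \<Sum>i\<in>S. h i q) = (\<Sum>i\<in>S. mass p (h i))"
proof -
  have "integrand p (\<lambda>q. \<Sum>i\<in>S. h i q) = (\<lambda>y. \<Sum>i\<in>S. integrand p (h i) y)"
    by (simp add: integrand_def in_chart_def fun_eq_iff sum_distrib_right)
  then show ?thesis
    unfolding mass_def using integrand_continuous(2)[OF assms(2)]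
    by (simp add: Bochner_Integration.integral_sum)
qed

text \<open>The compatibility \<open>compat\<close> of the densities is the Jacobian factor of the
  substitution. Both integrands vanish off the images of the overlap because \<open>h\<close> is
  supported in it.\<close>

lemma mass_change:
  assumes h: "supported (V p \<inter> V q) h"
  shows "mass p h = mass q h"
proof -
  obtain K where K: "compact K" "K \<subseteq> V p \<inter> V q" "\<And>x. x \<notin> K \<Longrightarrow> h x = 0"
    using h unfolding supported_def by blast
  let ?S = "snd (c p) ` (V p \<inter> V q)"
  let ?g = "in_chart (c p) (snd (c q))"
  have g: "?g (snd (c p) x) = snd (c q) x" if "x \<in> V p" for x using that c V_chart by simp
  have gS: "?g ` ?S = snd (c q) ` (V p \<inter> V q)" using g by (force simp: image_image)
  have off: "integrand u h y = 0" if "y \<notin> snd (c u) ` (V p \<inter> V q)" for u y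
  proof (cases "y \<in> B u")
    case True
    then obtain x where x: "x \<in> V u" "y = snd (c u) x" by (rule B_V)
    then have "x \<notin> K" using that K(2) by blast
    then show ?thesis using x K(3) c V_chart by (simp add: integrand_def)
  qed (simp add: integrand_def)
  have "(\<integral>y. integrand p h y \<partial>lborel) = (\<integral>y. integrand q h y \<partial>lborel)"
  proof (rule integral_change_of_variables[of ?S ?g "\<lambda>y. jac (c p) (c q) (inv_into (fst (c p)) (snd (c p)) y)"])
    show "open ?S"
      using V_chart by (intro open_chart_image_subset open_Int open_coordinate_ball c) auto
    show "(?g has_derivative jac (c p) (c q) (inv_into (fst (c p)) (snd (c p)) y)) (at y)" if y: "y \<in> ?S" for y
    proof -
      obtain x where x: "x \<in> V p" "x \<in> V q" "y = snd (c p) x" using y by blast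
      then show ?thesis using transition_has_derivative[OF c c, of x p q] V_chart c by simp
    qed
    show "inj_on ?g ?S"
    proof (rule inj_onI)
      fix y z assume yz: "y \<in> ?S" "z \<in> ?S" "?g y = ?g z"
      then obtain u v where u: "u \<in> V p" "u \<in> V q" "y = snd (c p) u" and v: "v \<in> V p" "v \<in> V q" "z = snd (c p) v"
        by blast
      then have "snd (c q) u = snd (c q) v" using yz(3) g by simp
      then have "u = v" using chart_inj[OF c[of q]] V_chart u v by (meson inj_onD)
      then show "y = z" using u v by simp
    qed
    show "integrable lborel (integrand p h)" "integrable lborel (integrand q h)"
      using integrand_continuous(2) supported_mono[OF h] by blast+
    show "integrand p h y = \<bar>det (matrix (jac (c p) (c q) (inv_into (fst (c p)) (snd (c p)) y)))\<bar> * integrand q h (?g y)"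
      if y: "y \<in> ?S" for y
    proof -
      obtain x where x: "x \<in> V p" "x \<in> V q" "y = snd (c p) x" using y by blast
      have "integrand p h y = h x * exp (f p (snd (c p) x))"
        using x V_B c V_chart by (simp add: integrand_def)
      also have "\<dots> = \<bar>det (matrix (jac (c p) (c q) x))\<bar> * (h x * exp (f q (snd (c q) x)))"
        using compat[OF x(1,2)] by simp
      also have "h x * exp (f q (snd (c q) x)) = integrand q h (?g y)"
        using x V_B[OF x(2)] c V_chart g by (simp add: integrand_def)
      finally show ?thesis using x c V_chart by simp
    qed
    show "integrand p h y = 0" if "y \<notin> ?S" for y using off that by blast
    show "integrand q h y = 0" if "y \<notin> ?g ` ?S" for y using off that unfolding gS by blast
  qed
  then show ?thesis by (simp add: mass_def)
qed

text \<open>The function E h. The chart \<open>c q\<close> is only a reference; by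
  \<open>E_deriv_eq\<close> any chart around \<open>q\<close> gives the same value.\<close>

definition E_deriv :: "('m \<Rightarrow> real) \<Rightarrow> 'm \<Rightarrow> real" where
  "E_deriv h q = chart_deriv (c q) h q (E (c q) q)"

lemma E_deriv_eq:
  assumes h: "h \<in> smooth_functions A" and d: "d \<in> A" "q \<in> fst d"
  shows "E_deriv h q = chart_deriv d h q (E d q)"
proof -
  have q: "q \<in> fst (c q)" using V_chart cover by blast
  have "in_chart (c q) h differentiable at (snd (c q) q)"
    using smooth_on_differentiable[OF smooth_functionD[OF h c]] q by blast
  then have "chart_deriv d h q (E d q) = chart_deriv (c q) h q (jac d (c q) q (E d q))"
    by (rule chart_deriv_change[OF d(1) c d(2) q])
  also have "jac d (c q) q (E d q) = E (c q) q"
    by (rule vector_field_change[OF E(1) d(1) c d(2) q, symmetric])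
  finally show ?thesis by (simp add: E_deriv_def)
qed

lemma E_deriv_smooth:
  assumes h: "h \<in> smooth_functions A"
  shows "E_deriv h \<in> smooth_functions A"
  unfolding smooth_functions_def
proof (intro CollectI ballI)
  fix d assume d: "d \<in> A"
  let ?U = "snd d ` fst d"
  have "smooth_on ?U (\<lambda>y. \<Sum>b\<in>Basis. (in_chart d (E d) y \<bullet> b) *\<^sub>R frechet_derivative (in_chart d h) (at y) b)"
    by (intro smooth_on_sum smooth_on_scaleR open_chart_image d smooth_on_frechet_derivative smooth_functionD h
        smooth_on_bounded_linear_comp[OF bounded_linear_inner_left] vector_field_smooth E)
  then show "smooth_on ?U (in_chart d (E_deriv h))"
  proof (rule smooth_on_cong[OF open_chart_image[OF d], rotated])
    fix y assume "y \<in> ?U"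
    then obtain q where q: "q \<in> fst d" "y = snd d q" by blast
    interpret L: linear "chart_deriv d h q"
      using smooth_function_has_derivative[OF h d q(1)] by (rule has_derivative_linear)
    have "E_deriv h q = chart_deriv d h q (\<Sum>b\<in>Basis. (E d q \<bullet> b) *\<^sub>R b)"
      using E_deriv_eq[OF h d q(1)] by (simp add: euclidean_representation)
    then show "(\<Sum>b\<in>Basis. (in_chart d (E d) y \<bullet> b) *\<^sub>R frechet_derivative (in_chart d h) (at y) b) =
        in_chart d (E_deriv h) y"
      using q d unfolding L.sum L.scale by (simp add: chart_deriv_def)
  qed
qed

lemma E_deriv_supported:
  assumes h: "supported U h"
  shows "supported U (E_deriv h)"
proof -
  obtain K where sm: "h \<in> smooth_functions A" and K: "compact K" "K \<subseteq> U" "\<And>x. x \<notin> K \<Longrightarrow> h x = 0"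
    using h unfolding supported_def by blast
  have "E_deriv h q = 0" if q: "q \<notin> K" for q
  proof -
    have "chart_deriv (c q) h q = chart_deriv (c q) (\<lambda>_. 0) q"
      by (rule chart_deriv_cong[OF c, of "- K"])
        (use q K cover V_chart in \<open>auto simp: compact_imp_closed\<close>)
    then show ?thesis by (simp add: E_deriv_def chart_deriv_const)
  qed
  with K E_deriv_smooth[OF sm] show ?thesis unfolding supported_def by blast
qed

lemma E_deriv_sum:
  assumes "finite S" "\<And>i. i \<in> S \<Longrightarrow> h i \<in> smooth_functions A"
  shows "E_deriv (\<lambda>q. \<Sum>i\<in>S. h i q) q = (\<Sum>i\<in>S. E_deriv (h i) q)"
proof -
  have q: "q \<in> fst (c q)" using V_chart cover by blast
  have "((\<lambda>y. \<Sum>i\<in>S. in_chart (c q) (h i) y) has_derivative (\<lambda>v. \<Sum>i\<in>S. chart_deriv (c q) (h i) q v)) (at (snd (c q) q))"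
    by (intro has_derivative_sum smooth_function_has_derivative assms c q)
  then have "(in_chart (c q) (\<lambda>q. \<Sum>i\<in>S. h i q) has_derivative (\<lambda>v. \<Sum>i\<in>S. chart_deriv (c q) (h i) q v)) (at (snd (c q) q))"
    by (simp add: in_chart_def o_def)
  then show ?thesis unfolding E_deriv_def by (rule chart_deriv_eqI)
qed

text \<open>The divergence theorem for the field \<open>h E\<close>, whose divergence with respect to the parallel
  density is \<open>n h + E h\<close>.\<close>

lemma mass_divergence:
  assumes h: "supported (V p) h"
  shows "mass p (\<lambda>q. real CARD('n) * h q + E_deriv h q) = 0"
proof -
  interpret F: symmetric_framed_connection A nabla "c p" "a p" "r p" "e p" using fr by (rule symmetric_framed)
  let ?c = "c p"
  obtain K where sm: "h \<in> smooth_functions A" and K: "compact K" "K \<subseteq> V p" "\<And>q. q \<notin> K \<Longrightarrow> h q = 0"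
    using h unfolding supported_def by blast
  note K' = chart_image_compact[OF K(1,2)]
  let ?h = "in_chart ?c h" and ?E = "in_chart ?c (E ?c)"
  let ?dh = "\<lambda>y. frechet_derivative ?h (at y)" and ?dE = "\<lambda>y. frechet_derivative ?E (at y)"
  let ?T = "\<lambda>v. in_chart ?c (F.trace_form v)"
  \<comment> \<open>The \<open>k\<close>-th component of h E times the density. Its derivative in
    the \<open>k\<close>-th direction, summed over \<open>k\<close>, is the divergence times the
    density, and each summand has integral zero.\<close>
  define g where "g = (\<lambda>k y. (?h y * ?E y $ k) * exp (f p y))"
  define g' where "g' = (\<lambda>k y v. (?h y * ?E y $ k) * (?T v y * exp (f p y)) + (?h y * ?dE y v $ k + ?dh y v * ?E y $ k) * exp (f p y))"
  have sh: "smooth_on (B p) ?h" and sE: "smooth_on (B p) ?E"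
    using smooth_on_subset[OF _ B_sub] smooth_functionD[OF sm c] vector_field_smooth[OF E(1) c] by blast+
  have dg: "(g k has_derivative g' k y) (at y)" if y: "y \<in> B p" for k y
  proof -
    obtain x where x: "x \<in> V p" "y = snd ?c x" using B_V[OF y] .
    have "(f p has_derivative (\<lambda>v. ?T v y)) (at y)"
      using ld[of p] x c V_chart[OF x(1)] by (simp add: log_density_def)
    then show ?thesis
      unfolding g_def g'_def
      by (intro has_derivative_mult has_derivative_exp smooth_on_has_derivative[OF sh y]
          bounded_linear.has_derivative[OF bounded_linear_vec_nth smooth_on_has_derivative[OF sE y]])
  qed
  have contg: "continuous_on (B p) (\<lambda>y. g' k y v)" for k v
    unfolding g'_def
    by (intro continuous_intros continuous_f smooth_on_imp_continuous_on[OF sh] smooth_on_imp_continuous_on[OF sE]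
        smooth_on_imp_continuous_on[OF smooth_on_frechet_derivative[OF sh]]
        smooth_on_imp_continuous_on[OF smooth_on_frechet_derivative[OF sE]]
        continuous_on_subset[OF smooth_on_imp_continuous_on[OF F.smooth_on_trace_form] B_sub])
  have supp: "g k y = 0" if "y \<in> B p - snd ?c ` K" for k y
    using K'(3)[OF that] K(3) by (simp add: g_def in_chart_def)
  note 0 = cutoff_derivative_integral_0[OF K'(1,2) supp dg contg]
  have "integrand p (\<lambda>q. real CARD('n) * h q + E_deriv h q) y =
      (\<Sum>k\<in>UNIV. if y \<in> B p then g' k y (axis k 1) else 0)" for y
  proof (cases "y \<in> B p")
    case True
    then obtain x where x: "x \<in> V p" "y = snd ?c x" by (rule B_V)
    have xc: "x \<in> fst ?c" by (rule V_chart[OF x(1)])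
    interpret L: linear "?dh y" using smooth_on_has_derivative[OF sh True] by (rule has_derivative_linear)
    have "E_deriv h x = ?dh y (E ?c x)"
      using E_deriv_eq[OF sm c xc] x by (simp add: chart_deriv_def)
    also have "\<dots> = ?dh y (\<Sum>k\<in>UNIV. E ?c x $ k *\<^sub>R axis k 1)"
      using basis_expansion[of "E ?c x"] by (simp add: scalar_mult_eq_scaleR)
    also have "\<dots> = (\<Sum>k\<in>UNIV. E ?c x $ k * ?dh y (axis k 1))" by (simp add: L.sum L.scale)
    finally have 1: "E_deriv h x = (\<Sum>k\<in>UNIV. E ?c x $ k * ?dh y (axis k 1))" .
    have "trace (matrix (chart_deriv ?c (E ?c) x)) + F.trace_form (E ?c x) x = real CARD('n)"
      by (rule F.divergence_formula[OF E(1) E(2)[OF F.frame_field] x(1)])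
    then have 2: "(\<Sum>k\<in>UNIV. ?dE y (axis k 1) $ k) + (\<Sum>k\<in>UNIV. F.trace_form (axis k 1) x * E ?c x $ k) = real CARD('n)"
      using F.trace_form_coordinates[of "E ?c x" x] x(2) by (simp add: trace_matrix chart_deriv_def)
    \<comment> \<open>The product rule yields three sums. Differentiating the density contributes
      the trace form at \<open>E\<close>, which joins the trace of the derivative of
      \<open>E\<close> to give the dimension by \<open>divergence_formula\<close>; the third sum is
      E h.\<close>
    have "(\<Sum>k\<in>UNIV. g' k y (axis k 1)) = (\<Sum>k\<in>UNIV. exp (f p y) * (h x * (F.trace_form (axis k 1) x * E ?c x $ k) +
        h x * ?dE y (axis k 1) $ k + E ?c x $ k * ?dh y (axis k 1)))"
      using x(2) xc c by (intro sum.cong) (simp_all add: g'_def algebra_simps)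
    also have "\<dots> = exp (f p y) * (h x * (\<Sum>k\<in>UNIV. F.trace_form (axis k 1) x * E ?c x $ k) +
        h x * (\<Sum>k\<in>UNIV. ?dE y (axis k 1) $ k) + (\<Sum>k\<in>UNIV. E ?c x $ k * ?dh y (axis k 1)))"
      by (simp add: sum_distrib_left[symmetric] sum.distrib)
    also have "\<dots> = exp (f p y) * (h x * real CARD('n) + E_deriv h x)"
      unfolding 1 2[symmetric] by (simp add: algebra_simps)
    finally show ?thesis using True x(2) xc c by (simp add: integrand_def mult.commute)
  qed (simp add: integrand_def)
  then have "mass p (\<lambda>q. real CARD('n) * h q + E_deriv h q) =
      (\<integral>y. (\<Sum>k\<in>UNIV. if y \<in> B p then g' k y (axis k 1) else 0) \<partial>lborel)"
    by (simp only: mass_def)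
  also have "\<dots> = (\<Sum>k\<in>UNIV. \<integral>y. (if y \<in> B p then g' k y (axis k 1) else 0) \<partial>lborel)"
    by (rule Bochner_Integration.integral_sum) (rule 0(1))
  also have "\<dots> = 0" by (simp only: 0(2) sum.neutral_const)
  finally show ?thesis .
qed

lemma mass_divergence':
  assumes h: "supported (V p) h"
  shows "real CARD('n) * mass p h + mass p (E_deriv h) = 0"
proof -
  have "integrand p (\<lambda>q. real CARD('n) * h q + E_deriv h q) = (\<lambda>y. real CARD('n) * integrand p h y + integrand p (E_deriv h) y)"
    by (simp add: integrand_def in_chart_def fun_eq_iff algebra_simps)
  then have "mass p (\<lambda>q. real CARD('n) * h q + E_deriv h q) = real CARD('n) * mass p h + mass p (E_deriv h)"
    unfolding mass_def
    using integrand_continuous(2)[OF h] integrand_continuous(2)[OF E_deriv_supported[OF h]] by simp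
  then show ?thesis using mass_divergence[OF h] by simp
qed

text \<open>The local divergence identities for the functions of a partition of unity add up to n
  times the total volume plus the total integral of the derivatives along \<open>E\<close>. The
  latter vanishes because the partition sums to the constant 1. A vanishing total volume contradicts
  positivity of the density.\<close>

lemma not_compact: "\<not> compact (UNIV :: 'm set)"
proof
  assume cpt: "compact (UNIV :: 'm set)"
  have oV: "open (V p)" for p using open_coordinate_ball c by blast
  have Vc: "V p \<subseteq> fst (c p)" for p using V_chart by blast
  obtain S \<eta> K where \<eta>: "finite S" "\<And>p. \<eta> p \<in> smooth_functions A" "\<And>p. compact (K p)" "\<And>p. K p \<subseteq> V p"
    "\<And>p q. q \<notin> K p \<Longrightarrow> \<eta> p q = 0" "\<And>p q. 0 \<le> \<eta> p q" "\<And>q. (\<Sum>p\<in>S. \<eta> p q) = 1"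
    by (rule partition_of_unity[of c V, OF cpt c cover oV Vc]) (rule that)
  have sup: "supported (V p) (\<eta> p)" for p
    unfolding supported_def using \<eta>(2-5) by (intro conjI exI[of _ "K p"]) auto
  have sup': "supported (V p \<inter> V q) (\<lambda>x. E_deriv (\<eta> p) x * \<eta> q x)" for p q
    by (rule supported_mult[OF E_deriv_supported[OF sup] sup])
  have "E_deriv (\<lambda>q. \<Sum>p\<in>S. \<eta> p q) q = 0" for q
    unfolding \<eta>(7) by (simp add: E_deriv_def chart_deriv_const)
  then have sum0: "(\<Sum>p\<in>S. E_deriv (\<eta> p) q) = 0" for q
    using E_deriv_sum[OF \<eta>(1), of \<eta>] \<eta>(2) by simp
  \<comment> \<open>The terms belong to different balls and cannot be added directly. A second
    factor from the partition places each product in an overlap, where \<open>mass_change\<close>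
    moves it to the other ball; after exchanging the sums, all terms in one ball carry the same
    factor \<open>\<eta> q\<close> and the derivatives add up to zero.\<close>
  have "(\<Sum>p\<in>S. mass p (E_deriv (\<eta> p))) = (\<Sum>p\<in>S. \<Sum>q\<in>S. mass p (\<lambda>x. E_deriv (\<eta> p) x * \<eta> q x))"
  proof (rule sum.cong[OF refl])
    fix p
    have "E_deriv (\<eta> p) = (\<lambda>x. \<Sum>q\<in>S. E_deriv (\<eta> p) x * \<eta> q x)"
      using \<eta>(7) by (simp add: sum_distrib_left[symmetric])
    moreover have "mass p (\<lambda>x. \<Sum>q\<in>S. E_deriv (\<eta> p) x * \<eta> q x) = (\<Sum>q\<in>S. mass p (\<lambda>x. E_deriv (\<eta> p) x * \<eta> q x))"
      using supported_mono[OF sup'] by (intro mass_sum \<eta>(1)) blast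
    ultimately show "mass p (E_deriv (\<eta> p)) = (\<Sum>q\<in>S. mass p (\<lambda>x. E_deriv (\<eta> p) x * \<eta> q x))" by simp
  qed
  also have "\<dots> = (\<Sum>p\<in>S. \<Sum>q\<in>S. mass q (\<lambda>x. E_deriv (\<eta> p) x * \<eta> q x))"
    by (intro sum.cong refl mass_change sup')
  also have "\<dots> = (\<Sum>q\<in>S. \<Sum>p\<in>S. mass q (\<lambda>x. E_deriv (\<eta> p) x * \<eta> q x))"
    by (rule sum.swap)
  also have "\<dots> = (\<Sum>q\<in>S. mass q (\<lambda>x. \<Sum>p\<in>S. E_deriv (\<eta> p) x * \<eta> q x))"
    using supported_mono[OF sup'] by (intro sum.cong refl mass_sum[symmetric] \<eta>(1)) blast
  also have "\<dots> = (\<Sum>q\<in>S. mass q (\<lambda>x. 0))"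
    by (simp add: sum_distrib_right[symmetric] sum0)
  also have "\<dots> = 0"
  proof -
    have "integrand q (\<lambda>x. 0) = (\<lambda>y. 0)" for q by (simp add: integrand_def in_chart_def fun_eq_iff)
    then show ?thesis by (simp add: mass_def)
  qed
  finally have "(\<Sum>p\<in>S. mass p (E_deriv (\<eta> p))) = 0" .
  moreover have "(\<Sum>p\<in>S. real CARD('n) * mass p (\<eta> p) + mass p (E_deriv (\<eta> p))) = 0"
    using mass_divergence'[OF sup] by simp
  ultimately have "real CARD('n) * (\<Sum>p\<in>S. mass p (\<eta> p)) = 0"
    by (simp add: sum.distrib sum_distrib_left)
  \<comment> \<open>The index type is nonempty, so the dimension is positive and can be
    cancelled.\<close>
  then have total: "(\<Sum>p\<in>S. mass p (\<eta> p)) = 0" by simp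
  have nonneg: "0 \<le> integrand p (\<eta> p) y" for p y
    using \<eta>(6) by (simp add: integrand_def in_chart_def)
  then have mass_nonneg: "0 \<le> mass p (\<eta> p)" for p
    unfolding mass_def by (rule Bochner_Integration.integral_nonneg)
  have "\<forall>p\<in>S. mass p (\<eta> p) = 0"
    using sum_nonneg_eq_0_iff[OF \<eta>(1), of "\<lambda>p. mass p (\<eta> p)", OF mass_nonneg] total by (rule iffD1)
  then have mass0: "mass p (\<eta> p) = 0" if "p \<in> S" for p using that ..
  \<comment> \<open>A continuous nonnegative integrand with integral zero vanishes, and the
    exponential factor is positive, so every function of the partition would be zero although they
    sum to 1.\<close>
  have "\<eta> p q = 0" if p: "p \<in> S" for p q
  proof (cases "q \<in> V p")
    case True
    have "integrand p (\<eta> p) (snd (c p) q) = 0"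
      by (rule continuous_nonneg_integral_0[OF integrand_continuous(1)[OF sup] nonneg
            integrand_continuous(2)[OF sup] mass0[OF p, unfolded mass_def]])
    then show ?thesis using V_B[OF True] V_chart[OF True] c by (simp add: integrand_def)
  next
    case False
    then have "q \<notin> K p" using \<eta>(4)[of p] by blast
    then show ?thesis by (rule \<eta>(5))
  qed
  then have "(\<Sum>p\<in>S. \<eta> p q) = 0" for q by simp
  then show False using \<eta>(7) by simp
qed

end

theorem lemma3p21:
  fixes A :: "('m::{t2_space, second_countable_topology}, 'n::finite) chart set"
  assumes "smooth_manifold A"
    and "compact (UNIV :: 'm set)"
    and "betti_number 1 (euclidean :: 'm topology) = 0"
  shows "\<not> (\<exists>nabla E. radiant_structure A nabla E \<and> ricci_symmetric A nabla)"
proof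
  assume "\<exists>nabla E. radiant_structure A nabla E \<and> ricci_symmetric A nabla"
  then obtain nabla E where rad: "radiant_structure A nabla E" and ric: "ricci_symmetric A nabla"
    by blast
  interpret symmetric_connection A nabla
    using rad assms(1) unfolding radiant_structure_def smooth_manifold_def by unfold_locales blast+
  obtain c a r e f where
    "\<And>p. log_density (c p) (a p) (r p) (e p) (f p)" "\<And>p. p \<in> coordinate_ball (c p) (a p) (r p)"
    "\<And>p q x. x \<in> coordinate_ball (c p) (a p) (r p) \<Longrightarrow> x \<in> coordinate_ball (c q) (a q) (r q) \<Longrightarrow>
      exp (f p (snd (c p) x)) = \<bar>det (matrix (jac (c p) (c q) x))\<bar> * exp (f q (snd (c q) x))"
    by (rule parallel_density[OF ric assms(3)]) (rule that)
  then interpret parallel_volume A nabla E c a r e f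
    using rad unfolding radiant_structure_def by unfold_locales blast+
  show False using not_compact assms(2) by contradiction
qed

end
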